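(* Let $\mathfrak{g}$ be a simply laced simple Lie algebra of rank $l$ with root lattice $Q$, weight lattice $P$, simple roots $\alpha_1,\ldots,\alpha_l$ and fundamental weights $\lambda_1,\ldots,\lambda_l$. Let $W_Q\subset V_Q$ be the Feigin–Stoyanovsky principal subspace, i.e. the vertex subalgebra generated by $e^{\alpha_1},\ldots,e^{\alpha_l}$, and let $W_P\subset V_P$ be the generalized principal subspace generated by $e^{\lambda_1},\ldots,e^{\lambda_l}$. Then the commutant $\mathrm{Com}(W_Q,V_Q)$ of $W_Q$ inside $V_Q$ agrees with $$(W_P)^{\overline{0}}=\bigoplus_{\beta\in Q}(W_P)^\beta.$$
   Context: Let $\mathfrak{h}=\mathbb{C}\otimes_{\mathbb{Z}}Q$ with the invariant symmetric bilinear form $(\cdot|\cdot)$ normalized by $(\alpha|\alpha)=2$ for roots $\alpha$; $P\subset\mathfrak{h}$ is the dual lattice of $Q$, with $(\lambda_i|\alpha_j)=\delta_{ij}$. $M(1)=S(\mathfrak{h}\otimes t^{-1}\mathbb{C}[t^{-1}])$; write $h(n)=h\otimes t^n$; for $n<0$, $h(n)$ acts on $M(1)$ by multiplication, and for $n>0$ as the derivation with $h(n)\cdot h'(-m)=n(h|h')\delta_{n,m}$. $V_P=\bigoplus_{\alpha\in P}M(1)\otimes e^\alpha$; $1\otimes e^\alpha$ is written $e^\alpha$, $h(0)$ acts on $M(1)\otimes e^\alpha$ as $(h|\alpha)$, $|0\rangle=e^0$. The unmodified generalized vertex algebra structure is determined by $Y(h(-1)|0\rangle,z)=\sum_{n\in\mathbb{Z}}h(n)z^{-n-1}$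 and $Y(e^\alpha,z)=e^\alpha z^{\alpha(0)}\exp(\sum_{n>0}\frac{\alpha(-n)}nz^n)\exp(-\sum_{n>0}\frac{\alpha(n)}nz^{-n})$, where the operator $e^\alpha$ sends $u\otimes e^\beta$ to $u\otimes e^{\alpha+\beta}$ and $z^{\alpha(0)}$ acts on $M(1)\otimes e^\beta$ as $z^{(\alpha|\beta)}$. Fix a 2-cocycle $\varepsilon:P\times P\to\mathbb{C}^\times$ (so $\varepsilon(\alpha,\beta)\varepsilon(\alpha+\beta,\gamma)=\varepsilon(\beta,\gamma)\varepsilon(\alpha,\beta+\gamma)$, $\varepsilon(\alpha,0)=\varepsilon(0,\alpha)=1$) with $\varepsilon(\alpha,\beta)\varepsilon(\beta,\alpha)^{-1}=(-1)^{(\alpha|\beta)}$ for $\alpha,\beta\in Q$, and modify the vertex operators: $Y(a,z)b$ is replaced by $\varepsilon(\alpha,\beta)Y(a,z)b$ for $a\in M(1)\otimes e^\alpha$, $b\in M(1)\otimes e^\beta$. Then $V_Q=\bigoplus_{\alpha\in Q}M(1)\otimes e^\alpha$ is the usual lattice vertex algebra. Write $Y(a,z)=\sum_{n\in\mathbb{C}}a(n)z^{-n-1}$. The (generalized) vertex subalgebra generated by a set is the smallest translation-invariant subspace containing it and $|0\rangle$ and closed under all products $u(n)v$, $n\in\mathbb{C}$. For $\gamma\in P$, $(W_P)^\gamma=W_P\cap(M(1)\otimes e^\gamma)$. For a subset $S$ of a (generalized) vertex algebra $V$, $\mathrm{Com}(S,V)=\{v\in V\mid v(n)s=0\text{ for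 all }s\in S,\ n>-1\}$. *)

theory Defs
  imports
    "HOL-Analysis.Analysis"
    "HOL-Library.Multiset"
    "HOL-Library.Poly_Mapping"
    "HOL-Computational_Algebra.Formal_Laurent_Series"
begin

section \<open>Simply laced simple Lie algebras\<close>

locale complex_lie_algebra = vector_space scale
  for scale :: "complex \<Rightarrow> 'g::ab_group_add \<Rightarrow> 'g" +
  fixes bracket :: "'g \<Rightarrow> 'g \<Rightarrow> 'g"
  assumes bracket_add_left: "bracket (x + y) z = bracket x z + bracket y z"
    and bracket_add_right: "bracket x (y + z) = bracket x y + bracket x z"
    and bracket_scale_left: "bracket (scale c x) y = scale c (bracket x y)"
    and bracket_scale_right: "bracket x (scale c y) = scale c (bracket x y)"
    and bracket_self: "bracket x x = 0"
    and jacobi: "bracket x (bracket y z) + bracket y (bracket z x) + bracket z (bracket x y) = 0"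
begin

definition lie_ideal :: "'g set \<Rightarrow> bool" where
  "lie_ideal I \<longleftrightarrow> subspace I \<and> (\<forall>x. \<forall>y\<in>I. bracket x y \<in> I)"

text \<open>A Cartan subalgebra of a semisimple Lie algebra: a subalgebra that acts diagonally on
  the Lie algebra (the simultaneous eigenvectors span) and that is its own centralizer.  The
  last condition makes it abelian.\<close>

definition cartan_subalgebra :: "'g set \<Rightarrow> bool" where
  "cartan_subalgebra H \<longleftrightarrow>
     subspace H \<and>
     span {x. \<exists>f. \<forall>h\<in>H. bracket h x = scale (f h) x} = UNIV \<and>
     {x. \<forall>h\<in>H. bracket h x = 0} = H"

definition invariant_form :: "('g \<Rightarrow> 'g \<Rightarrow> complex) \<Rightarrow> bool" where
  "invariant_form \<kappa> \<longleftrightarrow>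
     (\<forall>x y z. \<kappa> (x + y) z = \<kappa> x z + \<kappa> y z) \<and>
     (\<forall>c x y. \<kappa> (scale c x) y = c * \<kappa> x y) \<and>
     (\<forall>x y. \<kappa> x y = \<kappa> y x) \<and>
     (\<forall>x y z. \<kappa> (bracket x y) z = \<kappa> x (bracket y z))"

text \<open>Roots are regarded as elements of the Cartan subalgebra: the functional
  \<open>\<kappa> \<beta>\<close> on \<open>H\<close> is represented by \<open>\<beta>\<close>.\<close>

definition roots :: "'g set \<Rightarrow> ('g \<Rightarrow> 'g \<Rightarrow> complex) \<Rightarrow> 'g set" where
  "roots H \<kappa> =
     {\<beta> \<in> H. \<beta> \<noteq> 0 \<and> (\<exists>x. x \<noteq> 0 \<and> (\<forall>h\<in>H. bracket h x = scale (\<kappa> \<beta> h) x))}"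

end

locale simple_lie_algebra = complex_lie_algebra scale bracket
  for scale :: "complex \<Rightarrow> 'g::ab_group_add \<Rightarrow> 'g" and bracket :: "'g \<Rightarrow> 'g \<Rightarrow> 'g" +
  assumes finite_dim: "\<exists>B. finite B \<and> span B = UNIV"
    and not_abelian: "\<exists>x y. bracket x y \<noteq> 0"
    and ideals_trivial: "lie_ideal I \<Longrightarrow> I = {0} \<or> I = UNIV"

text \<open>An invariant form can be normalized so that every root has square length 2 exactly when
  all roots have the same length.  The rank is the cardinality of the index type of the simple
  roots.\<close>

locale simply_laced_lie_algebra = simple_lie_algebra scale bracket
  for scale :: "complex \<Rightarrow> 'g::ab_group_add \<Rightarrow> 'g" and bracket :: "'g \<Rightarrow> 'g \<Rightarrow> 'g" +
  fixes H :: "'g set"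
    and \<kappa> :: "'g \<Rightarrow> 'g \<Rightarrow> complex"
    and simple_root :: "'l::finite \<Rightarrow> 'g"
  assumes cartan: "cartan_subalgebra H"
    and form: "invariant_form \<kappa>"
    and simply_laced: "\<beta> \<in> roots H \<kappa> \<Longrightarrow> \<kappa> \<beta> \<beta> = 2"
    and simple_root: "simple_root i \<in> roots H \<kappa>"
    and simple_root_inj: "inj simple_root"
    and simple_root_independent: "independent (range simple_root)"
    and simple_root_span: "span (range simple_root) = H"
    and root_decomposition: "\<beta> \<in> roots H \<kappa> \<Longrightarrow>
      \<exists>c :: 'l \<Rightarrow> nat. \<beta> = (\<Sum>i\<in>UNIV. scale (of_nat (c i)) (simple_root i)) \<or>
                       \<beta> = - (\<Sum>i\<in>UNIV. scale (of_nat (c i)) (simple_root i))"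


section \<open>Root and weight lattices\<close>

text \<open>Vectors in \<open>complex ^ 'l\<close> are the coordinates, with respect to the simple roots, of
  elements of \<open>\<complex> \<otimes>\<^sub>\<int> Q\<close>; \<open>A\<close> is the Gram matrix of the simple roots.\<close>

definition bform :: "('l::finite \<Rightarrow> 'l \<Rightarrow> complex) \<Rightarrow> complex ^ 'l \<Rightarrow> complex ^ 'l \<Rightarrow> complex" where
  "bform A x y = (\<Sum>i\<in>UNIV. \<Sum>j\<in>UNIV. vec_nth x i * A i j * vec_nth y j)"

abbreviation sroot :: "'l::finite \<Rightarrow> complex ^ 'l" where
  "sroot i \<equiv> axis i 1"

definition root_lattice :: "(complex ^ 'l::finite) set" where
  "root_lattice = {x. \<forall>i. vec_nth x i \<in> \<int>}"

definition weight_lattice :: "('l::finite \<Rightarrow> 'l \<Rightarrow> complex) \<Rightarrow> (complex ^ 'l) set" where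
  "weight_lattice A = {x. \<forall>y\<in>root_lattice. bform A x y \<in> \<int>}"

definition lattice_cocycle ::
  "('l::finite \<Rightarrow> 'l \<Rightarrow> complex) \<Rightarrow> (complex ^ 'l \<Rightarrow> complex ^ 'l \<Rightarrow> complex) \<Rightarrow> bool" where
  "lattice_cocycle A \<epsilon> \<longleftrightarrow>
     (\<forall>\<alpha>\<in>weight_lattice A. \<forall>\<beta>\<in>weight_lattice A. \<epsilon> \<alpha> \<beta> \<noteq> 0) \<and>
     (\<forall>\<alpha>\<in>weight_lattice A. \<forall>\<beta>\<in>weight_lattice A. \<forall>\<gamma>\<in>weight_lattice A.
        \<epsilon> \<alpha> \<beta> * \<epsilon> (\<alpha> + \<beta>) \<gamma> = \<epsilon> \<beta> \<gamma> * \<epsilon> \<alpha> (\<beta> + \<gamma>)) \<and>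
     (\<forall>\<alpha>\<in>weight_lattice A. \<epsilon> \<alpha> 0 = 1 \<and> \<epsilon> 0 \<alpha> = 1) \<and>
     (\<forall>\<alpha>\<in>root_lattice. \<forall>\<beta>\<in>root_lattice. \<forall>k::int.
        bform A \<alpha> \<beta> = of_int k \<longrightarrow> \<epsilon> \<alpha> \<beta> * inverse (\<epsilon> \<beta> \<alpha>) = (-1) powi k)"


section \<open>The Fock space\<close>

text \<open>\<open>S(\<hh> \<otimes> t\<^sup>-\<^sup>1\<complex>[t\<^sup>-\<^sup>1])\<close> is the polynomial ring in the
  variables \<open>\<alpha>\<^sub>i(-k-1)\<close>, encoded as \<open>(i, k)\<close> with \<open>k \<ge> 0\<close>; monomials are
  multisets of variables.\<close>

type_synonym 'l fock = "('l \<times> nat) multiset \<Rightarrow>\<^sub>0 complex"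

definition fconst :: "complex \<Rightarrow> 'l fock" where
  "fconst c = Poly_Mapping.single {#} c"

definition fvar :: "'l \<Rightarrow> nat \<Rightarrow> 'l fock" where
  "fvar i k = Poly_Mapping.single {#(i, k)#} 1"

text \<open>\<open>creat h n\<close> is \<open>h(-n)\<close>, for \<open>n > 0\<close>.\<close>

definition creat :: "complex ^ 'l \<Rightarrow> nat \<Rightarrow> 'l::finite fock \<Rightarrow> 'l fock" where
  "creat h n p = (\<Sum>i\<in>UNIV. fconst (vec_nth h i) * fvar i (n - 1)) * p"

text \<open>\<open>annih A \<beta> h n\<close> is \<open>h(n)\<close> on \<open>M(1) \<otimes> e\<^sup>\<beta>\<close>, for \<open>n \<ge> 0\<close>.  For
  \<open>n > 0\<close> it is the derivation sending \<open>\<alpha>\<^sub>i(-m)\<close> to \<open>n (h|\<alpha>\<^sub>i) \<delta>\<^sub>n\<^sub>,\<^sub>m\<close>,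
  written out on monomials.\<close>

definition annih ::
  "('l::finite \<Rightarrow> 'l \<Rightarrow> complex) \<Rightarrow> complex ^ 'l \<Rightarrow> complex ^ 'l \<Rightarrow> nat \<Rightarrow> 'l fock \<Rightarrow> 'l fock" where
  "annih A \<beta> h n p =
     (if n = 0 then fconst (bform A h \<beta>) * p
      else \<Sum>\<mu>\<in>Poly_Mapping.keys p. \<Sum>i\<in>UNIV.
        Poly_Mapping.single (\<mu> - {#(i, n - 1)#})
          (Poly_Mapping.lookup p \<mu> * of_nat (count \<mu> (i, n - 1)) *
            (of_nat n * bform A h (sroot i))))"


section \<open>Vertex operators\<close>

text \<open>\<open>op_exp a w\<close> is \<open>exp (\<Sum>\<^sub>n\<^sub>>\<^sub>0 a\<^sub>n s\<^sup>n) w\<close> as a power series in \<open>s\<close>.  The iterated function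
  is the operator \<open>\<Sum>\<^sub>n\<^sub>>\<^sub>0 a\<^sub>n s\<^sup>n\<close> on coefficient sequences; its \<open>j\<close>-th power contributes
  only to the coefficients of \<open>s\<^sup>m\<close> with \<open>m \<ge> j\<close>, so the truncation is exact.\<close>

definition op_exp :: "(nat \<Rightarrow> 'l fock \<Rightarrow> 'l fock) \<Rightarrow> 'l fock \<Rightarrow> 'l fock fps" where
  "op_exp a w = Abs_fps (\<lambda>m. \<Sum>j\<le>m. fconst (1 / fact j) *
     ((\<lambda>W r. \<Sum>n=1..r. a n (W (r - n))) ^^ j) (\<lambda>r. if r = 0 then w else 0) m)"

text \<open>\<open>exp_creat \<alpha>\<close> is \<open>exp (\<Sum>\<^sub>n\<^sub>>\<^sub>0 \<alpha>(-n)/n z\<^sup>n)\<close>, a power series in \<open>z\<close>, and \<open>exp_annih A \<alpha>\<close> is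
  \<open>exp (- \<Sum>\<^sub>n\<^sub>>\<^sub>0 \<alpha>(n)/n z\<^sup>-\<^sup>n)\<close>, a power series in \<open>z\<^sup>-\<^sup>1\<close> (the modes \<open>\<alpha>(n)\<close> with \<open>n > 0\<close> do
  not depend on \<open>\<beta>\<close>).\<close>

definition exp_creat :: "complex ^ 'l::finite \<Rightarrow> 'l fock \<Rightarrow> 'l fock fps" where
  "exp_creat \<alpha> = op_exp (\<lambda>n p. fconst (1 / of_nat n) * creat \<alpha> n p)"

definition exp_annih ::
  "('l::finite \<Rightarrow> 'l \<Rightarrow> complex) \<Rightarrow> complex ^ 'l \<Rightarrow> complex ^ 'l \<Rightarrow> 'l fock \<Rightarrow> 'l fock fps" where
  "exp_annih A \<alpha> \<beta> = op_exp (\<lambda>n p. fconst (- 1 / of_nat n) * annih A \<beta> \<alpha> n p)"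

text \<open>\<open>vexp A \<alpha> \<beta> w\<close> is \<open>z\<^sup>-\<^sup>(\<^sup>\<alpha>\<^sup>|\<^sup>\<beta>\<^sup>) Y(e\<^sup>\<alpha>, z)(w \<otimes> e\<^sup>\<beta>)\<close> with the factor
  \<open>e\<^sup>\<alpha>\<^sup>+\<^sup>\<beta>\<close> omitted; \<open>fls_shift q\<close> is multiplication by \<open>z\<^sup>-\<^sup>q\<close>.\<close>

definition vexp ::
  "('l::finite \<Rightarrow> 'l \<Rightarrow> complex) \<Rightarrow> complex ^ 'l \<Rightarrow> complex ^ 'l \<Rightarrow> 'l fock \<Rightarrow> 'l fock fls" where
  "vexp A \<alpha> \<beta> w = (\<Sum>q | fps_nth (exp_annih A \<alpha> \<beta> w) q \<noteq> 0.
     fls_shift (int q) (fps_to_fls (exp_creat \<alpha> (fps_nth (exp_annih A \<alpha> \<beta> w) q))))"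

text \<open>For a field \<open>F\<close>, \<open>normal_step A \<beta> (i, k) F\<close> is the normally ordered product
  \<open>:\<partial>\<^sup>k \<alpha>\<^sub>i(z) / k! F(z):\<close> on \<open>M(1) \<otimes> e\<^sup>\<beta>\<close>.  With
  \<open>\<alpha>\<^sub>i(z) = \<Sum>\<^sub>n \<alpha>\<^sub>i(n) z\<^sup>-\<^sup>n\<^sup>-\<^sup>1\<close>, the part with modes \<open>n < 0\<close> is placed to the left of \<open>F\<close>
  and the part with modes \<open>n \<ge> 0\<close> to the right.\<close>

fun normal_step ::
  "('l::finite \<Rightarrow> 'l \<Rightarrow> complex) \<Rightarrow> complex ^ 'l \<Rightarrow> 'l \<times> nat \<Rightarrow>
    ('l fock \<Rightarrow> 'l fock fls) \<Rightarrow> 'l fock \<Rightarrow> 'l fock fls" where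
  "normal_step A \<beta> (i, k) F w =
     fps_to_fls (Abs_fps (\<lambda>m. of_nat ((m + k) choose k) * fvar i (m + k))) * F w +
     (\<Sum>n | annih A \<beta> (sroot i) n w \<noteq> 0.
        fls_shift (int (n + k + 1))
          (fls_const (fconst ((-1) ^ k * of_nat ((n + k) choose k))) *
            F (annih A \<beta> (sroot i) n w)))"

text \<open>\<open>z\<^sup>-\<^sup>(\<^sup>\<alpha>\<^sup>|\<^sup>\<beta>\<^sup>) Y(u \<otimes> e\<^sup>\<alpha>, z)(w \<otimes> e\<^sup>\<beta>)\<close>, by the reconstruction formula: a monomial
  \<open>\<Prod>\<^sub>j \<alpha>\<^sub>i\<^sub>j(-k\<^sub>j-1)\<close> times \<open>e\<^sup>\<alpha>\<close> has vertex operator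
  \<open>:\<Prod>\<^sub>j (\<partial>\<^bsup>k\<^sub>j\<^esup> \<alpha>\<^sub>i\<^sub>j(z) / k\<^sub>j!) Y(e\<^sup>\<alpha>, z):\<close>.\<close>

definition vertex_op ::
  "('l::finite \<Rightarrow> 'l \<Rightarrow> complex) \<Rightarrow> complex ^ 'l \<Rightarrow> complex ^ 'l \<Rightarrow>
    'l fock \<Rightarrow> 'l fock \<Rightarrow> 'l fock fls" where
  "vertex_op A \<alpha> \<beta> u w = (\<Sum>\<mu>\<in>Poly_Mapping.keys u.
     fls_const (fconst (Poly_Mapping.lookup u \<mu>)) *
       fold_mset (normal_step A \<beta>) (vexp A \<alpha> \<beta>) \<mu> w)"


section \<open>Lattice generalized vertex algebras\<close>

text \<open>The coefficient of \<open>v\<close> at \<open>\<alpha>\<close> is the component of \<open>v\<close> in \<open>M(1) \<otimes> e\<^sup>\<alpha>\<close>.\<close>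

type_synonym 'l lattice_space = "complex ^ 'l \<Rightarrow>\<^sub>0 'l fock"

definition lattice_va :: "(complex ^ 'l::finite) set \<Rightarrow> 'l lattice_space set" where
  "lattice_va L = {v. Poly_Mapping.keys v \<subseteq> L}"

definition vscale :: "complex \<Rightarrow> 'l::finite lattice_space \<Rightarrow> 'l lattice_space" where
  "vscale c v = Poly_Mapping.map (\<lambda>p. fconst c * p) v"

definition vexpo :: "complex ^ 'l \<Rightarrow> 'l::finite lattice_space" where
  "vexpo \<alpha> = Poly_Mapping.single \<alpha> 1"

definition vac :: "'l::finite lattice_space" where
  "vac = vexpo 0"

text \<open>\<open>vmode A \<epsilon> a n b\<close> is the product \<open>a(n) b\<close>, the coefficient of \<open>z\<^sup>-\<^sup>n\<^sup>-\<^sup>1\<close> in the vertex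
  operator modified by \<open>\<epsilon>\<close>.  The exponents of \<open>z\<close> occurring for charges \<open>\<alpha>\<close>, \<open>\<beta>\<close> are
  \<open>(\<alpha>|\<beta>) + k\<close> with \<open>k\<close> an integer, so the innermost sum has at most one term.\<close>

definition vmode ::
  "('l::finite \<Rightarrow> 'l \<Rightarrow> complex) \<Rightarrow> (complex ^ 'l \<Rightarrow> complex ^ 'l \<Rightarrow> complex) \<Rightarrow>
    'l lattice_space \<Rightarrow> complex \<Rightarrow> 'l lattice_space \<Rightarrow> 'l lattice_space" where
  "vmode A \<epsilon> a n b =
     (\<Sum>\<alpha>\<in>Poly_Mapping.keys a. \<Sum>\<beta>\<in>Poly_Mapping.keys b.
        Poly_Mapping.single (\<alpha> + \<beta>)
          (fconst (\<epsilon> \<alpha> \<beta>) *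
            (\<Sum>k::int | bform A \<alpha> \<beta> + of_int k = - n - 1.
               fls_nth (vertex_op A \<alpha> \<beta> (Poly_Mapping.lookup a \<alpha>) (Poly_Mapping.lookup b \<beta>)) k)))"

definition translation ::
  "('l::finite \<Rightarrow> 'l \<Rightarrow> complex) \<Rightarrow> (complex ^ 'l \<Rightarrow> complex ^ 'l \<Rightarrow> complex) \<Rightarrow>
    'l lattice_space \<Rightarrow> 'l lattice_space" where
  "translation A \<epsilon> v = vmode A \<epsilon> v (-2) vac"

definition vertex_subalgebra ::
  "('l::finite \<Rightarrow> 'l \<Rightarrow> complex) \<Rightarrow> (complex ^ 'l \<Rightarrow> complex ^ 'l \<Rightarrow> complex) \<Rightarrow>
    'l lattice_space set \<Rightarrow> 'l lattice_space set \<Rightarrow> bool" where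
  "vertex_subalgebra A \<epsilon> V U \<longleftrightarrow>
     U \<subseteq> V \<and> module.subspace vscale U \<and> vac \<in> U \<and>
     (\<forall>v\<in>U. translation A \<epsilon> v \<in> U) \<and>
     (\<forall>u\<in>U. \<forall>v\<in>U. \<forall>n. vmode A \<epsilon> u n v \<in> U)"

definition generated_subalgebra ::
  "('l::finite \<Rightarrow> 'l \<Rightarrow> complex) \<Rightarrow> (complex ^ 'l \<Rightarrow> complex ^ 'l \<Rightarrow> complex) \<Rightarrow>
    'l lattice_space set \<Rightarrow> 'l lattice_space set \<Rightarrow> 'l lattice_space set" where
  "generated_subalgebra A \<epsilon> V S = \<Inter> {U. vertex_subalgebra A \<epsilon> V U \<and> S \<subseteq> U}"

text \<open>The condition \<open>n > -1\<close> is meant for real \<open>n\<close>; products with non-real \<open>n\<close> vanish, since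
  the form is real on the lattices.\<close>

definition commutant ::
  "('l::finite \<Rightarrow> 'l \<Rightarrow> complex) \<Rightarrow> (complex ^ 'l \<Rightarrow> complex ^ 'l \<Rightarrow> complex) \<Rightarrow>
    'l lattice_space set \<Rightarrow> 'l lattice_space set \<Rightarrow> 'l lattice_space set" where
  "commutant A \<epsilon> S V =
     {v \<in> V. \<forall>s\<in>S. \<forall>n::real. n > -1 \<longrightarrow> vmode A \<epsilon> v (complex_of_real n) s = 0}"

definition charge_part ::
  "'l::finite lattice_space set \<Rightarrow> complex ^ 'l \<Rightarrow> 'l lattice_space set" where
  "charge_part W \<gamma> = W \<inter> lattice_va {\<gamma>}"

definition principal_Q ::
  "('l::finite \<Rightarrow> 'l \<Rightarrow> complex) \<Rightarrow> (complex ^ 'l \<Rightarrow> complex ^ 'l \<Rightarrow> complex) \<Rightarrow>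
    'l lattice_space set" where
  "principal_Q A \<epsilon> =
     generated_subalgebra A \<epsilon> (lattice_va root_lattice) (range (\<lambda>i. vexpo (sroot i)))"

definition principal_P ::
  "('l::finite \<Rightarrow> 'l \<Rightarrow> complex) \<Rightarrow> (complex ^ 'l \<Rightarrow> complex ^ 'l \<Rightarrow> complex) \<Rightarrow>
    ('l \<Rightarrow> complex ^ 'l) \<Rightarrow> 'l lattice_space set" where
  "principal_P A \<epsilon> fw =
     generated_subalgebra A \<epsilon> (lattice_va (weight_lattice A)) (range (\<lambda>i. vexpo (fw i)))"

end

theory Submission imports Defs begin

text \<open>For \<open>\<gamma> \<in> \<hh>\<close> let \<open>h\<^sub>n(\<gamma>)\<close> be the coefficients of \<open>exp (\<Sum>\<^sub>n\<^sub>>\<^sub>0 \<gamma>(-n)/n z\<^sup>n)\<close>.  The key identity writes the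
  vertex operator of \<open>h\<^sub>n(\<gamma>) u \<otimes> e\<^sup>\<gamma>\<^sup>+\<^sup>\<alpha>\<close> in terms of that of \<open>u \<otimes> e\<^sup>\<alpha>\<close>.  It shows that the span of the
  vectors \<open>h\<^sub>n\<^sub>1(\<gamma>\<^sub>1) \<dots> h\<^sub>n\<^sub>r(\<gamma>\<^sub>r) \<otimes> e\<^sup>\<gamma>\<^sup>1\<^sup>+\<^sup>\<dots>\<^sup>+\<^sup>\<gamma>\<^sup>r\<close> with all \<open>\<gamma>\<^sub>a\<close> in a given family is closed under all products.
  For the fundamental weights this span is \<open>W\<^sub>P\<close>; for the simple roots it contains \<open>W\<^sub>Q\<close>.  As
  \<open>(\<lambda>\<^sub>i|\<alpha>\<^sub>j) = \<delta>\<^sub>i\<^sub>j \<ge> 0\<close>, products between the two spans have no poles, so \<open>(W\<^sub>P)\<^sup>\<beta>\<close> with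
  \<open>\<beta> \<in> Q\<close> lies in the commutant.

  Conversely, \<open>M(1)\<close> is a polynomial ring in the \<open>h\<^sub>n(\<lambda>\<^sub>i)\<close>, \<open>n > 0\<close>.  If \<open>w\<close> has degree \<open>d\<close> in the
  \<open>i\<close>-th group of generators, then \<open>Y(w \<otimes> e\<^sup>\<beta>, z) e\<^sup>\<alpha>\<^sup>i\<close> starts at \<open>z\<^sup>(\<^sup>\<beta>\<^sup>|\<^sup>\<alpha>\<^sup>i\<^sup>)\<^sup>-\<^sup>d\<close> with the top degree
  part of \<open>w\<close>, each \<open>h\<^sub>n(\<lambda>\<^sub>i)\<close> replaced by \<open>h\<^sub>n\<^sub>-\<^sub>1(\<lambda>\<^sub>i)\<close>.  This is nonzero, so commuting with
  \<open>e\<^sup>\<alpha>\<^sup>i\<close> forces \<open>d \<le> (\<beta>|\<alpha>\<^sub>i)\<close>; padding with \<open>h\<^sub>0(\<lambda>\<^sub>i) = 1\<close> puts \<open>w \<otimes> e\<^sup>\<beta>\<close> into \<open>W\<^sub>P\<close>.\<close>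

section \<open>Integrality of the Cartan matrix\<close>

text \<open>The polynomials \<open>hsym \<gamma> n\<close> enter because Y(e^\<gamma>, t)|0> =
  E_\<gamma>(t) e^\<gamma>, where E_\<gamma> is their generating series: up to the factor e^\<gamma>
  they are the translates T^n e^\<gamma> / n!, and Y(E_\<gamma>(t) e^\<gamma>, z) should be
  Y(e^\<gamma>, z + t). The key identity extends this to E_\<gamma>(t) u \<otimes>
  e^(\<gamma>+\<alpha>), whose vertex operator is Y(u \<otimes> e^\<alpha>, z) with the creation
  half of Y(e^\<gamma>, z + t) on its left and the annihilation half on its right. The obstacle is
  that vertex operators are defined through the modes \<alpha>_i(-k-1), which are power sums and not
  complete symmetric polynomials. Newton's identities mediate between the two, and identities of
  exponentials are proved by letting both coefficient sequences satisfy the same recursion. No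
  Borcherds identity is invoked: closure under products, pole bounds and leading terms are read off
  the key identity. From the Lie algebra comes the integrality of the Gram matrix, which places Q
  inside P.\<close>

lemma (in vector_space) eigenvectors_eventually_zero:
  assumes B: "finite B" "span B = UNIV"
    and add: "\<And>x y. T (x + y) = T x + T y"
    and hom: "\<And>c x. T (scale c x) = scale c (T x)"
    and eig: "\<And>n. T (v n) = scale (\<mu> n) (v n)"
    and inj: "inj (\<mu> :: nat \<Rightarrow> 'a)"
  shows "\<exists>n. v n = 0"
proof (rule ccontr)
  assume nz: "\<nexists>n. v n = 0"
  \<comment> \<open>\<open>P N\<close> is the product of the operators \<open>T - \<mu> i\<close>
    for \<open>i < N\<close>. It kills \<open>v 0\<close>, ..., \<open>v (N - 1)\<close> and
    multiplies \<open>v N\<close> by a nonzero scalar, so \<open>v N\<close> is independent of its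
    predecessors, against finite dimension.\<close>
  define P where "P N = rec_nat (\<lambda>x. x) (\<lambda>N f x. T (f x) - scale (\<mu> N) (f x)) N" for N
  have P0: "P 0 x = x" and PS: "P (Suc N) x = T (P N x) - scale (\<mu> N) (P N x)" for N x
    by (simp_all add: P_def)
  have Padd: "P N (x + y) = P N x + P N y" and Phom: "P N (scale c x) = scale c (P N x)" for N x y c
    by (induction N) (simp_all add: P0 PS add hom scale_right_distrib scale_right_diff_distrib mult.commute)
  have Pv: "P N (v m) = scale (\<Prod>i<N. \<mu> m - \<mu> i) (v m)" for N m
  proof (induction N)
    case (Suc N)
    have "P (Suc N) (v m) = scale ((\<Prod>i<N. \<mu> m - \<mu> i) * \<mu> m - \<mu> N * (\<Prod>i<N. \<mu> m - \<mu> i)) (v m)"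
      by (simp only: PS Suc hom eig scale_scale scale_left_diff_distrib)
    then show ?case by (simp add: algebra_simps)
  qed (simp add: P0)
  have Pspan: "P N x = 0" if "x \<in> span (v ` {..<N})" for N x
    using that
  proof (induction rule: span_induct_alt)
    case base
    show ?case using Phom [of N 0 0] by simp
  next
    case (step c x y)
    then obtain m where m: "m < N" "x = v m" by auto
    have "(\<Prod>i<N. \<mu> m - \<mu> i) = 0" using m by auto
    then show ?case using step m by (simp add: Padd Phom Pv)
  qed
  have notin: "v N \<notin> span (v ` {..<N})" for N
  proof
    assume "v N \<in> span (v ` {..<N})"
    then have "scale (\<Prod>i<N. \<mu> N - \<mu> i) (v N) = 0"
      using Pspan [of "v N" N] Pv [of N N] by metis
    moreover have "(\<Prod>i<N. \<mu> N - \<mu> i) \<noteq> 0"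
      using inj by (auto simp: inj_eq)
    ultimately show False using nz by auto
  qed
  have "independent (v ` {..<N}) \<and> card (v ` {..<N}) = N" for N
  proof (induction N)
    case (Suc N)
    have "v N \<notin> v ` {..<N}" using notin [of N] span_base [of "v N"] by metis
    with Suc notin [of N] show ?case
      by (simp only: lessThan_Suc image_insert independent_insert card_insert_disjoint finite_imageI
          finite_lessThan if_False simp_thms)
  qed (simp add: independent_empty)
  then have "N \<le> card B" for N
    using independent_span_bound [OF B(1), of "v ` {..<N}"] B(2) by auto
  from this [of "Suc (card B)"] show False by simp
qed

section \<open>The invariant form, sl2-triples and integrality of root pairings\<close>

context simply_laced_lie_algebra
begin

lemma form_add_left: "\<kappa> (x + y) z = \<kappa> x z + \<kappa> y z"
  and form_scale_left: "\<kappa> (scale c x) z = c * \<kappa> x z"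
  and form_sym: "\<kappa> x z = \<kappa> z x"
  and form_bracket: "\<kappa> (bracket x y) z = \<kappa> x (bracket y z)"
  using form by (auto simp: invariant_form_def)

lemma form_add_right: "\<kappa> z (x + y) = \<kappa> z x + \<kappa> z y"
  and form_scale_right: "\<kappa> z (scale c x) = c * \<kappa> z x"
  by (metis form_add_left form_sym) (metis form_scale_left form_sym)

lemma form_zero [simp]: "\<kappa> 0 x = 0" "\<kappa> x 0 = 0"
  using form_scale_left [of 0 0 x] form_scale_right [of x 0 0] by simp_all

lemma form_minus_left: "\<kappa> (- x) z = - \<kappa> x z" and form_minus_right: "\<kappa> z (- x) = - \<kappa> z x"
  using form_add_left [of x "- x" z] form_add_right [of z x "- x"] by (simp_all add: eq_neg_iff_add_eq_0 add.commute)

lemma form_diff_left: "\<kappa> (x - y) z = \<kappa> x z - \<kappa> y z"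
  using form_add_left [of x "- y" z] by (simp add: form_minus_left)

lemma bracket_zero [simp]: "bracket 0 x = 0" "bracket x 0 = 0"
  using bracket_scale_left [of 0 0 x] bracket_scale_right [of x 0 0] by simp_all

lemma bracket_antisym: "bracket x y = - bracket y x"
proof -
  have "bracket (x + y) (x + y) = 0" by (rule bracket_self)
  then have "bracket x y + bracket y x = 0"
    unfolding bracket_add_left bracket_add_right by (simp add: bracket_self add.commute)
  then show ?thesis by (simp add: eq_neg_iff_add_eq_0)
qed

lemma bracket_minus: "bracket (- x) y = - bracket x y" "bracket x (- y) = - bracket x y"
  using bracket_add_left [of x "- x" y] bracket_add_right [of x y "- y"]
  by (simp_all add: eq_neg_iff_add_eq_0 add.commute)

lemma jacobi_derivation: "bracket x (bracket y z) = bracket (bracket x y) z + bracket y (bracket x z)"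
proof -
  have "bracket x (bracket y z) - bracket y (bracket x z) - bracket (bracket x y) z = 0"
    using jacobi [of x y z] bracket_antisym [of z x] bracket_antisym [of z "bracket x y"]
    by (simp add: bracket_minus)
  then show ?thesis by (simp add: algebra_simps)
qed

text \<open>The radical is an ideal by invariance, and a simple root has square length 2, so
  simplicity leaves only the zero radical.\<close>

lemma form_nondegenerate:
  assumes "\<And>y. \<kappa> x y = 0"
  shows "x = 0"
proof -
  let ?R = "{x. \<forall>y. \<kappa> x y = 0}"
  have "lie_ideal ?R"
    unfolding lie_ideal_def subspace_def
  proof (intro conjI allI ballI)
    fix x y assume "y \<in> ?R"
    then have "\<kappa> (bracket x y) z = 0" for z
      using form_bracket [of y x z] bracket_antisym [of x y] by (simp add: form_minus_left)
    then show "bracket x y \<in> ?R" by simp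
  qed (simp_all add: form_add_left form_scale_left)
  moreover have "?R \<noteq> UNIV"
  proof
    assume "?R = UNIV"
    then have "\<kappa> (simple_root undefined) (simple_root undefined) = 0" by blast
    then show False using simply_laced [OF simple_root, of undefined] by simp
  qed
  ultimately have "?R = {0}" using ideals_trivial by blast
  then show ?thesis using assms by blast
qed

lemma weight_span_form_zero:
  assumes "\<And>x f. (\<And>h. h \<in> H \<Longrightarrow> bracket h x = scale (f h) x) \<Longrightarrow> \<kappa> e x = 0"
  shows "\<kappa> e y = 0"
proof -
  have "y \<in> span {x. \<exists>f. \<forall>h\<in>H. bracket h x = scale (f h) x}"
    using cartan by (auto simp: cartan_subalgebra_def)
  then show ?thesis
  proof (induction rule: span_induct_alt)
    case (step c x y)
    then show ?case using assms by (auto simp: form_add_right form_scale_right)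
  qed simp
qed

text \<open>Nondegeneracy supplies a weight vector that pairs with \<open>e\<close>. Invariance
  forces its weight to be -\<beta>, and rescaling makes the pairing 1, which leaves [e, f] to be
  identified with \<beta>.\<close>

lemma root_sl2_triple:
  assumes "\<beta> \<in> roots H \<kappa>"
  obtains e f where "\<And>h. h \<in> H \<Longrightarrow> bracket h e = scale (\<kappa> \<beta> h) e"
    "\<And>h. h \<in> H \<Longrightarrow> bracket h f = scale (- \<kappa> \<beta> h) f" "bracket e f = \<beta>"
proof -
  have central: "bracket h x = 0" if "x \<in> H" "h \<in> H" for x h
    using cartan that by (auto simp: cartan_subalgebra_def)
  have centralI: "x \<in> H" if "\<And>h. h \<in> H \<Longrightarrow> bracket h x = 0" for x
    using cartan that by (auto simp: cartan_subalgebra_def)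
  have subH: "subspace H" using cartan by (auto simp: cartan_subalgebra_def)
  from assms obtain e where e: "e \<noteq> 0" "\<And>h. h \<in> H \<Longrightarrow> bracket h e = scale (\<kappa> \<beta> h) e" and \<beta>: "\<beta> \<in> H"
    by (auto simp: roots_def)
  obtain x \<phi> where x: "\<kappa> e x \<noteq> 0" "\<And>h. h \<in> H \<Longrightarrow> bracket h x = scale (\<phi> h) x"
    using form_nondegenerate [of e] weight_span_form_zero [of e] e(1) by blast
  have \<phi>: "\<phi> h = - \<kappa> \<beta> h" if "h \<in> H" for h
  proof -
    have "\<kappa> \<beta> h * \<kappa> e x = \<kappa> (bracket h e) x" using e that by (simp add: form_scale_left)
    also have "\<dots> = - \<kappa> (bracket e h) x" by (metis bracket_antisym form_minus_left)
    also have "\<dots> = - \<phi> h * \<kappa> e x" using x that by (simp add: form_bracket form_scale_right)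
    finally have "(\<phi> h + \<kappa> \<beta> h) * \<kappa> e x = 0" by (simp add: algebra_simps)
    then show ?thesis using x(1) by (simp add: eq_neg_iff_add_eq_0)
  qed
  define f where "f = scale (1 / \<kappa> e x) x"
  have f: "\<kappa> e f = 1" "\<And>h. h \<in> H \<Longrightarrow> bracket h f = scale (- \<kappa> \<beta> h) f"
    using x \<phi> by (simp_all add: f_def form_scale_right bracket_scale_right mult.commute)
  have efH: "bracket e f \<in> H"
  proof (rule centralI)
    fix h assume "h \<in> H"
    then show "bracket h (bracket e f) = 0"
      using e f by (simp add: jacobi_derivation [of h e f] bracket_scale_left bracket_scale_right bracket_minus)
  qed
  define d where "d = bracket e f - \<beta>"
  have dH: "d \<in> H" using efH \<beta> subH by (simp add: d_def subspace_diff)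
  have dh: "\<kappa> d h = 0" if "h \<in> H" for h
    using f that by (simp add: d_def form_diff_left form_bracket bracket_antisym [of f h] form_minus_right form_scale_right)
  \<comment> \<open>Nondegeneracy is known on the whole algebra only, so \<open>d\<close> is tested
    against all weight vectors: those of weight zero lie in \<open>H\<close>, and those of nonzero
    weight are orthogonal to \<open>H\<close> by invariance.\<close>
  have "\<kappa> d y = 0" for y
  proof (rule weight_span_form_zero)
    fix y \<psi> assume y: "\<And>h. h \<in> H \<Longrightarrow> bracket h y = scale (\<psi> h) y"
    show "\<kappa> d y = 0"
    proof (cases "\<forall>h\<in>H. \<psi> h = 0")
      case True
      then have "y \<in> H" using y by (intro centralI) simp
      then show ?thesis by (rule dh)
    next
      case False
      then obtain h where h: "h \<in> H" "\<psi> h \<noteq> 0" by blast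
      have "\<psi> h * \<kappa> d y = \<kappa> (bracket d h) y" using y h by (simp add: form_bracket form_scale_right)
      also have "\<dots> = 0" using central [OF h(1) dH] by simp
      finally show ?thesis using h by simp
    qed
  qed
  then have "d = 0" by (rule form_nondegenerate)
  then have "bracket e f = \<beta>" by (simp add: d_def)
  then show thesis using that e(2) f(2) by blast
qed

text \<open>The weight \<open>\<kappa> \<gamma> \<beta>\<close> of a \<open>\<gamma>\<close>-root vector under the triple \<open>(e, \<beta>, f)\<close> differs by an
  even integer from the weight of a vector killed by \<open>e\<close>, which is the length of a finite
  \<open>f\<close>-string.\<close>

lemma root_form_Ints:
  assumes \<beta>: "\<beta> \<in> roots H \<kappa>" and \<gamma>: "\<gamma> \<in> roots H \<kappa>"
  shows "\<kappa> \<gamma> \<beta> \<in> \<int>"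
proof -
  obtain e f where ef: "\<And>h. h \<in> H \<Longrightarrow> bracket h e = scale (\<kappa> \<beta> h) e"
    "\<And>h. h \<in> H \<Longrightarrow> bracket h f = scale (- \<kappa> \<beta> h) f" "bracket e f = \<beta>"
    using root_sl2_triple [OF \<beta>] by metis
  have \<beta>H: "\<beta> \<in> H" using \<beta> by (simp add: roots_def)
  have be: "bracket \<beta> e = scale 2 e" and bf: "bracket \<beta> f = scale (- 2) f"
    using ef(1,2) [OF \<beta>H] simply_laced [OF \<beta>] by simp_all
  obtain x where x: "x \<noteq> 0" "bracket \<beta> x = scale (\<kappa> \<gamma> \<beta>) x"
    using \<gamma> \<beta>H by (auto simp: roots_def)
  obtain B where B: "finite B" "span B = UNIV" using finite_dim by blast
  define v where "v n = ((bracket e) ^^ n) x" for n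
  have v: "v 0 = x" "v (Suc n) = bracket e (v n)" for n by (simp_all add: v_def)
  have vw: "bracket \<beta> (v n) = scale (\<kappa> \<gamma> \<beta> + 2 * of_nat n) (v n)" for n
  proof (induction n)
    case (Suc n)
    have "bracket \<beta> (v (Suc n)) = scale (2 + (\<kappa> \<gamma> \<beta> + 2 * of_nat n)) (v (Suc n))"
      by (simp only: v jacobi_derivation [of \<beta> e] be bracket_scale_left bracket_scale_right Suc) (simp only: scale_left_distrib)
    then show ?case by (simp add: add_ac distrib_left)
  qed (simp add: v x)
  have "\<exists>n. v n = 0"
    by (rule eigenvectors_eventually_zero [where T = "bracket \<beta>", OF B _ _ vw])
       (auto simp: bracket_add_right bracket_scale_right inj_def)
  then obtain k where k: "v k \<noteq> 0" "v (Suc k) = 0"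
    using ex_least_nat_less [of "\<lambda>n. v n = 0"] v(1) x(1) by blast
  define w where "w = v k"
  define \<mu> where "\<mu> = \<kappa> \<gamma> \<beta> + 2 * of_nat k"
  have w: "w \<noteq> 0" "bracket e w = 0" "bracket \<beta> w = scale \<mu> w"
    using k vw [of k] by (simp_all add: w_def \<mu>_def v)
  define u where "u n = ((bracket f) ^^ n) w" for n
  have u: "u 0 = w" "u (Suc n) = bracket f (u n)" for n by (simp_all add: u_def)
  have uw: "bracket \<beta> (u n) = scale (\<mu> - 2 * of_nat n) (u n)" for n
  proof (induction n)
    case (Suc n)
    have "bracket \<beta> (u (Suc n)) = scale (- 2 + (\<mu> - 2 * of_nat n)) (u (Suc n))"
      by (simp only: u jacobi_derivation [of \<beta> f] bf bracket_scale_left bracket_scale_right Suc) (simp only: scale_left_distrib)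
    then show ?case by (simp add: add_ac distrib_left diff_diff_eq)
  qed (simp add: u w)
  \<comment> \<open>The sl2 relation e f^(n+1) w = (n+1) (\<mu> - n) f^n w. Where the f-string ends,
    the scalar must vanish, so \<mu> is a natural number.\<close>
  have eu: "bracket e (u (Suc n)) = scale (of_nat (Suc n) * (\<mu> - of_nat n)) (u n)" for n
  proof (induction n)
    case 0
    show ?case by (simp add: u jacobi_derivation [of e f] ef w)
  next
    case (Suc n)
    have "bracket e (u (Suc (Suc n))) = bracket \<beta> (u (Suc n)) + bracket f (bracket e (u (Suc n)))"
      by (simp only: u(2) [of "Suc n"] jacobi_derivation [of e f] ef)
    also have "\<dots> = scale (\<mu> - 2 * of_nat (Suc n) + of_nat (Suc n) * (\<mu> - of_nat n)) (u (Suc n))"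
      by (simp only: uw Suc.IH bracket_scale_right u(2) [of n, symmetric] scale_left_distrib)
    also have "\<mu> - 2 * of_nat (Suc n) + of_nat (Suc n) * (\<mu> - of_nat n) =
        of_nat (Suc (Suc n)) * (\<mu> - of_nat (Suc n))"
      by (simp add: algebra_simps)
    finally show ?case .
  qed
  have "\<exists>n. u n = 0"
    by (rule eigenvectors_eventually_zero [where T = "bracket \<beta>", OF B _ _ uw])
       (auto simp: bracket_add_right bracket_scale_right inj_def)
  then obtain m where m: "u m \<noteq> 0" "u (Suc m) = 0"
    using ex_least_nat_less [of "\<lambda>n. u n = 0"] u(1) w(1) by blast
  then have "of_nat (Suc m) * (\<mu> - of_nat m) = 0" using eu [of m] by simp
  then have "\<mu> = of_nat m" by (simp del: of_nat_Suc)
  then have "\<kappa> \<gamma> \<beta> = of_nat m - 2 * of_nat k" by (simp add: \<mu>_def algebra_simps)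
  then show ?thesis by simp
qed

end

section \<open>The Fock space as a polynomial ring\<close>

lemma poly_mapping_induct [case_names single sum]:
  fixes p :: "'k \<Rightarrow>\<^sub>0 'a::comm_monoid_add"
  assumes single: "\<And>k c. P (Poly_Mapping.single k c)"
    and sum: "\<And>p q. P p \<Longrightarrow> P q \<Longrightarrow> P (p + q)"
  shows "P p"
proof (induction p rule: update_induct)
  case const
  show ?case using single [of undefined 0] by simp
next
  case (update f a b)
  have "Poly_Mapping.update a b f = Poly_Mapping.single a b + f"
    using update(1) by (auto intro!: poly_mapping_eqI simp: lookup_update lookup_add lookup_single in_keys_iff when_def)
  then show ?case using sum [OF single update(3)] by simp
qed

lemma lookup_sum: "Poly_Mapping.lookup (sum f S) k = (\<Sum>x\<in>S. Poly_Mapping.lookup (f x) k)"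
  by (induction S rule: infinite_finite_induct) (simp_all add: lookup_add)

lemma poly_mapping_sum_single: "(\<Sum>k\<in>Poly_Mapping.keys p. Poly_Mapping.single k (Poly_Mapping.lookup p k)) = p"
  by (rule poly_mapping_eqI)
     (auto simp: lookup_sum lookup_single when_def in_keys_iff if_distrib cong: if_cong)

lemma fconst_0 [simp]: "fconst 0 = 0"
  and fconst_1 [simp]: "fconst 1 = 1"
  by (simp_all add: fconst_def)

lemma fconst_add: "fconst (a + b) = fconst a + fconst b"
  and fconst_diff: "fconst (a - b) = fconst a - fconst b"
  and fconst_minus: "fconst (- a) = - fconst a"
  and fconst_mult: "fconst (a * b) = fconst a * fconst b"
  by (simp_all add: fconst_def single_add single_diff single_uminus mult_single)

lemma fconst_of_nat: "fconst (of_nat n) = of_nat n"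
  by (induction n) (simp_all add: fconst_add)

lemma fconst_sum: "fconst (sum f S) = (\<Sum>x\<in>S. fconst (f x))"
  by (induction S rule: infinite_finite_induct) (simp_all add: fconst_add)

lemma fconst_mult_assoc: "fconst a * (fconst b * x) = fconst (a * b) * x"
  by (simp add: fconst_mult mult.assoc)

lemma fconst_inverse_cancel:
  assumes "a \<noteq> 0"
  shows "fconst (1 / a) * (fconst a * x) = x" "fconst a * (fconst (1 / a) * x) = x"
  using assms by (simp_all add: fconst_mult_assoc)

lemma of_nat_fock_cancel:
  fixes x y :: "'l fock"
  assumes "of_nat n * x = of_nat n * y" "n \<noteq> 0"
  shows "x = y"
  using assms fconst_inverse_cancel(1) [of "of_nat n"] by (metis fconst_of_nat of_nat_eq_0_iff)

lemma single_add_mset: "Poly_Mapping.single (add_mset (i, k) \<mu>) c = fvar i k * Poly_Mapping.single \<mu> c"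
  by (simp add: fvar_def mult_single)

lemma fock_induct [case_names const var add]:
  assumes const: "\<And>c. P (fconst c)"
    and var: "\<And>i k p. P p \<Longrightarrow> P (fvar i k * p)"
    and add: "\<And>p q. P p \<Longrightarrow> P q \<Longrightarrow> P (p + q)"
  shows "P p"
proof (induction p rule: poly_mapping_induct)
  case (single \<mu> c)
  show ?case
  proof (induction \<mu>)
    case empty
    show ?case using const [of c] by (simp add: fconst_def)
  next
    case (add x \<mu>)
    then show ?case using var [of "Poly_Mapping.single \<mu> c"] by (cases x) (simp add: single_add_mset)
  qed
qed (rule add)

text \<open>Cancellation may shrink the support of \<open>p + q\<close>, so all three sums are first
  extended to the union of the supports, where the new terms vanish.\<close>

lemma sum_keys_add:
  fixes f :: "'k \<Rightarrow> 'a::comm_monoid_add \<Rightarrow> 'b::comm_monoid_add"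
  assumes "\<And>x. f x 0 = 0" "\<And>x a b. f x (a + b) = f x a + f x b"
  shows "(\<Sum>x\<in>Poly_Mapping.keys (p + q). f x (Poly_Mapping.lookup (p + q) x)) =
    (\<Sum>x\<in>Poly_Mapping.keys p. f x (Poly_Mapping.lookup p x)) +
    (\<Sum>x\<in>Poly_Mapping.keys q. f x (Poly_Mapping.lookup q x))"
proof -
  let ?S = "Poly_Mapping.keys p \<union> Poly_Mapping.keys q"
  have *: "(\<Sum>x\<in>Poly_Mapping.keys r. f x (Poly_Mapping.lookup r x)) = (\<Sum>x\<in>?S. f x (Poly_Mapping.lookup r x))"
    if "Poly_Mapping.keys r \<subseteq> ?S" for r
    by (rule sum.mono_neutral_left) (use that assms(1) in \<open>auto simp: in_keys_iff\<close>)
  show ?thesis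
    by (subst (1 2 3) *) (auto simp: keys_add lookup_add assms(2) sum.distrib intro: subsetD [OF keys_add])
qed
section \<open>The Heisenberg operators\<close>

text \<open>The partial derivative in the variable \<alpha>_i(-k-1). A positive mode
  \<open>annih\<close> is a constant-coefficient combination of these, which is why such modes
  commute.\<close>

definition pdiff :: "'l \<Rightarrow> nat \<Rightarrow> 'l fock \<Rightarrow> 'l fock" where
  "pdiff i k p = (\<Sum>\<mu>\<in>Poly_Mapping.keys p.
     Poly_Mapping.single (\<mu> - {#(i, k)#}) (Poly_Mapping.lookup p \<mu> * of_nat (count \<mu> (i, k))))"

lemma pdiff_add: "pdiff i k (p + q) = pdiff i k p + pdiff i k q"
  unfolding pdiff_def
  by (rule sum_keys_add) (simp_all add: algebra_simps single_add)

lemma pdiff_single: "pdiff i k (Poly_Mapping.single \<mu> c) =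
    Poly_Mapping.single (\<mu> - {#(i, k)#}) (c * of_nat (count \<mu> (i, k)))"
  by (cases "c = 0") (simp_all add: pdiff_def)

lemma pdiff_fconst [simp]: "pdiff i k (fconst c) = 0"
  by (simp add: fconst_def pdiff_single)

lemma pdiff_fvar_mult:
  "pdiff i k (fvar j m * p) = (if (i, k) = (j, m) then p else 0) + fvar j m * pdiff i k p"
proof (induction p rule: poly_mapping_induct)
  case (single \<mu> c)
  show ?case
  proof (cases "(i, k) = (j, m)")
    case True
    \<comment> \<open>Removal from a multiset is truncated, so a monomial without the variable is
      treated apart from one where it can be put back.\<close>
    show ?thesis
    proof (cases "count \<mu> (i, k) = 0")
      case True
      with \<open>(i, k) = (j, m)\<close> show ?thesis
        by (simp add: fvar_def mult_single pdiff_single)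
    next
      case False
      then have "add_mset (i, k) (\<mu> - {#(i, k)#}) = \<mu>" by (auto simp: not_in_iff)
      then have "fvar i k * pdiff i k (Poly_Mapping.single \<mu> c) = Poly_Mapping.single \<mu> (c * of_nat (count \<mu> (i, k)))"
        by (simp only: pdiff_single single_add_mset [symmetric])
      moreover have "pdiff i k (fvar i k * Poly_Mapping.single \<mu> c) =
          Poly_Mapping.single \<mu> c + Poly_Mapping.single \<mu> (c * of_nat (count \<mu> (i, k)))"
        by (simp add: single_add_mset [symmetric] pdiff_single distrib_left single_add)
      ultimately show ?thesis using \<open>(i, k) = (j, m)\<close> by simp
    qed
  next
    case False
    have "add_mset (j, m) \<mu> - {#(i, k)#} = add_mset (j, m) (\<mu> - {#(i, k)#})" if "(i, k) \<in># \<mu>"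
      using diff_union_swap [OF False] by simp
    with False show ?thesis
      by (cases "(i, k) \<in># \<mu>") (auto simp: fvar_def mult_single pdiff_single not_in_iff)
  qed
next
  case (sum p q)
  then show ?case by (simp add: pdiff_add algebra_simps)
qed

lemma pdiff_0 [simp]: "pdiff i k 0 = 0" by (simp add: pdiff_def)

lemma pdiff_fconst_mult: "pdiff i k (fconst c * p) = fconst c * pdiff i k p"
proof (induction p rule: fock_induct)
  case (const d)
  then show ?case by (simp flip: fconst_mult)
next
  case (var j m p)
  show ?case
    unfolding mult.left_commute [of "fconst c" "fvar j m"] pdiff_fvar_mult var
    by (simp add: distrib_left mult.left_commute)
next
  case (add p q)
  then show ?case by (simp add: pdiff_add algebra_simps)
qed

lemma pdiff_commute: "pdiff i k (pdiff j m p) = pdiff j m (pdiff i k p)"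
proof (induction p rule: fock_induct)
  case (var i' k' p)
  then show ?case by (auto simp add: pdiff_fvar_mult pdiff_add)
qed (simp_all add: pdiff_add)

context
  fixes A :: "'l::finite \<Rightarrow> 'l \<Rightarrow> complex"
begin

lemma annih_Suc: "annih A \<beta> h (Suc n) p =
    (\<Sum>i\<in>UNIV. fconst (of_nat (Suc n) * bform A h (sroot i)) * pdiff i n p)"
proof -
  have "Poly_Mapping.single \<nu> (a * b * c) = fconst c * Poly_Mapping.single \<nu> (a * b)" for \<nu> :: "('l \<times> nat) multiset" and a b c
    by (simp add: fconst_def mult_single mult_ac)
  then show ?thesis
    unfolding annih_def pdiff_def by (simp add: sum_distrib_left sum.swap [of _ UNIV] del: of_nat_Suc)
qed

lemma annih_0: "annih A \<beta> h 0 p = fconst (bform A h \<beta>) * p"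
  by (simp add: annih_def)

lemma annih_indep: "n > 0 \<Longrightarrow> annih A \<beta> h n p = annih A \<beta>' h n p"
  by (cases n) (simp_all add: annih_Suc)

lemma annih_add: "annih A \<beta> h n (p + q) = annih A \<beta> h n p + annih A \<beta> h n q"
  by (cases n) (simp_all add: annih_0 annih_Suc pdiff_add algebra_simps sum.distrib)

lemma annih_fconst_mult: "annih A \<beta> h n (fconst c * p) = fconst c * annih A \<beta> h n p"
  by (cases n) (simp_all add: annih_0 annih_Suc pdiff_fconst_mult sum_distrib_left mult.left_commute)

lemma annih_zero [simp]: "annih A \<beta> h n 0 = 0"
  using annih_fconst_mult [of \<beta> h n 0 0] by simp

lemma annih_of_nat_mult: "annih A \<beta> h n (of_nat m * p) = of_nat m * annih A \<beta> h n p"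
  using annih_fconst_mult [of \<beta> h n "of_nat m" p] by (simp add: fconst_of_nat)

lemma annih_sum: "annih A \<beta> h n (sum f S) = (\<Sum>x\<in>S. annih A \<beta> h n (f x))"
  by (induction S rule: infinite_finite_induct) (simp_all add: annih_add)

lemma pdiff_sum: "pdiff i k (sum f S) = (\<Sum>x\<in>S. pdiff i k (f x))"
  by (induction S rule: infinite_finite_induct) (simp_all add: pdiff_add)

lemma annih_commute: "annih A \<beta> h n (annih A \<beta> h' m p) = annih A \<beta> h' m (annih A \<beta> h n p)"
proof (cases n; cases m)
  fix n' m' assume "n = Suc n'" "m = Suc m'"
  then show ?thesis
    by (simp add: annih_Suc pdiff_sum pdiff_fconst_mult sum_distrib_left pdiff_commute [of _ n'] del: of_nat_Suc)
       (subst sum.swap, simp add: mult.left_commute)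
qed (simp_all add: annih_0 annih_fconst_mult mult.left_commute)

lemma annih_fvar_mult: "annih A \<beta> h (Suc n) (fvar j m * p) =
    (if n = m then fconst (of_nat (Suc n) * bform A h (sroot j)) * p else 0) + fvar j m * annih A \<beta> h (Suc n) p"
proof -
  have "annih A \<beta> h (Suc n) (fvar j m * p) =
    (\<Sum>i\<in>UNIV. (if i = j then (if n = m then fconst (of_nat (Suc n) * bform A h (sroot i)) * p else 0) else 0) +
       fvar j m * (fconst (of_nat (Suc n) * bform A h (sroot i)) * pdiff i n p))"
    unfolding annih_Suc pdiff_fvar_mult by (rule sum.cong) (auto simp: algebra_simps)
  then show ?thesis
    by (simp add: sum.distrib sum.delta annih_Suc sum_distrib_left)
qed

lemma annih_fconst [simp]: "annih A \<beta> h (Suc n) (fconst c) = 0"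
  by (simp add: annih_Suc)

lemma annih_mult: "annih A \<beta> h (Suc n) (p * q) = annih A \<beta> h (Suc n) p * q + p * annih A \<beta> h (Suc n) q"
proof (induction p rule: fock_induct)
  case (const c)
  then show ?case by (simp add: annih_fconst_mult)
next
  case (var i k p)
  show ?case
    unfolding mult.assoc [of "fvar i k"] annih_fvar_mult var by (auto simp: algebra_simps)
next
  case (add p q)
  then show ?case by (simp add: annih_add algebra_simps)
qed

lemma annih_eventually_zero: "\<exists>N. \<forall>n\<ge>N. annih A \<beta> h n p = 0"
proof (induction p rule: fock_induct)
  case (const c)
  have "annih A \<beta> h n (fconst c) = 0" if "n \<ge> 1" for n using that by (cases n) simp_all
  then show ?case by blast
next
  case (var i k p)
  then obtain N where N: "\<forall>n\<ge>N. annih A \<beta> h n p = 0" by blast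
  have "annih A \<beta> h n (fvar i k * p) = 0" if "n \<ge> max N (k + 2)" for n
    using that N by (cases n) (auto simp: annih_fvar_mult)
  then show ?case by blast
next
  case (add p q)
  then obtain N M where "\<forall>n\<ge>N. annih A \<beta> h n p = 0" "\<forall>n\<ge>M. annih A \<beta> h n q = 0" by blast
  then have "\<forall>n\<ge>max N M. annih A \<beta> h n (p + q) = 0" by (simp add: annih_add)
  then show ?case by blast
qed

end

text \<open>The polynomial h(-n) itself, so that \<open>creat h n\<close> is multiplication by
  it.\<close>

definition gen :: "complex ^ 'l::finite \<Rightarrow> nat \<Rightarrow> 'l fock" where
  "gen h n = (\<Sum>i\<in>UNIV. fconst (vec_nth h i) * fvar i (n - 1))"

lemma creat_eq: "creat h n p = gen h n * p"
  by (simp add: creat_def gen_def)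

lemma gen_add: "gen (g + h) n = gen g n + gen h n"
  by (simp add: gen_def fconst_add algebra_simps sum.distrib)

lemma gen_sroot: "gen (sroot i) (Suc k) = fvar i k"
proof -
  have "gen (sroot i) (Suc k) = (\<Sum>j\<in>UNIV. if j = i then fvar j k else 0)"
    unfolding gen_def by (rule sum.cong) (auto simp: axis_def)
  then show ?thesis by simp
qed

lemma bform_add_left: "bform A (x + y) z = bform A x z + bform A y z"
  and bform_add_right: "bform A z (x + y) = bform A z x + bform A z y"
  by (simp_all add: bform_def algebra_simps sum.distrib)

lemma bform_zero [simp]: "bform A 0 x = 0" "bform A x 0 = 0"
  by (simp_all add: bform_def)

lemma bform_sroot: "bform A x (sroot j) = (\<Sum>i\<in>UNIV. vec_nth x i * A i j)"
proof -
  have "bform A x (sroot j) = (\<Sum>i\<in>UNIV. \<Sum>k\<in>UNIV. if k = j then vec_nth x i * A i j else 0)"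
    unfolding bform_def by (intro sum.cong refl) (auto simp: axis_def)
  then show ?thesis by simp
qed

lemma bform_expand: "bform A x y = (\<Sum>j\<in>UNIV. bform A x (sroot j) * vec_nth y j)"
  unfolding bform_sroot by (simp add: bform_def sum_distrib_right) (rule sum.swap)

text \<open>The Heisenberg relation between h(n) and g(-m), both indices shifted by one, as a
  Leibniz rule.\<close>

lemma annih_gen_mult: "annih A \<beta> h (Suc n) (gen g (Suc m) * p) =
    (if n = m then fconst (of_nat (Suc n) * bform A h g) * p else 0) + gen g (Suc m) * annih A \<beta> h (Suc n) p"
proof -
  have 1: "annih A \<beta> h (Suc n) (gen g (Suc m)) = (if n = m then fconst (of_nat (Suc n) * bform A h g) else 0)"
  proof -
    have "annih A \<beta> h (Suc n) (fvar i m) = (if n = m then fconst (of_nat (Suc n) * bform A h (sroot i)) else 0)" for i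
      using annih_fvar_mult [of A \<beta> h n i m 1] annih_fconst [of A \<beta> h n 1] by auto
    then have "annih A \<beta> h (Suc n) (gen g (Suc m)) = (\<Sum>i\<in>UNIV. fconst (vec_nth g i) *
        (if n = m then fconst (of_nat (Suc n) * bform A h (sroot i)) else 0))"
      by (simp only: gen_def annih_sum annih_fconst_mult diff_Suc_1)
    also have "\<dots> = (if n = m then fconst (of_nat (Suc n) * bform A h g) else 0)"
      by (simp add: bform_expand [of A h g] fconst_sum sum_distrib_left fconst_mult [symmetric] mult_ac del: of_nat_Suc)
    finally show ?thesis .
  qed
  show ?thesis by (simp add: annih_mult 1)
qed

section \<open>Exponentials of commuting operators\<close>

lemma sum_triangle_swap:
  fixes f :: "nat \<Rightarrow> nat \<Rightarrow> 'a::comm_monoid_add"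
  shows "(\<Sum>n=1..m. \<Sum>l=1..m-n. f n l) = (\<Sum>l=1..m. \<Sum>n=1..m-l. f n l)"
proof -
  have "(\<Sum>n=1..m. \<Sum>l=1..m-n. f n l) = (\<Sum>(n, l)\<in>(SIGMA n:{1..m}. {1..m-n}). f n l)"
    by (simp add: sum.Sigma)
  also have "\<dots> = (\<Sum>(l, n)\<in>(SIGMA l:{1..m}. {1..m-l}). f n l)"
    by (rule sum.reindex_bij_witness [of _ "\<lambda>(l, n). (n, l)" "\<lambda>(n, l). (l, n)"]) auto
  also have "\<dots> = (\<Sum>l=1..m. \<Sum>n=1..m-l. f n l)"
    by (simp add: sum.Sigma)
  finally show ?thesis .
qed

text \<open>These are the coefficients of s d/ds exp(a(s)) w = (\<Sum> n a_n s^n) exp(a(s)) w. An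
  exponential of operators may be differentiated like this because the \<open>a n\<close>
  commute.\<close>

lemma op_exp_recursion:
  fixes a :: "nat \<Rightarrow> 'l fock \<Rightarrow> 'l fock"
  assumes add: "\<And>n x y. a n (x + y) = a n x + a n y"
    and hom: "\<And>n c x. a n (fconst c * x) = fconst c * a n x"
    and comm: "\<And>n m x. a n (a m x) = a m (a n x)"
  shows "fps_nth (op_exp a w) 0 = w"
    and "of_nat m * fps_nth (op_exp a w) m = (\<Sum>n=1..m. of_nat n * a n (fps_nth (op_exp a w) (m - n)))"
proof -
  have a0: "a n 0 = 0" for n using hom [of n 0 0] by simp
  have asum: "a n (sum g S) = (\<Sum>x\<in>S. a n (g x))" for n and g :: "nat \<Rightarrow> 'l fock" and S
    by (induction S rule: infinite_finite_induct) (simp_all add: a0 add)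
  have anat: "a n (of_nat k * x) = of_nat k * a n x" for n k x
    using hom [of n "of_nat k" x] by (simp add: fconst_of_nat)
  define P where "P j = ((\<lambda>W r. \<Sum>n=1..r. a n (W (r - n))) ^^ j) (\<lambda>r. if r = 0 then w else 0)" for j
  have P0: "P 0 r = (if r = 0 then w else 0)" and PS: "P (Suc j) r = (\<Sum>n=1..r. a n (P j (r - n)))" for j r
    by (simp_all add: P_def)
  have nth: "fps_nth (op_exp a w) m = (\<Sum>j\<le>m. fconst (1 / fact j) * P j m)" for m
    by (simp add: op_exp_def P_def)
  show "fps_nth (op_exp a w) 0 = w" by (simp add: nth P0)
  have Pz: "P j m = 0" if "j > m" for j m
    using that
  proof (induction j arbitrary: m)
    case (Suc j)
    have "P j (m - n) = 0" if "n \<in> {1..m}" for n using Suc that by auto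
    then show ?case unfolding PS by (simp add: a0)
  qed simp
  \<comment> \<open>This is s d/ds a(s)^(j+1) = (j+1) (s a'(s)) a(s)^j. Splitting \<open>m\<close>
    as \<open>n + (m - n)\<close> is the product rule.\<close>
  have step: "of_nat m * P (Suc j) m = of_nat (Suc j) * (\<Sum>n=1..m. of_nat n * a n (P j (m - n)))" for j m
  proof (induction j arbitrary: m)
    case 0
    have "of_nat m * a n (P 0 (m - n)) = of_nat n * a n (P 0 (m - n))" if "n \<in> {1..m}" for n
      using that by (cases "n = m") (simp_all add: P0 a0)
    then show ?case by (simp add: PS sum_distrib_left)
  next
    case (Suc j)
    have "of_nat m * P (Suc (Suc j)) m = (\<Sum>n=1..m. of_nat m * a n (P (Suc j) (m - n)))"
      by (simp add: PS [of "Suc j"] sum_distrib_left)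
    also have "\<dots> = (\<Sum>n=1..m. of_nat n * a n (P (Suc j) (m - n)) + a n (of_nat (m - n) * P (Suc j) (m - n)))"
    proof (rule sum.cong [OF refl])
      fix n assume "n \<in> {1..m}"
      then have "(of_nat m :: 'l fock) = of_nat n + of_nat (m - n)" by (simp flip: of_nat_add)
      then show "of_nat m * a n (P (Suc j) (m - n)) =
          of_nat n * a n (P (Suc j) (m - n)) + a n (of_nat (m - n) * P (Suc j) (m - n))"
        by (simp add: anat algebra_simps)
    qed
    also have "\<dots> = (\<Sum>n=1..m. of_nat n * a n (P (Suc j) (m - n))) +
        (\<Sum>n=1..m. of_nat (Suc j) * (\<Sum>l=1..m-n. of_nat l * a n (a l (P j (m - n - l)))))"
      unfolding Suc.IH sum.distrib anat asum ..
    also have "(\<Sum>n=1..m. of_nat (Suc j) * (\<Sum>l=1..m-n. of_nat l * a n (a l (P j (m - n - l))))) =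
        of_nat (Suc j) * (\<Sum>l=1..m. \<Sum>n=1..m-l. of_nat l * a n (a l (P j (m - n - l))))"
      by (simp only: sum_distrib_left [symmetric] sum_triangle_swap [where m = m])
    also have "(\<Sum>l=1..m. \<Sum>n=1..m-l. of_nat l * a n (a l (P j (m - n - l)))) =
        (\<Sum>l=1..m. of_nat l * a l (P (Suc j) (m - l)))"
      unfolding PS [of j] asum sum_distrib_left
      by (intro sum.cong refl arg_cong [where f = "(*) _"]) (simp only: comm [of _ _ "P j _"] diff_commute [of m])
    finally show ?case by (simp add: algebra_simps)
  qed
  show "of_nat m * fps_nth (op_exp a w) m = (\<Sum>n=1..m. of_nat n * a n (fps_nth (op_exp a w) (m - n)))"
  proof (cases m)
    case (Suc m')
    have "of_nat m * fps_nth (op_exp a w) m = (\<Sum>j\<le>m. fconst (1 / fact j) * (of_nat m * P j m))"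
      by (simp add: nth sum_distrib_left mult.left_commute)
    also have "\<dots> = (\<Sum>j\<le>m'. fconst (1 / fact (Suc j)) * (of_nat m * P (Suc j) m))"
      unfolding Suc sum.atMost_Suc_shift by (simp add: P0)
    also have "\<dots> = (\<Sum>j\<le>m'. fconst (1 / fact j) * (\<Sum>n=1..m. of_nat n * a n (P j (m - n))))"
    proof (rule sum.cong [OF refl])
      fix j
      have "fconst (1 / fact (Suc j)) * (of_nat (Suc j) * x) = fconst (1 / fact j) * x" for x :: "'l fock"
        unfolding fconst_of_nat [symmetric] fconst_mult_assoc
        by (simp add: field_simps del: of_nat_Suc)
      then show "fconst (1 / fact (Suc j)) * (of_nat m * P (Suc j) m) =
          fconst (1 / fact j) * (\<Sum>n=1..m. of_nat n * a n (P j (m - n)))"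
        by (simp only: step)
    qed
    also have "\<dots> = (\<Sum>n=1..m. of_nat n * a n (\<Sum>j\<le>m'. fconst (1 / fact j) * P j (m - n)))"
      by (simp add: sum_distrib_left asum hom mult.left_commute) (rule sum.swap)
    also have "\<dots> = (\<Sum>n=1..m. of_nat n * a n (fps_nth (op_exp a w) (m - n)))"
    proof (rule sum.cong [OF refl])
      fix n assume n: "n \<in> {1..m}"
      have "(\<Sum>j\<le>m'. fconst (1 / fact j) * P j (m - n)) = (\<Sum>j\<le>m-n. fconst (1 / fact j) * P j (m - n))"
        by (rule sum.mono_neutral_right) (use n Suc in \<open>auto simp: Pz\<close>)
      then show "of_nat n * a n (\<Sum>j\<le>m'. fconst (1 / fact j) * P j (m - n)) =
          of_nat n * a n (fps_nth (op_exp a w) (m - n))"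
        by (simp add: nth)
    qed
    finally show ?thesis .
  qed simp
qed

text \<open>Division by \<open>m\<close> is possible over the complex numbers, so each coefficient
  is determined by its predecessors. Equality of exponentials is reduced to equality of recursions
  by this lemma.\<close>

lemma recursion_unique:
  fixes c d :: "nat \<Rightarrow> 'l fock"
  assumes "c 0 = d 0"
    and "\<And>m. of_nat m * c m = (\<Sum>n=1..m. b n (c (m - n)))"
    and "\<And>m. of_nat m * d m = (\<Sum>n=1..m. b n (d (m - n)))"
  shows "c m = d m"
proof (induction m rule: less_induct)
  case (less m)
  show ?case
  proof (cases "m = 0")
    case False
    have "(\<Sum>n=1..m. b n (c (m - n))) = (\<Sum>n=1..m. b n (d (m - n)))"
      using less by (intro sum.cong refl arg_cong [where f = "b _"]) auto
    then show ?thesis using of_nat_fock_cancel [OF _ False] assms by metis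
  qed (simp add: assms)
qed

section \<open>Coefficients of the exponentials\<close>

text \<open>With \<gamma>(-n) read as the n-th power sum, exp(\<Sum> p_n z^n / n) generates the
  complete homogeneous symmetric polynomials, and \<open>hsym_recursion\<close> is Newton's
  identity.\<close>

definition hsym :: "complex ^ 'l::finite \<Rightarrow> nat \<Rightarrow> 'l fock" where
  "hsym \<gamma> n = fps_nth (exp_creat \<gamma> 1) n"

text \<open>The coefficient of z^(-q) in \<tau>_\<gamma>(z) w, where \<tau>_\<gamma> is the
  annihilation exponential. The charge 0 is a normalization, since positive modes do not see the
  charge (\<open>exp_annih_nth\<close>).\<close>

definition tcoef ::
  "('l::finite \<Rightarrow> 'l \<Rightarrow> complex) \<Rightarrow> complex ^ 'l \<Rightarrow> nat \<Rightarrow> 'l fock \<Rightarrow> 'l fock" where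
  "tcoef A \<gamma> q w = fps_nth (exp_annih A \<gamma> 0 w) q"

lemma of_nat_fconst_cancel: "n \<noteq> 0 \<Longrightarrow> of_nat n * (fconst (1 / of_nat n) * x) = x"
  by (simp add: fconst_inverse_cancel flip: fconst_of_nat)

lemma exp_creat_recursion:
  "fps_nth (exp_creat \<gamma> w) 0 = w"
  "of_nat m * fps_nth (exp_creat \<gamma> w) m = (\<Sum>n=1..m. gen \<gamma> n * fps_nth (exp_creat \<gamma> w) (m - n))"
proof -
  let ?a = "\<lambda>n p. fconst (1 / of_nat n) * creat \<gamma> n p"
  have lin: "?a n (x + y) = ?a n x + ?a n y" "?a n (fconst c * x) = fconst c * ?a n x"
    "?a n (?a m x) = ?a m (?a n x)" for n m c x y
    by (simp_all add: creat_eq algebra_simps)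
  note rec = op_exp_recursion [of ?a, OF lin, folded exp_creat_def]
  show "fps_nth (exp_creat \<gamma> w) 0 = w" by (rule rec)
  show "of_nat m * fps_nth (exp_creat \<gamma> w) m = (\<Sum>n=1..m. gen \<gamma> n * fps_nth (exp_creat \<gamma> w) (m - n))"
    unfolding rec(2) by (rule sum.cong) (simp_all add: of_nat_fconst_cancel creat_eq del: of_nat_Suc)
qed

lemma hsym_0 [simp]: "hsym \<gamma> 0 = 1"
  by (simp add: hsym_def exp_creat_recursion)

lemma hsym_recursion: "of_nat m * hsym \<gamma> m = (\<Sum>n=1..m. gen \<gamma> n * hsym \<gamma> (m - n))"
  unfolding hsym_def by (rule exp_creat_recursion)

lemma exp_creat_nth: "fps_nth (exp_creat \<gamma> w) m = hsym \<gamma> m * w"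
proof (rule recursion_unique)
  show "of_nat m * (hsym \<gamma> m * w) = (\<Sum>n=1..m. gen \<gamma> n * (hsym \<gamma> (m - n) * w))" for m
    by (simp add: hsym_recursion sum_distrib_right mult.assoc flip: mult.assoc [of "of_nat m"])
qed (simp_all add: exp_creat_recursion)

lemma sum_triangle_swap0:
  fixes f :: "nat \<Rightarrow> nat \<Rightarrow> 'a::comm_monoid_add"
  shows "(\<Sum>i\<le>m. \<Sum>n=1..i. f i n) = (\<Sum>n=1..m. \<Sum>j\<le>m-n. f (j + n) n)"
proof -
  have "(\<Sum>i\<le>m. \<Sum>n=1..i. f i n) = (\<Sum>(i, n)\<in>(SIGMA i:{..m}. {1..i}). f i n)"
    by (simp add: sum.Sigma)
  also have "\<dots> = (\<Sum>(n, j)\<in>(SIGMA n:{1..m}. {..m-n}). f (j + n) n)"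
    by (rule sum.reindex_bij_witness [of _ "\<lambda>(n, j). (j + n, n)" "\<lambda>(i, n). (n, i - n)"]) auto
  also have "\<dots> = (\<Sum>n=1..m. \<Sum>j\<le>m-n. f (j + n) n)"
    by (simp add: sum.Sigma)
  finally show ?thesis .
qed

text \<open>For a series in s and t with coefficients \<open>x i j\<close>, the operators s d/ds and
  t d/dt add up to the Euler operator on the diagonal s = t. Recursions of two factors thus give one
  for their product.\<close>

lemma cauchy_recursion:
  fixes x :: "nat \<Rightarrow> nat \<Rightarrow> 'a::semiring_1"
  assumes F: "\<And>i j. of_nat i * x i j = (\<Sum>n=1..i. F n (i - n) j)"
    and G: "\<And>i j. of_nat j * x i j = (\<Sum>n=1..j. G n i (j - n))"
  shows "of_nat m * (\<Sum>i\<le>m. x i (m - i)) =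
    (\<Sum>n=1..m. \<Sum>i\<le>m-n. F n i (m - n - i) + G n i (m - n - i))"
proof -
  have "of_nat m * (\<Sum>i\<le>m. x i (m - i)) = (\<Sum>i\<le>m. of_nat i * x i (m - i) + of_nat (m - i) * x i (m - i))"
    unfolding sum_distrib_left
  proof (rule sum.cong [OF refl])
    fix i assume "i \<in> {..m}"
    then have "(of_nat m :: 'a) = of_nat i + of_nat (m - i)" by (simp flip: of_nat_add)
    then show "of_nat m * x i (m - i) = of_nat i * x i (m - i) + of_nat (m - i) * x i (m - i)"
      by (simp only: distrib_right)
  qed
  also have "\<dots> = (\<Sum>i\<le>m. \<Sum>n=1..i. F n (i - n) (m - i)) + (\<Sum>i\<le>m. \<Sum>n=1..m-i. G n i (m - i - n))"
    by (simp only: F G sum.distrib)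
  also have "(\<Sum>i\<le>m. \<Sum>n=1..i. F n (i - n) (m - i)) = (\<Sum>n=1..m. \<Sum>i\<le>m-n. F n i (m - n - i))"
    unfolding sum_triangle_swap0 by (simp add: add.commute)
  also have "(\<Sum>i\<le>m. \<Sum>n=1..m-i. G n i (m - i - n)) = (\<Sum>i\<le>m. \<Sum>n=1..i. G n (m - i) (i - n))"
    by (rule sum.reindex_bij_witness [of _ "\<lambda>i. m - i" "\<lambda>i. m - i"]) auto
  also have "\<dots> = (\<Sum>n=1..m. \<Sum>j\<le>m-n. G n (m - (j + n)) j)"
    unfolding sum_triangle_swap0 by simp
  also have "\<dots> = (\<Sum>n=1..m. \<Sum>i\<le>m-n. G n i (m - n - i))"
  proof (rule sum.cong [OF refl])
    fix n assume "n \<in> {1..m}"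
    then show "(\<Sum>j\<le>m-n. G n (m - (j + n)) j) = (\<Sum>i\<le>m-n. G n i (m - n - i))"
      by (intro sum.reindex_bij_witness [of _ "\<lambda>i. m - n - i" "\<lambda>i. m - n - i"])
         (auto simp: add.commute)
  qed
  finally show ?thesis by (simp add: sum.distrib)
qed

lemma hsym_add: "hsym (\<gamma> + \<delta>) m = (\<Sum>i\<le>m. hsym \<gamma> i * hsym \<delta> (m - i))"
proof (rule recursion_unique [where b = "\<lambda>n x. gen (\<gamma> + \<delta>) n * x"])
  show "of_nat m * (\<Sum>i\<le>m. hsym \<gamma> i * hsym \<delta> (m - i)) =
      (\<Sum>n=1..m. gen (\<gamma> + \<delta>) n * (\<Sum>i\<le>m-n. hsym \<gamma> i * hsym \<delta> (m - n - i)))" for m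
  proof -
    have F: "of_nat i * (hsym \<gamma> i * hsym \<delta> j) = (\<Sum>n=1..i. gen \<gamma> n * hsym \<gamma> (i - n) * hsym \<delta> j)" for i j
      by (simp only: mult.assoc [symmetric, of "of_nat i"] hsym_recursion sum_distrib_right)
    have G: "of_nat j * (hsym \<gamma> i * hsym \<delta> j) = (\<Sum>n=1..j. hsym \<gamma> i * (gen \<delta> n * hsym \<delta> (j - n)))" for i j
      by (simp only: mult.left_commute [of "of_nat j"] hsym_recursion sum_distrib_left)
    show ?thesis
      unfolding cauchy_recursion [OF F G]
      by (unfold sum_distrib_left, intro sum.cong refl) (simp add: gen_add algebra_simps)
  qed
qed (simp_all add: hsym_recursion)

lemma hsym_zero: "n > 0 \<Longrightarrow> hsym 0 n = 0"
proof (induction n rule: less_induct)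
  case (less n)
  have "of_nat n * hsym 0 n = of_nat n * (0 :: 'a fock)"
    unfolding hsym_recursion by (simp add: gen_def)
  then show ?case using of_nat_fock_cancel less by blast
qed

section \<open>Action of the annihilation exponential on polynomials\<close>

context
  fixes A :: "'l::finite \<Rightarrow> 'l \<Rightarrow> complex"
begin

lemma exp_annih_recursion:
  "fps_nth (exp_annih A \<gamma> \<beta> w) 0 = w"
  "of_nat m * fps_nth (exp_annih A \<gamma> \<beta> w) m = (\<Sum>n=1..m. - annih A 0 \<gamma> n (fps_nth (exp_annih A \<gamma> \<beta> w) (m - n)))"
proof -
  let ?a = "\<lambda>n p. fconst (- 1 / of_nat n) * annih A \<beta> \<gamma> n p"
  have lin: "?a n (x + y) = ?a n x + ?a n y" "?a n (fconst c * x) = fconst c * ?a n x"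
    "?a n (?a m x) = ?a m (?a n x)" for n m c x y
    by (simp_all only: annih_add annih_fconst_mult distrib_left mult.left_commute annih_commute [of A \<beta> \<gamma> n \<gamma> m])
  note rec = op_exp_recursion [of ?a, OF lin, folded exp_annih_def]
  show "fps_nth (exp_annih A \<gamma> \<beta> w) 0 = w" by (rule rec)
  have *: "fconst (- 1 / of_nat n) * x = - (fconst (1 / of_nat n) * x)" for n and x :: "'l fock"
    by (simp add: fconst_minus)
  show "of_nat m * fps_nth (exp_annih A \<gamma> \<beta> w) m = (\<Sum>n=1..m. - annih A 0 \<gamma> n (fps_nth (exp_annih A \<gamma> \<beta> w) (m - n)))"
    unfolding rec(2) *
    by (rule sum.cong) (auto simp add: of_nat_fconst_cancel annih_indep [where \<beta> = \<beta> and \<beta>' = 0] simp del: of_nat_Suc)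
qed

lemma exp_annih_nth: "fps_nth (exp_annih A \<gamma> \<beta> w) q = tcoef A \<gamma> q w"
  unfolding tcoef_def by (rule recursion_unique) (rule exp_annih_recursion | simp add: exp_annih_recursion)+

lemma tcoef_0 [simp]: "tcoef A \<gamma> 0 w = w"
  by (simp add: tcoef_def exp_annih_recursion)

lemma tcoef_recursion: "of_nat m * tcoef A \<gamma> m w = (\<Sum>n=1..m. - annih A 0 \<gamma> n (tcoef A \<gamma> (m - n) w))"
  unfolding tcoef_def by (rule exp_annih_recursion)

lemma tcoef_unique:
  assumes "c 0 = w" "\<And>m. of_nat m * c m = (\<Sum>n=1..m. - annih A 0 \<gamma> n (c (m - n)))"
  shows "tcoef A \<gamma> m w = c m"
  by (rule recursion_unique [OF _ tcoef_recursion assms(2)]) (simp add: assms)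

lemma tcoef_add: "tcoef A \<gamma> m (x + y) = tcoef A \<gamma> m x + tcoef A \<gamma> m y"
  by (rule tcoef_unique) (simp_all add: distrib_left tcoef_recursion annih_add sum.distrib algebra_simps sum_subtractf sum_negf)

lemma tcoef_fconst_mult: "tcoef A \<gamma> m (fconst c * x) = fconst c * tcoef A \<gamma> m x"
  by (rule tcoef_unique) (simp_all add: mult.left_commute [of "of_nat _"] tcoef_recursion annih_fconst_mult sum_distrib_left sum_negf)

lemma tcoef_sum: "tcoef A \<gamma> m (sum f S) = (\<Sum>x\<in>S. tcoef A \<gamma> m (f x))"
  using tcoef_fconst_mult [of \<gamma> m 0 0]
  by (induction S rule: infinite_finite_induct) (simp_all add: tcoef_add)

lemma tcoef_zero [simp]: "tcoef A \<gamma> m 0 = 0"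
  using tcoef_fconst_mult [of \<gamma> m 0 0] by simp

lemma tcoef_annih: "tcoef A \<gamma> m (annih A \<beta> h n w) = annih A \<beta> h n (tcoef A \<gamma> m w)"
proof (rule tcoef_unique)
  show "of_nat m * annih A \<beta> h n (tcoef A \<gamma> m w) =
      (\<Sum>k=1..m. - annih A 0 \<gamma> k (annih A \<beta> h n (tcoef A \<gamma> (m - k) w)))" for m
  proof -
    have "of_nat m * annih A \<beta> h n (tcoef A \<gamma> m w) = annih A \<beta> h n (- (\<Sum>k=1..m. annih A 0 \<gamma> k (tcoef A \<gamma> (m - k) w)))"
      by (simp only: annih_of_nat_mult [symmetric] tcoef_recursion sum_negf)
    also have "\<dots> = - (\<Sum>k=1..m. annih A \<beta> h n (annih A 0 \<gamma> k (tcoef A \<gamma> (m - k) w)))"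
      using annih_fconst_mult [of A \<beta> h n "- 1"] by (simp add: fconst_minus annih_sum)
    also have "\<dots> = - (\<Sum>k=1..m. annih A 0 \<gamma> k (annih A \<beta> h n (tcoef A \<gamma> (m - k) w)))"
    proof (intro arg_cong [where f = uminus] sum.cong refl)
      fix k assume "k \<in> {1..m}"
      then show "annih A \<beta> h n (annih A 0 \<gamma> k (tcoef A \<gamma> (m - k) w)) = annih A 0 \<gamma> k (annih A \<beta> h n (tcoef A \<gamma> (m - k) w))"
        using annih_commute [of A \<beta> h n \<gamma> k] annih_indep [of k A \<beta> \<gamma> _ 0] by simp
    qed
    finally show ?thesis by (simp add: sum_negf)
  qed
qed simp

text \<open>The exponential of a derivation is multiplicative: \<tau>_\<gamma>(z) is a ring
  homomorphism and is determined by its values on generators.\<close>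

lemma tcoef_mult: "tcoef A \<gamma> m (x * y) = (\<Sum>i\<le>m. tcoef A \<gamma> i x * tcoef A \<gamma> (m - i) y)"
proof (rule tcoef_unique)
  show "of_nat m * (\<Sum>i\<le>m. tcoef A \<gamma> i x * tcoef A \<gamma> (m - i) y) =
      (\<Sum>n=1..m. - annih A 0 \<gamma> n (\<Sum>i\<le>m-n. tcoef A \<gamma> i x * tcoef A \<gamma> (m - n - i) y))" for m
  proof -
    have *: "- annih A 0 \<gamma> n (p * q) = - annih A 0 \<gamma> n p * q + p * (- annih A 0 \<gamma> n q)" if "n \<in> {1..m}" for n p q
      using that by (cases n) (simp_all add: annih_mult)
    have F: "of_nat i * (tcoef A \<gamma> i x * tcoef A \<gamma> j y) =
        (\<Sum>n=1..i. - annih A 0 \<gamma> n (tcoef A \<gamma> (i - n) x) * tcoef A \<gamma> j y)" for i j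
      by (simp only: mult.assoc [symmetric, of "of_nat i"] tcoef_recursion sum_distrib_right)
    have G: "of_nat j * (tcoef A \<gamma> i x * tcoef A \<gamma> j y) =
        (\<Sum>n=1..j. tcoef A \<gamma> i x * - annih A 0 \<gamma> n (tcoef A \<gamma> (j - n) y))" for i j
      by (simp only: mult.left_commute [of "of_nat j"] tcoef_recursion sum_distrib_left)
    show ?thesis
      unfolding cauchy_recursion [OF F G]
      by (unfold annih_sum sum_negf [symmetric], intro sum.cong refl) (simp only: *)
  qed
qed simp

lemma tcoef_gamma_add: "tcoef A (\<gamma> + \<delta>) m w = (\<Sum>i\<le>m. tcoef A \<gamma> i (tcoef A \<delta> (m - i) w))"
proof (rule tcoef_unique)
  have *: "tcoef A \<gamma> i (- annih A 0 \<delta> n p) = - annih A 0 \<delta> n (tcoef A \<gamma> i p)" for i n p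
    using tcoef_fconst_mult [of \<gamma> i "- 1"] by (simp add: fconst_minus tcoef_annih)
  have **: "annih A 0 (\<gamma> + \<delta>) n p = annih A 0 \<gamma> n p + annih A 0 \<delta> n p" for n p
    by (cases n) (simp_all add: annih_0 annih_Suc bform_add_left fconst_add algebra_simps sum.distrib)
  have nat: "of_nat k * tcoef A \<gamma> i p = tcoef A \<gamma> i (of_nat k * p)" for k i p
    using tcoef_fconst_mult [of \<gamma> i "of_nat k" p] by (simp add: fconst_of_nat)
  show "of_nat m * (\<Sum>i\<le>m. tcoef A \<gamma> i (tcoef A \<delta> (m - i) w)) =
      (\<Sum>n=1..m. - annih A 0 (\<gamma> + \<delta>) n (\<Sum>i\<le>m-n. tcoef A \<gamma> i (tcoef A \<delta> (m - n - i) w)))" for m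
  proof -
    have F: "of_nat i * tcoef A \<gamma> i (tcoef A \<delta> j w) =
        (\<Sum>n=1..i. - annih A 0 \<gamma> n (tcoef A \<gamma> (i - n) (tcoef A \<delta> j w)))" for i j
      by (rule tcoef_recursion)
    have G: "of_nat j * tcoef A \<gamma> i (tcoef A \<delta> j w) =
        (\<Sum>n=1..j. - annih A 0 \<delta> n (tcoef A \<gamma> i (tcoef A \<delta> (j - n) w)))" for i j
      by (simp only: nat tcoef_recursion [where \<gamma> = \<delta>] tcoef_sum *)
    show ?thesis
      unfolding cauchy_recursion [OF F G]
      by (unfold annih_sum sum_negf [symmetric], intro sum.cong refl) (simp add: **)
  qed
qed simp

lemma tcoef_fconst: "q > 0 \<Longrightarrow> tcoef A \<gamma> q (fconst c) = 0"
proof -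
  have "tcoef A \<gamma> q (fconst c) = (if q = 0 then fconst c else 0)"
  proof (rule tcoef_unique)
    fix m
    have "annih A 0 \<gamma> n (if m - n = 0 then fconst c else 0) = 0" if "n \<in> {1..m}" for n
      using that by (cases n) auto
    then show "of_nat m * (if m = 0 then fconst c else 0) = (\<Sum>n=1..m. - annih A 0 \<gamma> n (if m - n = 0 then fconst c else 0))"
      by simp
  qed simp
  then show "q > 0 \<Longrightarrow> tcoef A \<gamma> q (fconst c) = 0" by simp
qed

text \<open>\<tau>_\<gamma>(z) translates h(-k-1) by the constant -(\<gamma>|h) z^(-k-1). It
  therefore produces polynomials in z^(-1).\<close>

lemma tcoef_gen: "tcoef A \<gamma> q (gen h (Suc k)) =
    (if q = 0 then gen h (Suc k) else if q = Suc k then fconst (- bform A \<gamma> h) else 0)" (is "_ = ?c q")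
proof (rule tcoef_unique)
  fix m
  show "of_nat m * ?c m = (\<Sum>n=1..m. - annih A 0 \<gamma> n (?c (m - n)))"
  proof (cases m)
    case (Suc m')
    have g: "annih A 0 \<gamma> (Suc n) (gen h (Suc k)) = (if n = k then fconst (of_nat (Suc n) * bform A \<gamma> h) else 0)" for n
      using annih_gen_mult [of A 0 \<gamma> n h k 1] annih_fconst [of A 0 \<gamma> n 1] by auto
    have "annih A 0 \<gamma> n (?c (m - n)) = (if n = m then annih A 0 \<gamma> m (gen h (Suc k)) else 0)" if "n \<in> {1..m}" for n
      using that by (cases n) auto
    then have "(\<Sum>n=1..m. - annih A 0 \<gamma> n (?c (m - n))) = - annih A 0 \<gamma> m (gen h (Suc k))"
      using Suc by (simp add: sum_negf del: of_nat_Suc)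
    also have "\<dots> = of_nat m * ?c m"
      unfolding Suc g by (simp add: fconst_minus fconst_mult fconst_of_nat del: of_nat_Suc)
    finally show ?thesis by simp
  qed simp
qed simp

lemma tcoef_eventually_zero: "\<exists>N. \<forall>q\<ge>N. tcoef A \<gamma> q w = 0"
proof (induction w rule: fock_induct)
  case (const c)
  then show ?case using tcoef_fconst by (metis Suc_le_eq)
next
  case (var i k p)
  then obtain N where N: "\<forall>q\<ge>N. tcoef A \<gamma> q p = 0" by blast
  have "tcoef A \<gamma> q (fvar i k * p) = 0" if "q \<ge> N + Suc k" for q
    unfolding tcoef_mult gen_sroot [symmetric]
  proof (rule sum.neutral, rule ballI)
    fix j
    show "tcoef A \<gamma> j (gen (sroot i) (Suc k)) * tcoef A \<gamma> (q - j) p = 0"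
      using N that by (cases "j \<le> Suc k") (auto simp: tcoef_gen)
  qed
  then show ?case by blast
next
  case (add p q)
  then obtain N M where "\<forall>n\<ge>N. tcoef A \<gamma> n p = 0" "\<forall>n\<ge>M. tcoef A \<gamma> n q = 0" by blast
  then have "\<forall>n\<ge>max N M. tcoef A \<gamma> n (p + q) = 0" by (simp add: tcoef_add)
  then show ?case by blast
qed

text \<open>In generating form, \<gamma>(m) E_\<delta>(x) = (\<gamma>|\<delta>) x^m E_\<delta>(x)
  for m > 0.\<close>

lemma annih_hsym: "annih A 0 \<gamma> (Suc k) (hsym \<delta> n) = (if Suc k \<le> n then fconst (bform A \<gamma> \<delta>) * hsym \<delta> (n - Suc k) else 0)"
proof (induction n rule: less_induct)
  case (less n)
  let ?b = "fconst (bform A \<gamma> \<delta>)"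
  show ?case
  proof (cases "n = 0")
    case True
    then show ?thesis using annih_fconst [of A 0 \<gamma> k 1] by simp
  next
    case False
    have "of_nat n * annih A 0 \<gamma> (Suc k) (hsym \<delta> n) = (\<Sum>l=1..n. annih A 0 \<gamma> (Suc k) (gen \<delta> l * hsym \<delta> (n - l)))"
      by (simp only: annih_of_nat_mult [symmetric] hsym_recursion annih_sum)
    \<comment> \<open>Differentiating \<open>gen \<delta> l\<close> contributes \<open>Suc k\<close>
      copies of the claimed value, and the induction hypothesis, resummed by Newton's identity, the
      other \<open>n - Suc k\<close>.\<close>
    also have "\<dots> = (\<Sum>l=1..n. (if l = Suc k then of_nat (Suc k) * ?b * hsym \<delta> (n - Suc k) else 0) +
        (if l \<le> n - Suc k \<and> Suc k \<le> n then ?b * (gen \<delta> l * hsym \<delta> (n - Suc k - l)) else 0))"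
    proof (rule sum.cong [OF refl])
      fix l assume l: "l \<in> {1..n}"
      then obtain l' where l': "l = Suc l'" by (cases l) auto
      have eq: "n - l - Suc k = n - Suc k - l" by simp
      show "annih A 0 \<gamma> (Suc k) (gen \<delta> l * hsym \<delta> (n - l)) =
          (if l = Suc k then of_nat (Suc k) * ?b * hsym \<delta> (n - Suc k) else 0) +
          (if l \<le> n - Suc k \<and> Suc k \<le> n then ?b * (gen \<delta> l * hsym \<delta> (n - Suc k - l)) else 0)"
        unfolding l' annih_gen_mult
        using less [of "n - Suc l'"] l l' eq
        by (auto simp: fconst_mult fconst_of_nat mult_ac simp del: of_nat_Suc)
    qed
    also have "\<dots> = (if Suc k \<le> n then of_nat (Suc k) * ?b * hsym \<delta> (n - Suc k) +
        ?b * (\<Sum>l=1..n - Suc k. gen \<delta> l * hsym \<delta> (n - Suc k - l)) else 0)"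
    proof (cases "Suc k \<le> n")
      case True
      have "(\<Sum>l=1..n. if l \<le> n - Suc k \<and> Suc k \<le> n then ?b * (gen \<delta> l * hsym \<delta> (n - Suc k - l)) else 0) =
          (\<Sum>l=1..n - Suc k. ?b * (gen \<delta> l * hsym \<delta> (n - Suc k - l)))"
        by (rule sum.mono_neutral_cong_right) (use True in auto)
      then show ?thesis using True by (simp add: sum.distrib sum_distrib_left del: of_nat_Suc)
    qed (auto intro!: sum.neutral)
    also have "\<dots> = (if Suc k \<le> n then (of_nat (Suc k) + of_nat (n - Suc k)) * (?b * hsym \<delta> (n - Suc k)) else 0)"
      by (simp only: hsym_recursion [symmetric]) (simp add: algebra_simps)
    also have "\<dots> = of_nat n * (if Suc k \<le> n then ?b * hsym \<delta> (n - Suc k) else 0)"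
      by (simp del: of_nat_Suc flip: of_nat_add)
    finally show ?thesis using of_nat_fock_cancel False by blast
  qed
qed

text \<open>In generating form, \<tau>_\<gamma>(z) E_\<delta>(x) = (1 - x/z)^(\<gamma>|\<delta>)
  E_\<delta>(x). For a natural number (\<gamma>|\<delta>) the factor is a polynomial, which later
  bounds the poles.\<close>

lemma tcoef_hsym: "tcoef A \<gamma> q (hsym \<delta> n) =
    (if q \<le> n then fconst ((- 1) ^ q * (bform A \<gamma> \<delta> gchoose q)) * hsym \<delta> (n - q) else 0)" (is "_ = ?c q")
proof (rule tcoef_unique)
  fix m
  let ?b = "bform A \<gamma> \<delta>"
  let ?g = "\<lambda>j. (- 1) ^ j * (?b gchoose j)"
  have "(\<Sum>k=1..m. - annih A 0 \<gamma> k (?c (m - k))) = (\<Sum>k=1..m. if m \<le> n then fconst (- ?b * ?g (m - k)) * hsym \<delta> (n - m) else 0)"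
  proof (rule sum.cong [OF refl])
    fix k assume k: "k \<in> {1..m}"
    then obtain k' where k': "k = Suc k'" by (cases k) auto
    show "- annih A 0 \<gamma> k (?c (m - k)) = (if m \<le> n then fconst (- ?b * ?g (m - k)) * hsym \<delta> (n - m) else 0)"
      using k unfolding k' by (auto simp: annih_fconst_mult annih_hsym fconst_mult_assoc fconst_minus mult.commute [of ?b])
  qed
  also have "\<dots> = (if m \<le> n then fconst (- ?b * (\<Sum>k=1..m. ?g (m - k))) * hsym \<delta> (n - m) else 0)"
    by (simp add: fconst_sum sum_distrib_left sum_distrib_right)
  also have "(\<Sum>k=1..m. ?g (m - k)) = (\<Sum>j<m. ?g j)"
    by (rule sum.reindex_bij_witness [of _ "\<lambda>j. m - j" "\<lambda>k. m - k"]) auto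
  \<comment> \<open>The alternating sum of the lower binomial coefficients is a single one with
    upper entry reduced by 1, and absorption restores the upper entry.\<close>
  also have "- ?b * (\<Sum>j<m. ?g j) = of_nat m * ?g m"
  proof (cases m)
    case (Suc m')
    have "(\<Sum>j<m. ?g j) = (- 1) ^ m' * (?b - 1 gchoose m')"
      using gbinomial_sum_lower_neg [of ?b m'] by (simp add: Suc lessThan_Suc_atMost mult.commute)
    moreover have "of_nat m * (?b gchoose m) = ?b * (?b - 1 gchoose m')"
      using gbinomial_absorption [of m' ?b] Suc by simp
    ultimately show ?thesis by (simp add: Suc algebra_simps del: of_nat_Suc)
  qed simp
  finally show "of_nat m * ?c m = (\<Sum>k=1..m. - annih A 0 \<gamma> k (?c (m - k)))"
    by (simp add: fconst_mult fconst_of_nat)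
qed simp

end

section \<open>Normally ordered products\<close>

text \<open>The monomial z^(-m). Shifts written as products can be moved by the ring laws.\<close>

abbreviation zinv :: "int \<Rightarrow> 'a::comm_ring_1 fls" where
  "zinv m \<equiv> fls_shift m 1"

lemma fls_shift_conv_zinv: "fls_shift m f = zinv m * f"
  by (simp add: fls_shifted_times_simps)

lemma zinv_mult: "zinv m * zinv n = zinv (m + n)"
  by (simp add: fls_shifted_times_simps add.commute)

lemma zinv_mult_assoc: "zinv m * (zinv n * f) = zinv (m + n) * f"
  by (simp only: mult.assoc [symmetric] zinv_mult)

abbreviation cconst :: "complex \<Rightarrow> 'l fock fls" where
  "cconst c \<equiv> fls_const (fconst c)"

lemma cconst_mult: "cconst (a * b) = cconst a * cconst b"
  by (simp add: fconst_mult)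

lemma fls_const_sum: "fls_const (sum f S) = (\<Sum>x\<in>S. fls_const (f x))"
  by (induction S rule: infinite_finite_induct) (simp_all flip: fls_plus_const)

lemma cconst_sum: "cconst (sum f S) = (\<Sum>x\<in>S. cconst (f x))"
  by (simp add: fconst_sum fls_const_sum)

lemma of_nat_conv_cconst: "of_nat n = cconst (of_nat n)"
  by (simp add: fconst_of_nat fls_of_nat)

lemma of_nat_fls_cancel:
  fixes x y :: "'l fock fls"
  assumes "of_nat n * x = of_nat n * y" "n \<noteq> 0"
  shows "x = y"
proof -
  have "cconst (1 / of_nat n) * (of_nat n * z) = z" for z :: "'l fock fls"
    unfolding of_nat_conv_cconst mult.assoc [symmetric] cconst_mult [symmetric] using assms(2) by simp
  then show ?thesis using assms(1) by metis
qed

text \<open>Fields are linear maps into Laurent series. Their vanishing at 0 allows the sums over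
  nonzero modes to be extended to a common finite range.\<close>

definition flin :: "('l fock \<Rightarrow> 'l fock fls) \<Rightarrow> bool" where
  "flin F \<longleftrightarrow> (\<forall>x y. F (x + y) = F x + F y) \<and> (\<forall>c x. F (fconst c * x) = cconst c * F x)"

lemma flinD:
  assumes "flin F"
  shows "F (x + y) = F x + F y" "F (fconst c * x) = cconst c * F x"
  using assms by (simp_all add: flin_def)

lemma flin_0: "flin F \<Longrightarrow> F 0 = 0"
  using flinD(2) [of F 0 0] by simp

lemma flin_sum: "flin F \<Longrightarrow> F (sum f S) = (\<Sum>x\<in>S. F (f x))"
  by (induction S rule: infinite_finite_induct) (simp_all add: flinD flin_0)

lemma sum_nonzero_bound:
  fixes N :: nat
  assumes "\<And>q. q \<ge> N \<Longrightarrow> x q = 0" "\<And>q. x q = 0 \<Longrightarrow> g q = 0"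
  shows "(\<Sum>q | x q \<noteq> 0. g q) = (\<Sum>q<N. g q)"
  by (rule sum.mono_neutral_left) (use assms not_le_imp_less in auto)

lemma sum_antidiagonal_bound:
  fixes f :: "nat \<Rightarrow> nat \<Rightarrow> 'a::comm_monoid_add"
  assumes "\<And>i j. i \<ge> M \<Longrightarrow> f i j = 0" "\<And>i j. j \<ge> N \<Longrightarrow> f i j = 0"
  shows "(\<Sum>i<M. \<Sum>j<N. f i j) = (\<Sum>p<M+N. \<Sum>i\<le>p. f i (p - i))"
proof -
  have nz: "i < M" "j < N" if "f i j \<noteq> 0" for i j
    using assms that not_le by metis+
  have "(\<Sum>i<M. \<Sum>j<N. f i j) = (\<Sum>(i, j)\<in>{..<M} \<times> {..<N}. f i j)"
    by (simp add: sum.cartesian_product)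
  also have "\<dots> = (\<Sum>(p, i)\<in>{(p, i). p < M + N \<and> i \<le> p \<and> i < M \<and> p - i < N}. f i (p - i))"
    by (rule sum.reindex_bij_witness [of _ "\<lambda>(p, i). (i, p - i)" "\<lambda>(i, j). (i + j, i)"]) auto
  also have "\<dots> = (\<Sum>(p, i)\<in>(SIGMA p:{..<M+N}. {..p}). f i (p - i))"
    by (rule sum.mono_neutral_left) (auto dest: nz intro: finite_subset [of _ "SIGMA p:{..<M+N}. {..p}"])
  also have "\<dots> = (\<Sum>p<M+N. \<Sum>i\<le>p. f i (p - i))"
    by (simp add: sum.Sigma)
  finally show ?thesis .
qed

text \<open>The creation half of \<partial>^k h(z) / k!, where that of h(z) is the sum of h(-m-1)
  z^m over m \<ge> 0.\<close>

definition cre :: "complex ^ 'l::finite \<Rightarrow> nat \<Rightarrow> 'l fock fls" where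
  "cre h k = fps_to_fls (Abs_fps (\<lambda>m. of_nat ((m + k) choose k) * gen h (Suc (m + k))))"

text \<open>The binomial coefficient of -n-1 over k, which arises from \<partial>^k z^(-n-1) /
  k!.\<close>

abbreviation ncoef :: "nat \<Rightarrow> nat \<Rightarrow> complex" where
  "ncoef k n \<equiv> (- 1) ^ k * of_nat ((n + k) choose k)"

context
  fixes A :: "'l::finite \<Rightarrow> 'l \<Rightarrow> complex"
begin

lemma normal_step_eq:
  assumes "\<And>n. n \<ge> N \<Longrightarrow> annih A \<beta> (sroot i) n w = 0" "F 0 = 0"
  shows "normal_step A \<beta> (i, k) F w = cre (sroot i) k * F w +
    (\<Sum>n<N. zinv (int (n + k + 1)) * (cconst (ncoef k n) * F (annih A \<beta> (sroot i) n w)))"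
proof -
  have "normal_step A \<beta> (i, k) F w = cre (sroot i) k * F w +
    (\<Sum>n | annih A \<beta> (sroot i) n w \<noteq> 0. zinv (int (n + k + 1)) * (cconst (ncoef k n) * F (annih A \<beta> (sroot i) n w)))"
    by (simp add: cre_def gen_sroot fls_shift_conv_zinv [of _ "_ * _"])
  then show ?thesis by (subst (asm) sum_nonzero_bound [of N]) (use assms in auto)
qed

lemma normal_step_zero: "normal_step A \<beta> (i, k) F 0 = cre (sroot i) k * F 0"
  by (simp add: cre_def gen_sroot)

lemma normal_step_cong:
  assumes "w \<noteq> 0" "\<And>v. v \<noteq> 0 \<Longrightarrow> F v = F' v"
  shows "normal_step A \<beta> x F w = normal_step A \<beta> x F' w"
  using assms by (cases x) (auto intro!: sum.cong)

text \<open>Creation halves act by multiplication on the value of \<open>F\<close> and annihilation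
  halves on its argument, so the two kinds never meet, and each kind commutes within itself.\<close>

lemma normal_step_commute_aux:
  assumes F: "F 0 = 0"
  shows "normal_step A \<beta> (i, k) (normal_step A \<beta> (j, l) F) w =
    normal_step A \<beta> (j, l) (normal_step A \<beta> (i, k) F) w"
proof -
  obtain N where N: "\<And>n. n \<ge> N \<Longrightarrow> annih A \<beta> (sroot i) n w = 0" using annih_eventually_zero by blast
  obtain M where M: "\<And>n. n \<ge> M \<Longrightarrow> annih A \<beta> (sroot j) n w = 0" using annih_eventually_zero by blast
  let ?i = "annih A \<beta> (sroot i)" and ?j = "annih A \<beta> (sroot j)"
  have c: "?i n (?j m w) = ?j m (?i n w)" for n m by (rule annih_commute)
  have i: "normal_step A \<beta> (j, l) F (?i n w) = cre (sroot j) l * F (?i n w) +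
    (\<Sum>m<M. zinv (int (m + l + 1)) * (cconst (ncoef l m) * F (?j m (?i n w))))" for n
    by (rule normal_step_eq) (use F M c [symmetric] in auto)
  have j: "normal_step A \<beta> (i, k) F (?j m w) = cre (sroot i) k * F (?j m w) +
    (\<Sum>n<N. zinv (int (n + k + 1)) * (cconst (ncoef k n) * F (?j m (?i n w))))" for m
    unfolding c [symmetric] by (rule normal_step_eq) (use F N c in auto)
  have "normal_step A \<beta> (i, k) (normal_step A \<beta> (j, l) F) w =
    cre (sroot i) k * (cre (sroot j) l * F w + (\<Sum>m<M. zinv (int (m + l + 1)) * (cconst (ncoef l m) * F (?j m w)))) +
    (\<Sum>n<N. zinv (int (n + k + 1)) * (cconst (ncoef k n) * (cre (sroot j) l * F (?i n w) +
      (\<Sum>m<M. zinv (int (m + l + 1)) * (cconst (ncoef l m) * F (?j m (?i n w)))))))"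
    by (subst normal_step_eq [OF N])
       (simp_all only: normal_step_zero F mult_zero_right i normal_step_eq [of M \<beta> j w F l, OF M F])
  also have "\<dots> = cre (sroot j) l * (cre (sroot i) k * F w + (\<Sum>n<N. zinv (int (n + k + 1)) * (cconst (ncoef k n) * F (?i n w)))) +
    (\<Sum>m<M. zinv (int (m + l + 1)) * (cconst (ncoef l m) * (cre (sroot i) k * F (?j m w) +
      (\<Sum>n<N. zinv (int (n + k + 1)) * (cconst (ncoef k n) * F (?j m (?i n w)))))))"
    by (simp only: distrib_left sum.distrib sum_distrib_left sum.swap [of _ "{..<M}" "{..<N}"] add_ac mult_ac)
  also have "\<dots> = normal_step A \<beta> (j, l) (normal_step A \<beta> (i, k) F) w"
    by (subst normal_step_eq [OF M])
       (simp_all only: normal_step_zero F mult_zero_right j normal_step_eq [of N \<beta> i w F k, OF N F])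
  finally show ?thesis .
qed

text \<open>\<open>fold_mset\<close> unfolds only if the steps commute on every function, including
  those with \<open>F 0 \<noteq> 0\<close>. For \<open>w \<noteq> 0\<close> the steps evaluate
  \<open>F\<close> at nonzero arguments only, so \<open>F\<close> may be reset to 0 at 0.\<close>

lemma normal_step_commute:
  "normal_step A \<beta> x (normal_step A \<beta> y F) w = normal_step A \<beta> y (normal_step A \<beta> x F) w"
proof -
  obtain i k j l where xy: "x = (i, k)" "y = (j, l)" by (metis surj_pair)
  show ?thesis
  proof (cases "w = 0")
    case True
    then show ?thesis by (simp only: xy normal_step_zero mult.left_commute)
  next
    case False
    let ?F = "\<lambda>v. if v = 0 then 0 else F v"
    have "normal_step A \<beta> x (normal_step A \<beta> y F) w = normal_step A \<beta> x (normal_step A \<beta> y ?F) w" for x y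
      by (intro normal_step_cong) (use False in auto)
    then show ?thesis using normal_step_commute_aux [of ?F] by (simp only: xy) simp
  qed
qed

lemma fold_normal_step_add_mset:
  "fold_mset (normal_step A \<beta>) F (add_mset x \<mu>) = normal_step A \<beta> x (fold_mset (normal_step A \<beta>) F \<mu>)"
proof -
  interpret comp_fun_commute "normal_step A \<beta>"
    by standard (rule ext, rule ext, simp only: o_apply normal_step_commute)
  show ?thesis by simp
qed

lemma flin_normal_step:
  assumes F: "flin F"
  shows "flin (normal_step A \<beta> x F)"
proof -
  obtain i k where x: "x = (i, k)" by (metis surj_pair)
  let ?i = "annih A \<beta> (sroot i)"
  show ?thesis
    unfolding flin_def
  proof (intro conjI allI)
    fix v w
    obtain N where N: "\<And>n. n \<ge> N \<Longrightarrow> ?i n v = 0" using annih_eventually_zero by blast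
    obtain M where M: "\<And>n. n \<ge> M \<Longrightarrow> ?i n w = 0" using annih_eventually_zero by blast
    have "?i n v = 0" "?i n w = 0" "?i n (v + w) = 0" if "n \<ge> max N M" for n
      using that N M by (simp_all add: annih_add)
    then show "normal_step A \<beta> x F (v + w) = normal_step A \<beta> x F v + normal_step A \<beta> x F w"
      unfolding x
      by (subst (1 2 3) normal_step_eq [where N = "max N M"])
         (simp_all add: flin_0 [OF F] annih_add flinD [OF F] distrib_left sum.distrib)
  next
    fix c v
    obtain N where N: "\<And>n. n \<ge> N \<Longrightarrow> ?i n v = 0" using annih_eventually_zero by blast
    then have "?i n (fconst c * v) = 0" if "n \<ge> N" for n
      using that by (simp add: annih_fconst_mult)
    with N show "normal_step A \<beta> x F (fconst c * v) = cconst c * normal_step A \<beta> x F v"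
      unfolding x
      by (subst (1 2) normal_step_eq [where N = N])
         (simp_all only: flin_0 [OF F] annih_fconst_mult flinD [OF F] distrib_left sum_distrib_left
           mult.left_commute [of "cconst c"])
  qed
qed

lemma normal_step_add:
  assumes "flin F" "flin G"
  shows "normal_step A \<beta> x (\<lambda>w. F w + G w) w = normal_step A \<beta> x F w + normal_step A \<beta> x G w"
proof -
  obtain i k where x: "x = (i, k)" by (metis surj_pair)
  obtain N where N: "\<And>n. n \<ge> N \<Longrightarrow> annih A \<beta> (sroot i) n w = 0" using annih_eventually_zero by blast
  show ?thesis
    unfolding x by (subst (1 2 3) normal_step_eq [OF N]) (simp_all add: assms flin_0 distrib_left sum.distrib)
qed

lemma normal_step_mult:
  assumes "flin F"
  shows "normal_step A \<beta> x (\<lambda>w. P * F w) w = P * normal_step A \<beta> x F w"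
proof -
  obtain i k where x: "x = (i, k)" by (metis surj_pair)
  obtain N where N: "\<And>n. n \<ge> N \<Longrightarrow> annih A \<beta> (sroot i) n w = 0" using annih_eventually_zero by blast
  show ?thesis
    unfolding x
    by (subst (1 2) normal_step_eq [OF N])
       (simp_all only: assms flin_0 mult_zero_right distrib_left sum_distrib_left mult.left_commute [of P])
qed

lemma flin_mult: "flin F \<Longrightarrow> flin (\<lambda>w. P * F w)"
  by (simp add: flin_def distrib_left mult.left_commute)

lemma flin_sum_fun: "(\<And>i. i \<in> S \<Longrightarrow> flin (F i)) \<Longrightarrow> flin (\<lambda>w. \<Sum>i\<in>S. F i w)"
  by (simp add: flin_def sum.distrib sum_distrib_left)

lemma normal_step_sum:
  assumes "finite S" "\<And>i. i \<in> S \<Longrightarrow> flin (F i)"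
  shows "normal_step A \<beta> x (\<lambda>w. \<Sum>i\<in>S. F i w) w = (\<Sum>i\<in>S. normal_step A \<beta> x (F i) w)"
  using assms
proof (induction S rule: finite_induct)
  case empty
  have "flin (\<lambda>_. 0 :: 'l fock fls)" by (simp add: flin_def)
  then show ?case using normal_step_mult [of "\<lambda>_. 0" \<beta> x 0 w] by simp
next
  case (insert j S)
  then show ?case by (simp add: normal_step_add flin_sum_fun)
qed

text \<open>\<open>normal_step\<close> handles simple roots; this is its linear extension, the
  normally ordered product with \<partial>^k h(z) / k! for arbitrary h.\<close>

definition nsg :: "complex ^ 'l \<Rightarrow> complex ^ 'l \<Rightarrow> nat \<Rightarrow> ('l fock \<Rightarrow> 'l fock fls) \<Rightarrow> 'l fock \<Rightarrow> 'l fock fls" where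
  "nsg \<beta> h k F w = (\<Sum>i\<in>UNIV. cconst (vec_nth h i) * normal_step A \<beta> (i, k) F w)"

lemma annih_expand: "annih A \<beta> h n w = (\<Sum>i\<in>UNIV. fconst (vec_nth h i) * annih A \<beta> (sroot i) n w)"
proof -
  have e: "bform A h g = (\<Sum>i\<in>UNIV. vec_nth h i * bform A (sroot i) g)" for g
  proof -
    have "bform A (sroot i) g = (\<Sum>j\<in>UNIV. A i j * vec_nth g j)" for i
    proof -
      have "bform A (sroot i) g = (\<Sum>k\<in>UNIV. if k = i then (\<Sum>j\<in>UNIV. A i j * vec_nth g j) else 0)"
        unfolding bform_def by (intro sum.cong refl) (auto simp: axis_def)
      then show ?thesis by simp
    qed
    then show ?thesis by (simp add: bform_def sum_distrib_left mult_ac)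
  qed
  show ?thesis
  proof (cases n)
    case 0
    then show ?thesis by (simp add: annih_0 e fconst_sum sum_distrib_right fconst_mult mult.assoc)
  next
    case (Suc m)
    have "annih A \<beta> h n w = (\<Sum>j\<in>UNIV. \<Sum>i\<in>UNIV. fconst (vec_nth h i) *
        (fconst (of_nat n * bform A (sroot i) (sroot j)) * pdiff j m w))"
      unfolding Suc annih_Suc
      by (subst e) (simp only: sum_distrib_left sum_distrib_right fconst_sum fconst_mult mult_ac)
    then show ?thesis
      unfolding Suc annih_Suc sum_distrib_left by (subst (asm) sum.swap)
  qed
qed

lemma cre_expand: "cre h k = (\<Sum>i\<in>UNIV. cconst (vec_nth h i) * cre (sroot i) k)"
  by (rule fls_eqI) (simp add: cre_def fls_nth_sum gen_sroot, simp add: gen_def sum_distrib_left mult_ac)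

lemma nsg_eq:
  assumes F: "flin F" and N: "\<And>n i. n \<ge> N \<Longrightarrow> annih A \<beta> (sroot i) n w = 0"
  shows "nsg \<beta> h k F w = cre h k * F w +
    (\<Sum>n<N. zinv (int (n + k + 1)) * (cconst (ncoef k n) * F (annih A \<beta> h n w)))"
proof -
  have "nsg \<beta> h k F w = (\<Sum>i\<in>UNIV. cconst (vec_nth h i) * (cre (sroot i) k * F w)) +
     (\<Sum>i\<in>UNIV. \<Sum>n<N. cconst (vec_nth h i) * (zinv (int (n + k + 1)) * (cconst (ncoef k n) * F (annih A \<beta> (sroot i) n w))))"
    unfolding nsg_def
    by (subst normal_step_eq [where N = N]) (simp_all only: N flin_0 [OF F] distrib_left sum.distrib sum_distrib_left)
  also have "(\<Sum>i\<in>UNIV. cconst (vec_nth h i) * (cre (sroot i) k * F w)) = cre h k * F w"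
    by (subst cre_expand) (simp only: sum_distrib_right mult.assoc)
  also have "(\<Sum>i\<in>UNIV. \<Sum>n<N. cconst (vec_nth h i) * (zinv (int (n + k + 1)) * (cconst (ncoef k n) * F (annih A \<beta> (sroot i) n w)))) =
      (\<Sum>n<N. zinv (int (n + k + 1)) * (cconst (ncoef k n) * F (annih A \<beta> h n w)))"
    by (subst sum.swap, rule sum.cong [OF refl], subst annih_expand [of _ h])
       (simp only: flin_sum [OF F] flinD [OF F] sum_distrib_left mult_ac)
  finally show ?thesis .
qed

lemma annih_eventually_zero_uniform: "\<exists>N. \<forall>n\<ge>N. \<forall>i. annih A \<beta> (sroot i) n w = 0"
proof -
  have "\<forall>i. \<exists>N. \<forall>n\<ge>N. annih A \<beta> (sroot i) n w = 0" using annih_eventually_zero by blast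
  then obtain N where "\<forall>i. \<forall>n\<ge>N i. annih A \<beta> (sroot i) n w = 0" by metis
  then have "\<forall>n\<ge>Max (range N). \<forall>i. annih A \<beta> (sroot i) n w = 0"
    by (meson Max_ge UNIV_I finite_class.finite_UNIV finite_imageI le_trans rangeI)
  then show ?thesis by blast
qed

section \<open>Vertex operators\<close>

lemma vexp_eq:
  assumes "\<And>q. q \<ge> N \<Longrightarrow> tcoef A \<alpha> q w = 0"
  shows "vexp A \<alpha> \<beta> w = fps_to_fls (Abs_fps (hsym \<alpha>)) * (\<Sum>q<N. zinv (int q) * fls_const (tcoef A \<alpha> q w))"
proof -
  have "fps_to_fls (exp_creat \<alpha> v) = fps_to_fls (Abs_fps (hsym \<alpha>)) * fls_const v" for v
    by (rule fls_eqI) (simp add: exp_creat_nth mult.commute [of _ "fls_const v"] mult.commute [of v])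
  then have "vexp A \<alpha> \<beta> w = (\<Sum>q | tcoef A \<alpha> q w \<noteq> 0.
      fls_shift (int q) (fps_to_fls (Abs_fps (hsym \<alpha>)) * fls_const (tcoef A \<alpha> q w)))"
    by (simp add: vexp_def exp_annih_nth)
  also have "\<dots> = (\<Sum>q<N. fls_shift (int q) (fps_to_fls (Abs_fps (hsym \<alpha>)) * fls_const (tcoef A \<alpha> q w)))"
    by (rule sum_nonzero_bound) (use assms in auto)
  also have "\<dots> = fps_to_fls (Abs_fps (hsym \<alpha>)) * (\<Sum>q<N. zinv (int q) * fls_const (tcoef A \<alpha> q w))"
    by (simp only: fls_shift_conv_zinv [of _ "_ * _"] sum_distrib_left mult_ac)
  finally show ?thesis .
qed

lemma flin_vexp: "flin (vexp A \<alpha> \<beta>)"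
  unfolding flin_def
proof (intro conjI allI)
  fix v w
  obtain N where N: "\<And>q. q \<ge> N \<Longrightarrow> tcoef A \<alpha> q v = 0" using tcoef_eventually_zero by blast
  obtain M where M: "\<And>q. q \<ge> M \<Longrightarrow> tcoef A \<alpha> q w = 0" using tcoef_eventually_zero by blast
  have "tcoef A \<alpha> q v = 0" "tcoef A \<alpha> q w = 0" "tcoef A \<alpha> q (v + w) = 0" if "q \<ge> max N M" for q
    using that N M by (simp_all add: tcoef_add)
  then show "vexp A \<alpha> \<beta> (v + w) = vexp A \<alpha> \<beta> v + vexp A \<alpha> \<beta> w"
    by (subst (1 2 3) vexp_eq [where N = "max N M"])
       (simp_all add: tcoef_add distrib_left sum.distrib flip: fls_plus_const)
next
  fix c v
  obtain N where N: "\<And>q. q \<ge> N \<Longrightarrow> tcoef A \<alpha> q v = 0" using tcoef_eventually_zero by blast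
  then have "tcoef A \<alpha> q (fconst c * v) = 0" if "q \<ge> N" for q
    using that by (simp add: tcoef_fconst_mult)
  with N show "vexp A \<alpha> \<beta> (fconst c * v) = cconst c * vexp A \<alpha> \<beta> v"
    by (subst (1 2) vexp_eq [where N = N])
       (simp_all only: tcoef_fconst_mult fls_const_mult_const [symmetric] sum_distrib_left
         mult.left_commute [of "cconst c"])
qed

lemma flin_fold_normal_step: "flin (fold_mset (normal_step A \<beta>) (vexp A \<alpha> \<beta>) \<mu>)"
  by (induction \<mu>) (simp_all add: flin_vexp fold_normal_step_add_mset flin_normal_step)

lemma vertex_op_single:
  "vertex_op A \<alpha> \<beta> (Poly_Mapping.single \<mu> c) w = cconst c * fold_mset (normal_step A \<beta>) (vexp A \<alpha> \<beta>) \<mu> w"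
  by (cases "c = 0") (simp_all add: vertex_op_def)

lemma vertex_op_add: "vertex_op A \<alpha> \<beta> (u + v) w = vertex_op A \<alpha> \<beta> u w + vertex_op A \<alpha> \<beta> v w"
  unfolding vertex_op_def
  by (rule sum_keys_add) (simp_all add: fconst_add distrib_right flip: fls_plus_const)

lemma vertex_op_fconst: "vertex_op A \<alpha> \<beta> (fconst c) w = cconst c * vexp A \<alpha> \<beta> w"
  by (simp add: fconst_def vertex_op_single [unfolded fconst_def])

lemma flin_vertex_op: "flin (vertex_op A \<alpha> \<beta> u)"
  using flin_fold_normal_step [of \<beta> \<alpha>]
  by (simp add: vertex_op_def flin_def distrib_left sum.distrib sum_distrib_left mult.left_commute)

lemma vertex_op_fconst_mult: "vertex_op A \<alpha> \<beta> (fconst c * u) w = cconst c * vertex_op A \<alpha> \<beta> u w"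
proof (induction u rule: poly_mapping_induct)
  case (single \<mu> d)
  have "fconst c * Poly_Mapping.single \<mu> d = Poly_Mapping.single \<mu> (c * d)"
    by (simp add: fconst_def mult_single)
  then show ?case by (simp add: vertex_op_single cconst_mult mult.assoc del: fls_const_mult_const)
next
  case (sum p q)
  then show ?case by (simp add: distrib_left vertex_op_add)
qed

text \<open>The reconstruction formula as a recursion. With \<open>fock_induct\<close>, claims about
  all vertex operators reduce to \<open>vexp\<close> and to compatibility with
  \<open>normal_step\<close>.\<close>

lemma vertex_op_fvar_mult:
  "vertex_op A \<alpha> \<beta> (fvar i k * u) w = normal_step A \<beta> (i, k) (vertex_op A \<alpha> \<beta> u) w"
proof (induction u rule: poly_mapping_induct)
  case (single \<mu> c)
  have "vertex_op A \<alpha> \<beta> (Poly_Mapping.single \<mu> c) = (\<lambda>w. cconst c * fold_mset (normal_step A \<beta>) (vexp A \<alpha> \<beta>) \<mu> w)"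
    by (rule ext) (rule vertex_op_single)
  then show ?case
    by (simp only: single_add_mset [symmetric] vertex_op_single fold_normal_step_add_mset
        normal_step_mult [OF flin_fold_normal_step])
next
  case (sum p q)
  have "vertex_op A \<alpha> \<beta> (p + q) = (\<lambda>w. vertex_op A \<alpha> \<beta> p w + vertex_op A \<alpha> \<beta> q w)"
    by (rule ext) (rule vertex_op_add)
  then show ?case
    by (simp only: distrib_left vertex_op_add sum
        normal_step_add [OF flin_vertex_op flin_vertex_op])
qed

lemma vertex_op_sum: "vertex_op A \<alpha> \<beta> (sum f S) w = (\<Sum>x\<in>S. vertex_op A \<alpha> \<beta> (f x) w)"
  using vertex_op_fconst_mult [of \<alpha> \<beta> 0 0 w]
  by (induction S rule: infinite_finite_induct) (simp_all add: vertex_op_add)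

lemma vertex_op_gen_mult: "vertex_op A \<alpha> \<beta> (gen h (Suc k) * u) w = nsg \<beta> h k (vertex_op A \<alpha> \<beta> u) w"
  by (simp only: gen_def sum_distrib_right mult.assoc vertex_op_sum vertex_op_fconst_mult vertex_op_fvar_mult
      nsg_def diff_Suc_1)

end

section \<open>Splitting off a complete symmetric polynomial\<close>

text \<open>\<open>dser \<gamma> i\<close> is the coefficient of \<open>t\<^sup>i\<close> in \<open>E\<^sub>\<gamma>(z + t)\<close>, where
  \<open>E\<^sub>\<gamma>(z) = exp (\<Sum>\<^sub>n\<^sub>>\<^sub>0 \<gamma>(-n)/n z\<^sup>n)\<close> has the coefficients \<open>hsym \<gamma>\<close>.\<close>

definition dser :: "complex ^ 'l::finite \<Rightarrow> nat \<Rightarrow> 'l fock fls" where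
  "dser \<gamma> i = fps_to_fls (Abs_fps (\<lambda>r. of_nat ((i + r) choose i) * hsym \<gamma> (i + r)))"

lemma dser_0: "dser \<gamma> 0 = fps_to_fls (Abs_fps (hsym \<gamma>))"
  by (simp add: dser_def)

text \<open>The t-derivative of E_\<gamma>(z + t) is the creation half of \<gamma>(z + t) times
  E_\<gamma>(z + t). On coefficients this is Newton's identity of order \<open>n + r\<close>,
  weighted by binomial coefficients.\<close>

lemma dser_recursion: "of_nat n * dser \<gamma> n = (\<Sum>k=1..n. cre \<gamma> (k - 1) * dser \<gamma> (n - k))"
proof -
  have vdm: "(\<Sum>k=1..n. ((l - 1) choose (k - 1)) * ((n + r - l) choose (n - k))) = (n + r - 1) choose (n - 1)"
    if "l \<in> {1..n+r}" "n > 0" for l r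
  proof -
    have "(\<Sum>k=1..n. ((l - 1) choose (k - 1)) * ((n + r - l) choose (n - k))) =
        (\<Sum>k\<le>n-1. ((l - 1) choose k) * ((n + r - l) choose (n - 1 - k)))"
      by (rule sum.reindex_bij_witness [of _ "\<lambda>k. k + 1" "\<lambda>k. k - 1"]) (use that in auto)
    also have "\<dots> = (l - 1 + (n + r - l)) choose (n - 1)" by (rule vandermonde)
    also have "l - 1 + (n + r - l) = n + r - 1" using that by auto
    finally show ?thesis .
  qed
  let ?c = "\<lambda>k. Abs_fps (\<lambda>m. of_nat ((m + (k - 1)) choose (k - 1)) * gen \<gamma> (Suc (m + (k - 1))))"
  let ?d = "\<lambda>i. Abs_fps (\<lambda>r. of_nat ((i + r) choose i) * hsym \<gamma> (i + r))"
  have "of_nat n * fps_nth (?d n) r = (\<Sum>k=1..n. fps_nth (?c k * ?d (n - k)) r)" for r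
  proof (cases "n = 0")
    case False
    have "(\<Sum>k=1..n. fps_nth (?c k * ?d (n - k)) r) =
        (\<Sum>k=1..n. \<Sum>l=1..n+r. of_nat (((l - 1) choose (k - 1)) * ((n + r - l) choose (n - k))) * (gen \<gamma> l * hsym \<gamma> (n + r - l)))"
    proof (rule sum.cong [OF refl])
      fix k assume k: "k \<in> {1..n}"
      have "fps_nth (?c k * ?d (n - k)) r = (\<Sum>m=0..r. of_nat ((m + (k - 1)) choose (k - 1)) * gen \<gamma> (Suc (m + (k - 1))) *
          (of_nat ((n - k + (r - m)) choose (n - k)) * hsym \<gamma> (n - k + (r - m))))"
        by (simp add: fps_mult_nth)
      also have "\<dots> = (\<Sum>l=k..k+r. of_nat (((l - 1) choose (k - 1)) * ((n + r - l) choose (n - k))) * (gen \<gamma> l * hsym \<gamma> (n + r - l)))"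
      proof (rule sum.reindex_bij_witness [of _ "\<lambda>l. l - k" "\<lambda>m. m + k"])
        fix m assume m: "m \<in> {0..r}"
        have "m + (k - 1) = m + k - 1" "Suc (m + (k - 1)) = m + k" "n - k + (r - m) = n + r - (m + k)"
          using k m by auto
        then show "of_nat (((m + k - 1) choose (k - 1)) * ((n + r - (m + k)) choose (n - k))) * (gen \<gamma> (m + k) * hsym \<gamma> (n + r - (m + k))) =
            of_nat ((m + (k - 1)) choose (k - 1)) * gen \<gamma> (Suc (m + (k - 1))) *
            (of_nat ((n - k + (r - m)) choose (n - k)) * hsym \<gamma> (n - k + (r - m)))"
          by (simp only: of_nat_mult mult_ac)
      qed auto
      \<comment> \<open>One of the two binomial coefficients vanishes outside
        \<open>{k..k+r}\<close>. The enlarged range no longer depends on \<open>k\<close>, so the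
        sums can be interchanged and \<open>vdm\<close> applied.\<close>
      also have "\<dots> = (\<Sum>l=1..n+r. of_nat (((l - 1) choose (k - 1)) * ((n + r - l) choose (n - k))) * (gen \<gamma> l * hsym \<gamma> (n + r - l)))"
      proof (rule sum.mono_neutral_left)
        show "\<forall>l\<in>{1..n + r} - {k..k + r}. of_nat (((l - 1) choose (k - 1)) * ((n + r - l) choose (n - k))) * (gen \<gamma> l * hsym \<gamma> (n + r - l)) = 0"
        proof
          fix l assume "l \<in> {1..n + r} - {k..k + r}"
          then have "l - 1 < k - 1 \<or> n + r - l < n - k" using k by auto
          then have "((l - 1) choose (k - 1)) * ((n + r - l) choose (n - k)) = 0" by (auto simp: binomial_eq_0)
          then show "of_nat (((l - 1) choose (k - 1)) * ((n + r - l) choose (n - k))) * (gen \<gamma> l * hsym \<gamma> (n + r - l)) = 0"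
            by (simp only: of_nat_0 mult_zero_left)
        qed
      qed (use k in auto)
      finally show "fps_nth (?c k * ?d (n - k)) r =
          (\<Sum>l=1..n+r. of_nat (((l - 1) choose (k - 1)) * ((n + r - l) choose (n - k))) * (gen \<gamma> l * hsym \<gamma> (n + r - l)))" .
    qed
    also have "\<dots> = (\<Sum>l=1..n+r. of_nat (\<Sum>k=1..n. ((l - 1) choose (k - 1)) * ((n + r - l) choose (n - k))) * (gen \<gamma> l * hsym \<gamma> (n + r - l)))"
      by (subst sum.swap) (simp only: of_nat_sum sum_distrib_right)
    also have "\<dots> = (\<Sum>l=1..n+r. of_nat ((n + r - 1) choose (n - 1)) * (gen \<gamma> l * hsym \<gamma> (n + r - l)))"
      using False by (intro sum.cong refl, subst vdm) auto
    also have "\<dots> = of_nat ((n + r - 1) choose (n - 1)) * (of_nat (n + r) * hsym \<gamma> (n + r))"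
      by (simp only: hsym_recursion sum_distrib_left)
    also have "\<dots> = of_nat (((n + r - 1) choose (n - 1)) * (n + r)) * hsym \<gamma> (n + r)"
      by (simp only: of_nat_mult mult_ac)
    also have "((n + r - 1) choose (n - 1)) * (n + r) = n * ((n + r) choose n)"
      using binomial_absorption [of "n - 1" "n + r"] False by (simp add: mult.commute)
    finally show ?thesis by (simp only: fps_nth_Abs_fps of_nat_mult mult.assoc)
  qed simp
  then have "of_nat n * ?d n = (\<Sum>k=1..n. ?c k * ?d (n - k))"
    by (intro fps_ext) (simp add: fps_sum_nth fps_of_nat [symmetric] del: fps_of_nat)
  then have "fps_to_fls (of_nat n * ?d n) = fps_to_fls (\<Sum>k=1..n. ?c k * ?d (n - k))" by (rule arg_cong)
  moreover have "fps_to_fls (sum f S) = (\<Sum>x\<in>S. fps_to_fls (f x))" for f :: "nat \<Rightarrow> 'a fock fps" and S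
    by (induction S rule: infinite_finite_induct) simp_all
  moreover have "fps_to_fls (of_nat m) = (of_nat m :: 'a fock fls)" for m
    by (induction m) simp_all
  ultimately show ?thesis
    by (simp only: dser_def cre_def fls_times_fps_to_fls)
qed

context
  fixes A :: "'l::finite \<Rightarrow> 'l \<Rightarrow> complex"
begin

text \<open>Let \<open>\<tau>(z) = exp (- \<Sum>\<^sub>n\<^sub>>\<^sub>0 \<gamma>(n)/n z\<^sup>-\<^sup>n)\<close>.  Then \<open>z\<^sup>c bop \<gamma> c j F w\<close> is the coefficient of \<open>t\<^sup>j\<close> in
  \<open>F ((z + t)\<^sup>c \<tau>(z + t) w)\<close>, and \<open>z\<^sup>c gop \<gamma> c n F w\<close> that of \<open>t\<^sup>n\<close> in
  \<open>E\<^sub>\<gamma>(z + t) F ((z + t)\<^sup>c \<tau>(z + t) w)\<close>.  The recursions below express that differentiation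
  in \<open>t\<close> is normally ordered multiplication by \<open>\<gamma>(z + t)\<close>.\<close>

definition bop :: "complex ^ 'l \<Rightarrow> complex \<Rightarrow> nat \<Rightarrow> ('l fock \<Rightarrow> 'l fock fls) \<Rightarrow> 'l fock \<Rightarrow> 'l fock fls" where
  "bop \<gamma> c j F w = (\<Sum>q | tcoef A \<gamma> q w \<noteq> 0.
     zinv (int (q + j)) * (cconst ((c - of_nat q) gchoose j) * F (tcoef A \<gamma> q w)))"

definition gop :: "complex ^ 'l \<Rightarrow> complex \<Rightarrow> nat \<Rightarrow> ('l fock \<Rightarrow> 'l fock fls) \<Rightarrow> 'l fock \<Rightarrow> 'l fock fls" where
  "gop \<gamma> c n F w = (\<Sum>i\<le>n. dser \<gamma> i * bop \<gamma> c (n - i) F w)"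

lemma bop_eq:
  assumes "flin F" "\<And>q. q \<ge> N \<Longrightarrow> tcoef A \<gamma> q w = 0"
  shows "bop \<gamma> c j F w = (\<Sum>q<N. zinv (int (q + j)) * (cconst ((c - of_nat q) gchoose j) * F (tcoef A \<gamma> q w)))"
  unfolding bop_def by (rule sum_nonzero_bound) (use assms in \<open>auto simp: flin_0\<close>)

lemma flin_bop:
  assumes F: "flin F"
  shows "flin (bop \<gamma> c j F)"
  unfolding flin_def
proof (intro conjI allI)
  fix v w
  obtain N where N: "\<And>q. q \<ge> N \<Longrightarrow> tcoef A \<gamma> q v = 0" using tcoef_eventually_zero by blast
  obtain M where M: "\<And>q. q \<ge> M \<Longrightarrow> tcoef A \<gamma> q w = 0" using tcoef_eventually_zero by blast
  have "tcoef A \<gamma> q v = 0" "tcoef A \<gamma> q w = 0" "tcoef A \<gamma> q (v + w) = 0" if "q \<ge> max N M" for q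
    using that N M by (simp_all add: tcoef_add)
  then show "bop \<gamma> c j F (v + w) = bop \<gamma> c j F v + bop \<gamma> c j F w"
    by (subst (1 2 3) bop_eq [OF F, where N = "max N M"])
       (simp_all add: tcoef_add flinD [OF F] distrib_left sum.distrib)
next
  fix d v
  obtain N where N: "\<And>q. q \<ge> N \<Longrightarrow> tcoef A \<gamma> q v = 0" using tcoef_eventually_zero by blast
  then have "tcoef A \<gamma> q (fconst d * v) = 0" if "q \<ge> N" for q
    using that by (simp add: tcoef_fconst_mult)
  with N show "bop \<gamma> c j F (fconst d * v) = cconst d * bop \<gamma> c j F v"
    by (subst (1 2) bop_eq [OF F, where N = N])
       (simp_all only: tcoef_fconst_mult flinD [OF F] sum_distrib_left mult.left_commute [of "cconst d"])
qed

lemma flin_gop: "flin F \<Longrightarrow> flin (gop \<gamma> c n F)"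
  unfolding gop_def by (intro flin_sum_fun flin_mult flin_bop)

text \<open>The annihilation modes commute with \<tau>_\<gamma> (\<open>tcoef_annih\<close>), and
  the creation half is a multiplication from outside.\<close>

lemma normal_step_bop:
  assumes F: "flin F"
  shows "normal_step A \<beta> x (bop \<gamma> c j F) w = bop \<gamma> c j (normal_step A \<beta> x F) w"
proof -
  obtain i k where x: "x = (i, k)" by (metis surj_pair)
  let ?i = "annih A \<beta> (sroot i)" and ?t = "tcoef A \<gamma>"
  obtain N where N: "\<And>n. n \<ge> N \<Longrightarrow> ?i n w = 0" using annih_eventually_zero by blast
  obtain M where M: "\<And>q. q \<ge> M \<Longrightarrow> ?t q w = 0" using tcoef_eventually_zero by blast
  have tN: "?i n (?t q w) = 0" if "n \<ge> N" for n q using N [OF that] by (simp flip: tcoef_annih)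
  have tM: "?t q (?i n w) = 0" if "q \<ge> M" for n q using M [OF that] by (simp add: tcoef_annih)
  let ?g = "\<lambda>q. cconst ((c - of_nat q) gchoose j)"
  have "normal_step A \<beta> x (bop \<gamma> c j F) w = cre (sroot i) k * bop \<gamma> c j F w +
      (\<Sum>n<N. zinv (int (n + k + 1)) * (cconst (ncoef k n) * bop \<gamma> c j F (?i n w)))"
    unfolding x by (rule normal_step_eq [OF N]) (simp_all add: flin_0 flin_bop F)
  also have "\<dots> = cre (sroot i) k * (\<Sum>q<M. zinv (int (q + j)) * (?g q * F (?t q w))) +
      (\<Sum>n<N. zinv (int (n + k + 1)) * (cconst (ncoef k n) * (\<Sum>q<M. zinv (int (q + j)) * (?g q * F (?i n (?t q w))))))"
    by (simp only: bop_eq [OF F M] bop_eq [OF F tM] tcoef_annih)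
  also have "\<dots> = (\<Sum>q<M. zinv (int (q + j)) * (?g q * (cre (sroot i) k * F (?t q w) +
      (\<Sum>n<N. zinv (int (n + k + 1)) * (cconst (ncoef k n) * F (?i n (?t q w)))))))"
    by (simp only: distrib_left sum.distrib sum_distrib_left sum.swap [of _ "{..<M}" "{..<N}"] mult_ac)
  also have "\<dots> = (\<Sum>q<M. zinv (int (q + j)) * (?g q * normal_step A \<beta> x F (?t q w)))"
    unfolding x by (subst normal_step_eq [OF tN]) (simp_all only: flin_0 [OF F])
  also have "\<dots> = bop \<gamma> c j (normal_step A \<beta> x F) w"
    by (rule bop_eq [OF flin_normal_step [OF F] M, symmetric])
  finally show ?thesis .
qed

lemma normal_step_gop:
  assumes F: "flin F"
  shows "normal_step A \<beta> x (gop \<gamma> c n F) w = gop \<gamma> c n (normal_step A \<beta> x F) w"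
  unfolding gop_def
  by (simp add: normal_step_sum normal_step_mult flin_mult flin_bop F normal_step_bop)

text \<open>At t = 0 this is E_(\<gamma>+\<alpha>) = E_\<gamma> E_\<alpha> together with
  \<tau>_(\<gamma>+\<alpha>) = \<tau>_\<alpha> \<tau>_\<gamma>. As \<open>gop\<close> puts the field
  between E_\<gamma> and \<tau>_\<gamma>, no contraction factor appears.\<close>

lemma gop_vexp: "gop \<gamma> c 0 (vexp A \<alpha> \<delta>) w = vexp A (\<gamma> + \<alpha>) \<delta> w"
proof -
  let ?t = "tcoef A \<gamma>" and ?E = "\<lambda>\<alpha>. fps_to_fls (Abs_fps (hsym \<alpha>))"
  obtain N where N: "\<And>q. q \<ge> N \<Longrightarrow> ?t q w = 0" using tcoef_eventually_zero by blast
  have "\<forall>q. \<exists>M. \<forall>r\<ge>M. tcoef A \<alpha> r (?t q w) = 0" using tcoef_eventually_zero by blast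
  then obtain m where m: "\<And>q r. r \<ge> m q \<Longrightarrow> tcoef A \<alpha> r (?t q w) = 0" by metis
  define M where "M = (\<Sum>q<N. m q)"
  have M: "tcoef A \<alpha> r (?t q w) = 0" if "r \<ge> M" for q r
  proof (cases "q < N")
    case True
    then have "m q \<le> M" unfolding M_def by (intro member_le_sum) auto
    then show ?thesis using m that by force
  qed (simp add: N)
  have E: "?E (\<gamma> + \<alpha>) = ?E \<gamma> * ?E \<alpha>"
    unfolding fls_times_fps_to_fls [symmetric]
    by (rule arg_cong [where f = fps_to_fls], rule fps_ext)
       (simp add: hsym_add fps_mult_nth atLeast0AtMost)
  have T: "tcoef A (\<gamma> + \<alpha>) p w = (\<Sum>r\<le>p. tcoef A \<alpha> r (?t (p - r) w))" for p
    by (subst add.commute) (rule tcoef_gamma_add)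
  have Tz: "tcoef A (\<gamma> + \<alpha>) p w = 0" if "p \<ge> M + N" for p
    unfolding T
  proof (rule sum.neutral, rule ballI)
    fix r assume "r \<in> {..p}"
    then show "tcoef A \<alpha> r (?t (p - r) w) = 0"
      using that M N by (cases "r \<ge> M") auto
  qed
  have "gop \<gamma> c 0 (vexp A \<alpha> \<delta>) w = ?E \<gamma> * (\<Sum>q<N. zinv (int q) * vexp A \<alpha> \<delta> (?t q w))"
    by (simp add: gop_def dser_0 bop_eq [OF flin_vexp N])
  also have "\<dots> = ?E \<gamma> * (\<Sum>q<N. zinv (int q) * (?E \<alpha> * (\<Sum>r<M. zinv (int r) * fls_const (tcoef A \<alpha> r (?t q w)))))"
    by (subst vexp_eq [OF M]) simp_all
  also have "\<dots> = ?E \<gamma> * ?E \<alpha> * (\<Sum>r<M. \<Sum>q<N. zinv (int q) * (zinv (int r) * fls_const (tcoef A \<alpha> r (?t q w))))"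
    by (simp only: sum.swap [of _ "{..<M}"] sum_distrib_left mult_ac)
  also have "\<dots> = ?E (\<gamma> + \<alpha>) * (\<Sum>r<M. \<Sum>q<N. zinv (int (q + r)) * fls_const (tcoef A \<alpha> r (?t q w)))"
    by (simp only: E zinv_mult_assoc of_nat_add)
  also have "(\<Sum>r<M. \<Sum>q<N. zinv (int (q + r)) * fls_const (tcoef A \<alpha> r (?t q w))) =
      (\<Sum>p<M+N. \<Sum>r\<le>p. zinv (int (p - r + r)) * fls_const (tcoef A \<alpha> r (?t (p - r) w)))"
    by (rule sum_antidiagonal_bound) (simp_all add: M N)
  also have "\<dots> = (\<Sum>p<M+N. zinv (int p) * fls_const (tcoef A (\<gamma> + \<alpha>) p w))"
    by (rule sum.cong [OF refl]) (simp add: T fls_const_sum sum_distrib_left)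
  also have "?E (\<gamma> + \<alpha>) * \<dots> = vexp A (\<gamma> + \<alpha>) \<delta> w"
    by (rule vexp_eq [OF Tz, symmetric])
  finally show ?thesis .
qed

text \<open>The coefficient of t^(j-1) in (1 + t)^(-m-1) (1 + t)^(c+m) = (1 + t)^(c-1):
  \<open>ncoef\<close> supplies the first factor.\<close>

lemma binomial_convolution:
  fixes c :: complex
  assumes "j > 0"
  shows "(\<Sum>k=1..j. ncoef (k - 1) m * (c + of_nat m gchoose (j - k))) = (c - 1) gchoose (j - 1)"
proof -
  have "(\<Sum>k=1..j. ncoef (k - 1) m * (c + of_nat m gchoose (j - k))) =
      (\<Sum>k=0..j-1. ncoef k m * (c + of_nat m gchoose (j - 1 - k)))"
    by (rule sum.reindex_bij_witness [of _ "\<lambda>k. k + 1" "\<lambda>k. k - 1"]) (use assms in auto)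
  also have "\<dots> = (\<Sum>k=0..j-1. (- of_nat m - 1 gchoose k) * (c + of_nat m gchoose (j - 1 - k)))"
  proof (rule sum.cong [OF refl])
    fix k
    have "- of_nat m - 1 = - (of_nat m + 1 :: complex)" by simp
    then have "(- of_nat m - 1 gchoose k :: complex) = ncoef k m"
      by (simp only: gbinomial_minus) (simp add: binomial_gbinomial add_ac)
    then show "ncoef k m * (c + of_nat m gchoose (j - 1 - k)) =
        (- of_nat m - 1 gchoose k) * (c + of_nat m gchoose (j - 1 - k))" by simp
  qed
  also have "\<dots> = (- of_nat m - 1 + (c + of_nat m)) gchoose (j - 1)"
    by (rule gbinomial_Vandermonde)
  finally show ?thesis by simp
qed

text \<open>The coefficients of z d/dz applied to z^c \<tau>_\<gamma>(z), c = (\<gamma>|\<delta>):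
  the zero mode gives c, the positive modes give -p by \<open>tcoef_recursion\<close>.\<close>

lemma annih_tcoef_sum:
  "(\<Sum>m\<le>p. tcoef A \<gamma> (p - m) (annih A \<delta> \<gamma> m w)) = fconst (bform A \<gamma> \<delta> - of_nat p) * tcoef A \<gamma> p w"
proof -
  have "(\<Sum>m\<le>p. tcoef A \<gamma> (p - m) (annih A \<delta> \<gamma> m w)) =
      tcoef A \<gamma> p (annih A \<delta> \<gamma> 0 w) + (\<Sum>m=1..p. annih A 0 \<gamma> m (tcoef A \<gamma> (p - m) w))"
    unfolding atMost_atLeast0 sum.atLeast_Suc_atMost [OF le0]
    by (auto simp: tcoef_annih intro!: sum.cong annih_indep)
  also have "(\<Sum>m=1..p. annih A 0 \<gamma> m (tcoef A \<gamma> (p - m) w)) = - (of_nat p * tcoef A \<gamma> p w)"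
    by (simp add: tcoef_recursion sum_negf)
  finally show ?thesis
    by (simp add: annih_0 tcoef_fconst_mult fconst_diff fconst_of_nat left_diff_distrib)
qed

text \<open>The t-derivative of (z + t)^c \<tau>_\<gamma>(z + t) is obtained by applying the half of
  \<gamma>(z + t) with modes n \<ge> 0. The exponent must be c = (\<gamma>|\<delta>), the value of
  the mode \<gamma>(0).\<close>

lemma bop_recursion:
  assumes F: "flin F" and L: "\<And>m. m \<ge> L \<Longrightarrow> annih A \<delta> \<gamma> m w = 0"
  shows "of_nat j * bop \<gamma> (bform A \<gamma> \<delta>) j F w =
    (\<Sum>k=1..j. \<Sum>m<L. zinv (int (m + k)) * (cconst (ncoef (k - 1) m) * bop \<gamma> (bform A \<gamma> \<delta>) (j - k) F (annih A \<delta> \<gamma> m w)))"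
proof (cases "j = 0")
  case False
  let ?t = "tcoef A \<gamma>" and ?i = "annih A \<delta> \<gamma>" and ?c = "bform A \<gamma> \<delta>"
  obtain N where N: "\<And>q. q \<ge> N \<Longrightarrow> ?t q w = 0" using tcoef_eventually_zero by blast
  have tN: "?t q (?i n w) = 0" if "q \<ge> N" for n q using N [OF that] by (simp add: tcoef_annih)
  have N': "?t q w = 0" if "q \<ge> L + N" for q using N that by simp
  let ?f = "\<lambda>p m. \<Sum>k=1..j. zinv (int (p + j)) * (cconst (ncoef (k - 1) m) * (cconst ((?c - of_nat (p - m)) gchoose (j - k)) * F (?t (p - m) (?i m w))))"
  have "(\<Sum>k=1..j. \<Sum>m<L. zinv (int (m + k)) * (cconst (ncoef (k - 1) m) * bop \<gamma> ?c (j - k) F (?i m w))) =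
     (\<Sum>k=1..j. \<Sum>m<L. \<Sum>q<N. zinv (int (m + k)) * (cconst (ncoef (k - 1) m) *
        (zinv (int (q + (j - k))) * (cconst ((?c - of_nat q) gchoose (j - k)) * F (?t q (?i m w))))))"
    by (simp only: bop_eq [OF F tN] sum_distrib_left)
  also have "\<dots> = (\<Sum>k=1..j. \<Sum>m<L. \<Sum>q<N. zinv (int (m + q + j)) * (cconst (ncoef (k - 1) m) *
        (cconst ((?c - of_nat q) gchoose (j - k)) * F (?t q (?i m w)))))"
  proof (intro sum.cong refl)
    fix k m q assume "k \<in> {1..j}"
    then have "int (m + k) + int (q + (j - k)) = int (m + q + j)" by auto
    then show "zinv (int (m + k)) * (cconst (ncoef (k - 1) m) *
        (zinv (int (q + (j - k))) * (cconst ((?c - of_nat q) gchoose (j - k)) * F (?t q (?i m w))))) =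
        zinv (int (m + q + j)) * (cconst (ncoef (k - 1) m) * (cconst ((?c - of_nat q) gchoose (j - k)) * F (?t q (?i m w))))"
      by (simp only: mult.left_commute [of "cconst _" "zinv _"] zinv_mult_assoc)
  qed
  also have "\<dots> = (\<Sum>m<L. \<Sum>q<N. \<Sum>k=1..j. zinv (int (m + q + j)) * (cconst (ncoef (k - 1) m) *
        (cconst ((?c - of_nat q) gchoose (j - k)) * F (?t q (?i m w)))))"
    by (simp only: sum.swap [where A = "{1..j}"])
  \<comment> \<open>Terms are collected by \<open>p = m + q\<close>, the total power of z^(-1) from
    the mode and from \<tau>_\<gamma>. For fixed \<open>p\<close> the sum over \<open>k\<close> no
    longer depends on \<open>m\<close>, except through the argument of \<open>F\<close>.\<close>
  also have "\<dots> = (\<Sum>p<L+N. \<Sum>m\<le>p. \<Sum>k=1..j. zinv (int (m + (p - m) + j)) * (cconst (ncoef (k - 1) m) *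
        (cconst ((?c - of_nat (p - m)) gchoose (j - k)) * F (?t (p - m) (?i m w)))))"
    by (rule sum_antidiagonal_bound) (simp_all add: L tN flin_0 [OF F])
  also have "\<dots> = (\<Sum>p<L+N. \<Sum>m\<le>p. ?f p m)"
    by (intro sum.cong refl) auto
  also have "\<dots> = (\<Sum>p<L+N. of_nat j * (zinv (int (p + j)) * (cconst ((?c - of_nat p) gchoose j) * F (?t p w))))"
  proof (rule sum.cong [OF refl])
    fix p
    have "?f p m = zinv (int (p + j)) * (cconst ((?c - of_nat p - 1) gchoose (j - 1)) * F (?t (p - m) (?i m w)))"
      if "m \<le> p" for m
    proof -
      have "?c - of_nat (p - m) = ?c - of_nat p + of_nat m" using that by (simp add: of_nat_diff)
      then have "?f p m = zinv (int (p + j)) * (cconst (\<Sum>k=1..j. ncoef (k - 1) m * (?c - of_nat p + of_nat m gchoose (j - k))) * F (?t (p - m) (?i m w)))"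
        by (simp only: cconst_sum cconst_mult sum_distrib_left sum_distrib_right mult.assoc)
      then show ?thesis using binomial_convolution [of j m "?c - of_nat p"] False by simp
    qed
    then have "(\<Sum>m\<le>p. ?f p m) = (\<Sum>m\<le>p. zinv (int (p + j)) * (cconst ((?c - of_nat p - 1) gchoose (j - 1)) * F (?t (p - m) (?i m w))))"
      by (intro sum.cong refl) simp
    also have "\<dots> = zinv (int (p + j)) * (cconst ((?c - of_nat p - 1) gchoose (j - 1)) * F (\<Sum>m\<le>p. ?t (p - m) (?i m w)))"
      by (simp only: flin_sum [OF F] sum_distrib_left)
    also have "\<dots> = zinv (int (p + j)) * (cconst (((?c - of_nat p - 1) gchoose (j - 1)) * (?c - of_nat p)) * F (?t p w))"
      by (simp only: annih_tcoef_sum flinD [OF F] cconst_mult mult.assoc)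
    also have "((?c - of_nat p - 1) gchoose (j - 1)) * (?c - of_nat p) = of_nat j * ((?c - of_nat p) gchoose j)"
      using gbinomial_absorption [of "j - 1" "?c - of_nat p"] False by (simp add: mult.commute)
    finally show "(\<Sum>m\<le>p. ?f p m) = of_nat j * (zinv (int (p + j)) * (cconst ((?c - of_nat p) gchoose j) * F (?t p w)))"
      by (simp only: of_nat_conv_cconst cconst_mult mult_ac)
  qed
  also have "\<dots> = of_nat j * bop \<gamma> ?c j F w"
    by (simp only: bop_eq [OF F N'] sum_distrib_left)
  finally show ?thesis by simp
qed simp

text \<open>By the Leibniz rule the creation half of \<gamma>(z + t) comes from
  \<open>dser_recursion\<close> and the other half from \<open>bop_recursion\<close>; together they
  form the normally ordered product \<open>nsg\<close>.\<close>

lemma gop_recursion: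
  assumes F: "flin F"
  shows "of_nat n * gop \<gamma> (bform A \<gamma> \<delta>) n F w =
    (\<Sum>k=1..n. nsg A \<delta> \<gamma> (k - 1) (gop \<gamma> (bform A \<gamma> \<delta>) (n - k) F) w)"
proof -
  let ?c = "bform A \<gamma> \<delta>" and ?i = "annih A \<delta> \<gamma>"
  obtain L where L: "\<And>m i. m \<ge> L \<Longrightarrow> annih A \<delta> (sroot i) m w = 0"
    using annih_eventually_zero_uniform by blast
  then have L': "?i m w = 0" if "m \<ge> L" for m using that by (subst annih_expand) simp
  let ?F = "\<lambda>k i j. cre \<gamma> (k - 1) * dser \<gamma> i * bop \<gamma> ?c j F w"
  let ?G = "\<lambda>k i j. dser \<gamma> i * (\<Sum>m<L. zinv (int (m + k)) * (cconst (ncoef (k - 1) m) * bop \<gamma> ?c j F (?i m w)))"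
  have "of_nat i * (dser \<gamma> i * bop \<gamma> ?c j F w) = (\<Sum>k=1..i. ?F k (i - k) j)" for i j
    by (simp only: mult.assoc [symmetric, of "of_nat i"] dser_recursion sum_distrib_right)
  moreover have "of_nat j * (dser \<gamma> i * bop \<gamma> ?c j F w) = (\<Sum>k=1..j. ?G k i (j - k))" for i j
    by (simp only: mult.left_commute [of "of_nat j"] bop_recursion [OF F L'] sum_distrib_left)
  ultimately have "of_nat n * gop \<gamma> ?c n F w = (\<Sum>k=1..n. \<Sum>i\<le>n-k. ?F k i (n - k - i) + ?G k i (n - k - i))"
    unfolding gop_def by (rule cauchy_recursion)
  also have "\<dots> = (\<Sum>k=1..n. nsg A \<delta> \<gamma> (k - 1) (gop \<gamma> ?c (n - k) F) w)"
  proof (rule sum.cong [OF refl])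
    fix k assume k: "k \<in> {1..n}"
    have e: "m + (k - 1) + 1 = m + k" for m using k by simp
    have "nsg A \<delta> \<gamma> (k - 1) (gop \<gamma> ?c (n - k) F) w = cre \<gamma> (k - 1) * gop \<gamma> ?c (n - k) F w +
        (\<Sum>m<L. zinv (int (m + (k - 1) + 1)) * (cconst (ncoef (k - 1) m) * gop \<gamma> ?c (n - k) F (?i m w)))"
      by (rule nsg_eq [OF flin_gop [OF F] L])
    also have "\<dots> = cre \<gamma> (k - 1) * gop \<gamma> ?c (n - k) F w +
        (\<Sum>m<L. zinv (int (m + k)) * (cconst (ncoef (k - 1) m) * gop \<gamma> ?c (n - k) F (?i m w)))"
      by (simp only: e)
    also have "cre \<gamma> (k - 1) * gop \<gamma> ?c (n - k) F w +
        (\<Sum>m<L. zinv (int (m + k)) * (cconst (ncoef (k - 1) m) * gop \<gamma> ?c (n - k) F (?i m w))) =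
        (\<Sum>i\<le>n-k. ?F k i (n - k - i) + ?G k i (n - k - i))"
      by (simp only: gop_def sum.distrib sum_distrib_left sum.swap [of _ "{..<L}"] mult_ac)
    finally show "(\<Sum>i\<le>n-k. ?F k i (n - k - i) + ?G k i (n - k - i)) = nsg A \<delta> \<gamma> (k - 1) (gop \<gamma> ?c (n - k) F) w" by simp
  qed
  finally show ?thesis .
qed

lemma gop_add: "gop \<gamma> c n (\<lambda>w. F w + G w) w = gop \<gamma> c n F w + gop \<gamma> c n G w"
  by (simp add: gop_def bop_def sum.distrib distrib_left)

lemma gop_mult: "gop \<gamma> c n (\<lambda>w. P * F w) w = P * gop \<gamma> c n F w"
  by (simp only: gop_def bop_def sum_distrib_left mult.left_commute [of P])

text \<open>The key identity for n = 0, where \<open>c\<close> enters only through binomial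
  coefficients over 0 and is arbitrary.\<close>

lemma vertex_op_charge_add: "vertex_op A (\<gamma> + \<alpha>) \<delta> u w = gop \<gamma> c 0 (vertex_op A \<alpha> \<delta> u) w"
proof (induction u arbitrary: w rule: fock_induct)
  case (const d)
  have "vertex_op A \<alpha> \<delta> (fconst d) = (\<lambda>w. cconst d * vexp A \<alpha> \<delta> w)" by (rule ext) (rule vertex_op_fconst)
  then show ?case by (simp only: vertex_op_fconst gop_mult gop_vexp)
next
  case (var i k p)
  have "vertex_op A \<alpha> \<delta> (fvar i k * p) = normal_step A \<delta> (i, k) (vertex_op A \<alpha> \<delta> p)"
    by (rule ext) (rule vertex_op_fvar_mult)
  moreover have "vertex_op A (\<gamma> + \<alpha>) \<delta> p = gop \<gamma> c 0 (vertex_op A \<alpha> \<delta> p)" by (rule ext) (rule var)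
  ultimately show ?case by (simp only: vertex_op_fvar_mult normal_step_gop [OF flin_vertex_op])
next
  case (add p q)
  have "vertex_op A \<alpha> \<delta> (p + q) = (\<lambda>w. vertex_op A \<alpha> \<delta> p w + vertex_op A \<alpha> \<delta> q w)"
    by (rule ext) (rule vertex_op_add)
  then show ?case by (simp only: vertex_op_add add gop_add)
qed

text \<open>This is the key identity. Both sides obey the same recursion in \<open>n\<close>: the
  left one by Newton's identity and \<open>vertex_op_gen_mult\<close>, the right one by
  \<open>gop_recursion\<close>.\<close>

lemma vertex_op_hsym_mult:
  "vertex_op A (\<gamma> + \<alpha>) \<delta> (hsym \<gamma> n * u) w = gop \<gamma> (bform A \<gamma> \<delta>) n (vertex_op A \<alpha> \<delta> u) w"
proof (induction n arbitrary: w rule: less_induct)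
  case (less n)
  show ?case
  proof (cases "n = 0")
    case True
    then show ?thesis by (simp add: vertex_op_charge_add)
  next
    case False
    have "of_nat n * vertex_op A (\<gamma> + \<alpha>) \<delta> (hsym \<gamma> n * u) w = vertex_op A (\<gamma> + \<alpha>) \<delta> (of_nat n * hsym \<gamma> n * u) w"
      by (simp only: fconst_of_nat [symmetric] of_nat_conv_cconst vertex_op_fconst_mult mult.assoc)
    also have "\<dots> = (\<Sum>k=1..n. vertex_op A (\<gamma> + \<alpha>) \<delta> (gen \<gamma> k * (hsym \<gamma> (n - k) * u)) w)"
      by (simp only: hsym_recursion sum_distrib_right vertex_op_sum mult.assoc)
    also have "\<dots> = (\<Sum>k=1..n. nsg A \<delta> \<gamma> (k - 1) (gop \<gamma> (bform A \<gamma> \<delta>) (n - k) (vertex_op A \<alpha> \<delta> u)) w)"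
    proof (rule sum.cong [OF refl])
      fix k assume k: "k \<in> {1..n}"
      then have "vertex_op A (\<gamma> + \<alpha>) \<delta> (hsym \<gamma> (n - k) * u) = gop \<gamma> (bform A \<gamma> \<delta>) (n - k) (vertex_op A \<alpha> \<delta> u)"
        using less False by (intro ext) auto
      moreover have "k = Suc (k - 1)" using k by simp
      ultimately show "vertex_op A (\<gamma> + \<alpha>) \<delta> (gen \<gamma> k * (hsym \<gamma> (n - k) * u)) w =
          nsg A \<delta> \<gamma> (k - 1) (gop \<gamma> (bform A \<gamma> \<delta>) (n - k) (vertex_op A \<alpha> \<delta> u)) w"
        using vertex_op_gen_mult [of A "\<gamma> + \<alpha>" \<delta> \<gamma> "k - 1" "hsym \<gamma> (n - k) * u" w] by simp
    qed
    also have "\<dots> = of_nat n * gop \<gamma> (bform A \<gamma> \<delta>) n (vertex_op A \<alpha> \<delta> u) w"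
      by (rule gop_recursion [OF flin_vertex_op, symmetric])
    finally show ?thesis using of_nat_fls_cancel False by blast
  qed
qed

end

section \<open>Spans of complete symmetric monomials\<close>

interpretation fock_space: vector_space "\<lambda>c (p :: 'l fock). fconst c * p"
  by standard (simp_all add: distrib_left fconst_add fconst_mult distrib_right mult.assoc)

declare fock_space.scale_scale [simp del]

definition mon :: "('i \<Rightarrow> complex ^ 'l::finite) \<Rightarrow> ('i \<times> nat) multiset \<Rightarrow> 'l fock" where
  "mon g \<nu> = (\<Prod>(j, n)\<in>#\<nu>. hsym (g j) n)"

text \<open>A pair \<open>(j, 0)\<close> contributes the factor 1 to \<open>mon\<close> but still
  \<open>g j\<close> to the charge, so one polynomial can occur at several charges.\<close>

definition chg :: "('i \<Rightarrow> complex ^ 'l::finite) \<Rightarrow> ('i \<times> nat) multiset \<Rightarrow> complex ^ 'l" where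
  "chg g \<nu> = (\<Sum>(j, n)\<in>#\<nu>. g j)"

definition wt :: "('i \<times> nat) multiset \<Rightarrow> nat" where
  "wt \<nu> = (\<Sum>(j, n)\<in>#\<nu>. n)"

lemma mon_simps [simp]: "mon g {#} = 1" "mon g (add_mset (j, n) \<nu>) = hsym (g j) n * mon g \<nu>"
  and chg_simps [simp]: "chg g {#} = 0" "chg g (add_mset (j, n) \<nu>) = g j + chg g \<nu>"
  and wt_simps [simp]: "wt {#} = 0" "wt (add_mset (j, n) \<nu>) = n + wt \<nu>"
  by (simp_all add: mon_def chg_def wt_def)

definition mspan :: "('i \<Rightarrow> complex ^ 'l::finite) \<Rightarrow> complex ^ 'l \<Rightarrow> 'l fock set" where
  "mspan g \<beta> = fock_space.span {mon g \<nu> | \<nu>. chg g \<nu> = \<beta>}"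

lemma mon_in_mspan: "mon g \<nu> \<in> mspan g (chg g \<nu>)"
  unfolding mspan_def by (rule fock_space.span_base) blast

lemma subspace_mspan: "fock_space.subspace (mspan g \<beta>)"
  unfolding mspan_def by (rule fock_space.subspace_span)

lemma span_mult_left:
  assumes "x \<in> fock_space.span S" "\<And>s. s \<in> S \<Longrightarrow> y * s \<in> fock_space.span S'"
  shows "y * x \<in> fock_space.span S'"
  using assms(1)
proof (induction rule: fock_space.span_induct_alt)
  case base
  show ?case by (simp add: fock_space.span_zero)
next
  case (step c s x)
  then show ?case using assms(2)
    by (simp add: distrib_left mult.left_commute [of y] fock_space.span_add fock_space.span_scale)
qed

lemma hsym_mult_mspan:
  assumes "x \<in> mspan g \<beta>"
  shows "hsym (g j) n * x \<in> mspan g (g j + \<beta>)"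
  using assms unfolding mspan_def
proof (rule span_mult_left)
  fix s assume "s \<in> {mon g \<nu> | \<nu>. chg g \<nu> = \<beta>}"
  then obtain \<nu> where "s = mon g \<nu>" "chg g \<nu> = \<beta>" by blast
  then show "hsym (g j) n * s \<in> fock_space.span {mon g \<nu> | \<nu>. chg g \<nu> = g j + \<beta>}"
    using mon_in_mspan [of g "add_mset (j, n) \<nu>"] by (simp add: mspan_def)
qed

definition vanishes_below :: "'a::zero fls \<Rightarrow> int \<Rightarrow> bool" where
  "vanishes_below f a \<longleftrightarrow> (\<forall>k<a. fls_nth f k = 0)"

lemma fls_nth_mult_in_subspace:
  fixes f g :: "'l fock fls"
  assumes "fock_space.subspace S" "\<And>i j. fls_nth f i * fls_nth g j \<in> S"
  shows "fls_nth (f * g) k \<in> S"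
  unfolding fls_times_nth(1) by (rule fock_space.subspace_sum) (use assms in auto)

lemma fls_nth_mult_lead:
  fixes f g :: "'a::comm_ring_1 fls"
  assumes "vanishes_below f a" "vanishes_below g b"
  shows "vanishes_below (f * g) (a + b)" "fls_nth (f * g) (a + b) = fls_nth f a * fls_nth g b"
proof -
  let ?F = "Abs_fps (\<lambda>n. fls_nth f (int n + a))" and ?G = "Abs_fps (\<lambda>n. fls_nth g (int n + b))"
  have f: "f = fls_shift (- a) (fps_to_fls ?F)" and g: "g = fls_shift (- b) (fps_to_fls ?G)"
    using assms by (auto intro!: fls_eqI simp: vanishes_below_def)
  have fg: "f * g = fls_shift (- a - b) (fps_to_fls (?F * ?G))"
    by (subst f, subst g) (simp add: fls_times_both_shifted_simp fls_times_fps_to_fls)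
  show "vanishes_below (f * g) (a + b)" "fls_nth (f * g) (a + b) = fls_nth f a * fls_nth g b"
    unfolding fg by (simp_all add: vanishes_below_def fps_mult_nth_0)
qed

lemma vanishes_below_sum:
  fixes f :: "'b \<Rightarrow> 'a::comm_ring_1 fls"
  shows "(\<And>i. i \<in> S \<Longrightarrow> vanishes_below (f i) a) \<Longrightarrow> vanishes_below (sum f S) a"
  by (simp add: vanishes_below_def fls_nth_sum)

lemma vanishes_below_dser: "vanishes_below (dser \<gamma> i) 0"
  and dser_nth_0: "fls_nth (dser \<gamma> i) 0 = hsym \<gamma> i"
  by (simp_all add: vanishes_below_def dser_def)

lemma dser_nth: "\<exists>c n. fls_nth (dser \<gamma> i) k = fconst c * hsym \<gamma> n"
proof (cases "k < 0")
  case True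
  then show ?thesis by (intro exI [of _ 0]) (simp add: dser_def)
next
  case False
  then show ?thesis
    by (intro exI [of _ "of_nat ((i + nat k) choose i)"] exI [of _ "i + nat k"]) (simp add: dser_def fconst_of_nat)
qed

lemma zinv_nth: "fls_nth (zinv m * f) k = fls_nth f (k + m)"
  by (simp flip: fls_shift_conv_zinv)

section \<open>Closure and regularity of products of complete symmetric monomials\<close>

context
  fixes A :: "'l::finite \<Rightarrow> 'l \<Rightarrow> complex"
begin

lemma tcoef_one: "q > 0 \<Longrightarrow> tcoef A \<gamma> q 1 = 0"
  using tcoef_fconst [of q A \<gamma> 1] by simp

lemma vertex_op_one: "vertex_op A \<alpha> \<beta> 1 w = vexp A \<alpha> \<beta> w"
  using vertex_op_fconst [of A \<alpha> \<beta> 1 w] by simp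

text \<open>By multiplicativity and \<open>tcoef_hsym\<close>, each factor is replaced by a multiple
  of one with the same \<open>g j\<close> and smaller index. The exact drop of the weight drives the
  induction in \<open>mon_in_generated\<close>.\<close>

lemma tcoef_mon:
  "tcoef A \<gamma> q (mon g \<nu>) \<in>
    fock_space.span {mon g \<nu>' | \<nu>'. chg g \<nu>' = chg g \<nu> \<and> size \<nu>' = size \<nu> \<and> wt \<nu>' + q = wt \<nu>}"
    (is "_ \<in> fock_space.span (?S \<nu> q)")
proof (induction \<nu> arbitrary: q)
  case empty
  show ?case
  proof (cases "q = 0")
    case True
    have "(1 :: 'l fock) \<in> ?S {#} 0" by (auto intro!: exI [of _ "{#}"])
    then show ?thesis using True by (simp add: fock_space.span_base)
  next
    case False
    then show ?thesis by (simp add: tcoef_one fock_space.span_zero)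
  qed
next
  case (add x \<nu>)
  obtain j n where x: "x = (j, n)" by (metis surj_pair)
  show ?case
    unfolding x mon_simps tcoef_mult
  proof (rule fock_space.span_sum)
    fix i assume i: "i \<in> {..q}"
    show "tcoef A \<gamma> i (hsym (g j) n) * tcoef A \<gamma> (q - i) (mon g \<nu>) \<in> fock_space.span (?S (add_mset (j, n) \<nu>) q)"
    proof (cases "i \<le> n")
      case True
      have "hsym (g j) (n - i) * tcoef A \<gamma> (q - i) (mon g \<nu>) \<in> fock_space.span (?S (add_mset (j, n) \<nu>) q)"
      proof (rule span_mult_left [OF add])
        fix s assume "s \<in> ?S \<nu> (q - i)"
        then obtain \<nu>' where "s = mon g \<nu>'" "chg g \<nu>' = chg g \<nu>" "size \<nu>' = size \<nu>" "wt \<nu>' + (q - i) = wt \<nu>" by blast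
        then have "hsym (g j) (n - i) * s \<in> ?S (add_mset (j, n) \<nu>) q"
          using i True by (intro CollectI exI [of _ "add_mset (j, n - i) \<nu>'"]) auto
        then show "hsym (g j) (n - i) * s \<in> fock_space.span (?S (add_mset (j, n) \<nu>) q)"
          by (rule fock_space.span_base)
      qed
      then show ?thesis
        using True by (simp add: tcoef_hsym mult.assoc fock_space.span_scale)
    qed (simp add: tcoef_hsym fock_space.span_zero)
  qed
qed

lemma tcoef_mspan:
  assumes "w \<in> mspan g \<delta>"
  shows "tcoef A \<gamma> q w \<in> mspan g \<delta>"
  using assms unfolding mspan_def
proof (induction rule: fock_space.span_induct_alt)
  case base
  show ?case by (simp add: fock_space.span_zero)
next
  case (step c s x)
  then obtain \<nu> where \<nu>: "s = mon g \<nu>" "chg g \<nu> = \<delta>" by blast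
  have "tcoef A \<gamma> q s \<in> fock_space.span {mon g \<nu> | \<nu>. chg g \<nu> = \<delta>}"
    unfolding \<nu>(1) by (rule subsetD [OF fock_space.span_mono tcoef_mon]) (use \<nu>(2) in blast)
  with step show ?case by (simp add: tcoef_add tcoef_fconst_mult fock_space.span_add fock_space.span_scale)
qed

lemma vexp_0: "vexp A 0 \<beta> w = fls_const w"
proof -
  have z: "tcoef A 0 q w = 0" if "q \<ge> 1" for q
    using that
  proof (induction q rule: less_induct)
    case (less q)
    have "annih A 0 0 n p = 0" for n and p :: "'l fock"
      by (cases n) (simp_all add: annih_0 annih_Suc)
    then have "of_nat q * tcoef A 0 q w = of_nat q * 0" by (simp add: tcoef_recursion)
    then show ?case using of_nat_fock_cancel less by (metis not_one_le_zero)
  qed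
  have "Abs_fps (hsym 0) = (1 :: 'l fock fps)"
    by (rule fps_ext) (simp add: hsym_zero)
  moreover have "(\<Sum>q<1. zinv (int q) * fls_const (tcoef A 0 q w)) = zinv 0 * fls_const w"
    unfolding One_nat_def sum.lessThan_Suc by simp
  ultimately show ?thesis using vexp_eq [OF z, where \<beta> = \<beta>] by (simp only: fps_one_to_fls mult_1 fls_shift_0)
qed

lemma vexp_nth:
  assumes "\<And>q. q \<ge> N \<Longrightarrow> tcoef A \<alpha> q w = 0"
  shows "fls_nth (vexp A \<alpha> \<beta> w) (int n) = (\<Sum>q<N. hsym \<alpha> (n + q) * tcoef A \<alpha> q w)"
proof -
  have "fls_nth (E * (zinv (int q) * fls_const p)) k = p * fls_nth E (k + int q)" for E :: "'l fock fls" and q p k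
    unfolding mult.commute [of E] mult.assoc zinv_nth by simp
  moreover have "vexp A \<alpha> \<beta> w = fps_to_fls (Abs_fps (hsym \<alpha>)) * (\<Sum>q<N. zinv (int q) * fls_const (tcoef A \<alpha> q w))"
    by (rule vexp_eq [OF assms])
  ultimately show ?thesis
    by (simp add: sum_distrib_left fls_nth_sum nat_add_distrib mult.commute [of "hsym _ _"])
qed

text \<open>The key identity splits off one factor: \<tau> preserves
  \<open>mspan g \<delta>\<close>, and every coefficient of \<open>dser\<close> is a multiple of
  some \<open>hsym (g j) m\<close>, which supplies the missing charge \<open>g j\<close>.\<close>

lemma vertex_op_mon_closed:
  assumes "w \<in> mspan g \<delta>"
  shows "fls_nth (vertex_op A (chg g \<nu>) \<delta> (mon g \<nu>) w) k \<in> mspan g (chg g \<nu> + \<delta>)"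
  using assms
proof (induction \<nu> arbitrary: w k)
  case empty
  show ?case using empty fock_space.subspace_0 [OF subspace_mspan [of g \<delta>]]
    by (simp add: vertex_op_one vexp_0)
next
  case (add x \<nu>)
  obtain j n where x: "x = (j, n)" by (metis surj_pair)
  let ?F = "vertex_op A (chg g \<nu>) \<delta> (mon g \<nu>)" and ?c = "bform A (g j) \<delta>"
  have bop: "fls_nth (bop A (g j) ?c i ?F w) l \<in> mspan g (chg g \<nu> + \<delta>)" for i l
    unfolding bop_def fls_nth_sum
    by (rule fock_space.subspace_sum [OF subspace_mspan])
       (simp add: zinv_nth fock_space.subspace_scale [OF subspace_mspan] add.IH tcoef_mspan add.prems)
  show ?case
    unfolding x mon_simps chg_simps vertex_op_hsym_mult gop_def fls_nth_sum
  proof (rule fock_space.subspace_sum [OF subspace_mspan], rule fls_nth_mult_in_subspace [OF subspace_mspan])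
    fix i a b
    obtain c m where "fls_nth (dser (g j) i) a = fconst c * hsym (g j) m" using dser_nth by blast
    then show "fls_nth (dser (g j) i) a * fls_nth (bop A (g j) ?c (n - i) ?F w) b \<in> mspan g (g j + chg g \<nu> + \<delta>)"
      using hsym_mult_mspan [OF bop]
      by (simp add: mult.assoc add.assoc fock_space.subspace_scale [OF subspace_mspan])
  qed
qed

lemma vertex_op_mspan:
  assumes "u \<in> mspan g \<alpha>" "\<And>\<nu>. chg g \<nu> = \<alpha> \<Longrightarrow> fls_nth (vertex_op A \<alpha> \<delta> (mon g \<nu>) w) k \<in> S"
    "fock_space.subspace S"
  shows "fls_nth (vertex_op A \<alpha> \<delta> u w) k \<in> S"
  using assms(1) unfolding mspan_def
proof (induction rule: fock_space.span_induct_alt)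
  case base
  show ?case using vertex_op_fconst_mult [of A \<alpha> \<delta> 0 0 w] fock_space.subspace_0 [OF assms(3)] by simp
next
  case (step c s x)
  then show ?case
    using assms(2) fock_space.subspace_add [OF assms(3)] fock_space.subspace_scale [OF assms(3)]
    by (auto simp: vertex_op_add vertex_op_fconst_mult)
qed

text \<open>For natural pairings each factor contributes the polynomial (1 - x/z)^d of degree d in
  z^(-1), and the degrees add up.\<close>

lemma tcoef_mon_zero:
  assumes "\<And>j. bform A \<gamma> (g j) = of_nat (d j)" "q > (\<Sum>(j, n)\<in>#\<nu>. d j)"
  shows "tcoef A \<gamma> q (mon g \<nu>) = 0"
  using assms(2)
proof (induction \<nu> arbitrary: q)
  case empty
  show ?case using empty by (simp add: tcoef_one)
next
  case (add x \<nu>)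
  obtain j n where x: "x = (j, n)" by (metis surj_pair)
  show ?case
    unfolding x mon_simps tcoef_mult
  proof (rule sum.neutral, rule ballI)
    fix i assume "i \<in> {..q}"
    then consider "i > d j" | "q - i > (\<Sum>(j, n)\<in>#\<nu>. d j)" using add.prems x by force
    then show "tcoef A \<gamma> i (hsym (g j) n) * tcoef A \<gamma> (q - i) (mon g \<nu>) = 0"
    proof cases
      case 1
      then have "(of_nat (d j) :: complex) gchoose i = 0"
        by (simp add: binomial_gbinomial [symmetric] binomial_eq_0)
      then show ?thesis by (simp add: tcoef_hsym assms(1))
    qed (simp add: add.IH)
  qed
qed

lemma bform_chg:
  assumes "\<And>j. bform A \<gamma> (g j) = of_nat (d j)"
  shows "bform A \<gamma> (chg g \<nu>) = of_nat (\<Sum>(j, n)\<in>#\<nu>. d j)"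
  by (induction \<nu>) (auto simp: bform_add_right assms)

lemma tcoef_mspan_zero:
  assumes "\<And>j. bform A \<gamma> (g j) = of_nat (d j)" "w \<in> mspan g \<delta>" "bform A \<gamma> \<delta> = of_nat c" "q > c"
  shows "tcoef A \<gamma> q w = 0"
  using assms(2) unfolding mspan_def
proof (induction rule: fock_space.span_induct_alt)
  case (step a s x)
  then obtain \<nu> where \<nu>: "s = mon g \<nu>" "chg g \<nu> = \<delta>" by blast
  then have "c = (\<Sum>(j, n)\<in>#\<nu>. d j)"
    using bform_chg [where g = g and d = d and \<nu> = \<nu>, OF assms(1)] assms(3) by (metis of_nat_eq_iff)
  then have "tcoef A \<gamma> q s = 0" using tcoef_mon_zero [where g = g and d = d, OF assms(1)] assms(4) \<nu> by blast
  then show ?case using step by (simp add: tcoef_add tcoef_fconst_mult)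
qed simp

text \<open>Here (z + t)^c \<tau>(z + t) w is a polynomial in z + t, so each factor costs at most
  z^(-c). The total is exactly the power of z that \<open>vertex_op\<close> omits, hence the
  products have no pole.\<close>

lemma vertex_op_mon_regular:
  assumes d: "\<And>i j. bform A (g i) (h j) = of_nat (d i j)"
    and c: "\<And>i. bform A (g i) \<delta> = of_nat (c i)"
    and "w \<in> mspan h \<delta>"
  shows "vanishes_below (vertex_op A (chg g \<nu>) \<delta> (mon g \<nu>) w) (- int (\<Sum>(i, n)\<in>#\<nu>. c i))"
  using assms(3)
proof (induction \<nu> arbitrary: w)
  case empty
  show ?case by (simp add: vertex_op_one vexp_0 vanishes_below_def)
next
  case (add x \<nu>)
  obtain j n where x: "x = (j, n)" by (metis surj_pair)
  let ?F = "vertex_op A (chg g \<nu>) \<delta> (mon g \<nu>)" and ?M = "int (\<Sum>(i, n)\<in>#\<nu>. c i)"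
  have bop: "vanishes_below (bop A (g j) (of_nat (c j)) r ?F w) (- ?M - int (c j))" for r
    unfolding bop_def
  proof (rule vanishes_below_sum)
    fix q assume "q \<in> {q. tcoef A (g j) q w \<noteq> 0}"
    then have q: "q \<le> c j" using tcoef_mspan_zero [where g = h and d = "d j", OF d add.prems c] not_le by blast
    show "vanishes_below (zinv (int (q + r)) * (cconst ((of_nat (c j) - of_nat q) gchoose r) * ?F (tcoef A (g j) q w))) (- ?M - int (c j))"
    proof (cases "q + r \<le> c j")
      case True
      have "vanishes_below (?F (tcoef A (g j) q w)) (- ?M)"
        by (rule add.IH [OF tcoef_mspan [OF add.prems]])
      then show ?thesis using True by (simp add: vanishes_below_def zinv_nth)
    next
      case False
      have "(of_nat (c j) - of_nat q :: complex) gchoose r = of_nat ((c j - q) choose r)"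
        using q by (simp add: binomial_gbinomial of_nat_diff)
      also have "(c j - q) choose r = 0" using False q by (simp add: binomial_eq_0)
      finally show ?thesis by (simp add: vanishes_below_def)
    qed
  qed
  have "vanishes_below (dser (g j) i * bop A (g j) (of_nat (c j)) (n - i) ?F w) (- ?M - int (c j))" for i
    using fls_nth_mult_lead(1) [OF vanishes_below_dser bop] by simp
  moreover have e: "- int (\<Sum>(i, n)\<in>#add_mset (j, n) \<nu>. c i) = - ?M - int (c j)" by simp
  ultimately show ?case
    unfolding x mon_simps chg_simps vertex_op_hsym_mult gop_def c e
    by (intro vanishes_below_sum)
qed

end

section \<open>Subalgebras of the lattice vertex algebra\<close>

lemma lookup_vscale: "Poly_Mapping.lookup (vscale c v) \<beta> = fconst c * Poly_Mapping.lookup v \<beta>"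
  by (simp add: vscale_def map.rep_eq when_def)

lemma module_vscale: "module (vscale :: complex \<Rightarrow> 'l::finite lattice_space \<Rightarrow> _)"
proof
  fix a b :: complex and x y :: "'l lattice_space"
  show "vscale a (x + y) = vscale a x + vscale a y"
    by (rule poly_mapping_eqI) (simp add: lookup_vscale lookup_add distrib_left)
  show "vscale (a + b) x = vscale a x + vscale b x"
    by (rule poly_mapping_eqI) (simp only: lookup_vscale lookup_add fconst_add distrib_right)
  show "vscale a (vscale b x) = vscale (a * b) x"
    by (rule poly_mapping_eqI) (simp add: lookup_vscale fconst_mult mult.assoc)
  show "vscale 1 x = x"
    by (rule poly_mapping_eqI) (simp add: lookup_vscale)
qed
interpretation lattice_module: module vscale by (rule module_vscale)

definition lattice_mspan :: "('i \<Rightarrow> complex ^ 'l::finite) \<Rightarrow> (complex ^ 'l) set \<Rightarrow> 'l lattice_space set" where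
  "lattice_mspan g L = {v \<in> lattice_va L. \<forall>\<beta>. Poly_Mapping.lookup v \<beta> \<in> mspan g \<beta>}"

lemma subspace_lattice_mspan: "lattice_module.subspace (lattice_mspan g L)"
  unfolding lattice_module.subspace_def lattice_mspan_def lattice_va_def
proof (intro conjI ballI allI)
  fix x y assume "x \<in> {v \<in> {v. Poly_Mapping.keys v \<subseteq> L}. \<forall>\<beta>. Poly_Mapping.lookup v \<beta> \<in> mspan g \<beta>}"
    "y \<in> {v \<in> {v. Poly_Mapping.keys v \<subseteq> L}. \<forall>\<beta>. Poly_Mapping.lookup v \<beta> \<in> mspan g \<beta>}"
  then show "x + y \<in> {v \<in> {v. Poly_Mapping.keys v \<subseteq> L}. \<forall>\<beta>. Poly_Mapping.lookup v \<beta> \<in> mspan g \<beta>}"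
    using keys_add [of x y] by (auto simp: lookup_add intro: fock_space.subspace_add [OF subspace_mspan])
next
  fix c x assume "x \<in> {v \<in> {v. Poly_Mapping.keys v \<subseteq> L}. \<forall>\<beta>. Poly_Mapping.lookup v \<beta> \<in> mspan g \<beta>}"
  then show "vscale c x \<in> {v \<in> {v. Poly_Mapping.keys v \<subseteq> L}. \<forall>\<beta>. Poly_Mapping.lookup v \<beta> \<in> mspan g \<beta>}"
    by (auto simp: lookup_vscale in_keys_iff intro: fock_space.subspace_scale [OF subspace_mspan])
qed (simp add: fock_space.subspace_0 [OF subspace_mspan])

lemma single_in_lattice_mspan:
  assumes "p \<in> mspan g \<beta>" "\<beta> \<in> L"
  shows "Poly_Mapping.single \<beta> p \<in> lattice_mspan g L"
  using assms fock_space.subspace_0 [OF subspace_mspan]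
  by (auto simp: lattice_mspan_def lattice_va_def lookup_single when_def)

lemma vmode_in_lattice_mspan:
  assumes "a \<in> lattice_mspan g L" "b \<in> lattice_mspan g L" "\<And>\<alpha> \<beta>. \<alpha> \<in> L \<Longrightarrow> \<beta> \<in> L \<Longrightarrow> \<alpha> + \<beta> \<in> L"
  shows "vmode A \<epsilon> a n b \<in> lattice_mspan g L"
  unfolding vmode_def
proof (intro lattice_module.subspace_sum [OF subspace_lattice_mspan] single_in_lattice_mspan)
  fix \<alpha> \<beta> assume \<alpha>: "\<alpha> \<in> Poly_Mapping.keys a" and \<beta>: "\<beta> \<in> Poly_Mapping.keys b"
  have a: "Poly_Mapping.lookup a \<alpha> \<in> mspan g \<alpha>" and b: "Poly_Mapping.lookup b \<beta> \<in> mspan g \<beta>"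
    using assms by (auto simp: lattice_mspan_def)
  have "\<alpha> \<in> L" "\<beta> \<in> L" using \<alpha> \<beta> assms(1,2) by (auto simp: lattice_mspan_def lattice_va_def)
  then show "\<alpha> + \<beta> \<in> L" by (rule assms(3))
  have "fls_nth (vertex_op A \<alpha> \<beta> (Poly_Mapping.lookup a \<alpha>) (Poly_Mapping.lookup b \<beta>)) k \<in> mspan g (\<alpha> + \<beta>)" for k
    by (rule vertex_op_mspan [OF a _ subspace_mspan]) (use vertex_op_mon_closed [OF b] in blast)
  then show "fconst (\<epsilon> \<alpha> \<beta>) * (\<Sum>k::int | bform A \<alpha> \<beta> + of_int k = - n - 1.
      fls_nth (vertex_op A \<alpha> \<beta> (Poly_Mapping.lookup a \<alpha>) (Poly_Mapping.lookup b \<beta>)) k) \<in> mspan g (\<alpha> + \<beta>)"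
    by (intro fock_space.subspace_scale [OF subspace_mspan] fock_space.subspace_sum [OF subspace_mspan])
qed

lemma generated_subset_lattice_mspan:
  assumes "0 \<in> L" "\<And>\<alpha> \<beta>. \<alpha> \<in> L \<Longrightarrow> \<beta> \<in> L \<Longrightarrow> \<alpha> + \<beta> \<in> L" "range g \<subseteq> L"
  shows "generated_subalgebra A \<epsilon> (lattice_va L) (range (\<lambda>i. vexpo (g i))) \<subseteq> lattice_mspan g L"
proof -
  have vac: "vac \<in> lattice_mspan g L"
    unfolding vac_def vexpo_def
    using single_in_lattice_mspan [OF mon_in_mspan [of g "{#}"]] assms(1) by simp
  \<comment> \<open>As \<open>hsym _ 0\<close> is 1, the generator is the monomial of the single
    pair \<open>(i, 0)\<close>.\<close>
  have gens: "vexpo (g i) \<in> lattice_mspan g L" for i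
    unfolding vexpo_def
    using single_in_lattice_mspan [OF mon_in_mspan [of g "{#(i, 0)#}"]] assms(3) by auto
  have "vertex_subalgebra A \<epsilon> (lattice_va L) (lattice_mspan g L)"
    unfolding vertex_subalgebra_def translation_def
  proof (intro conjI ballI allI)
    show "lattice_mspan g L \<subseteq> lattice_va L" by (auto simp: lattice_mspan_def)
    show "lattice_module.subspace (lattice_mspan g L)" by (rule subspace_lattice_mspan)
  qed (use vac assms(2) in \<open>auto intro: vmode_in_lattice_mspan\<close>)
  then show ?thesis using gens unfolding generated_subalgebra_def by blast
qed

lemma vmode_single:
  "vmode A \<epsilon> (Poly_Mapping.single \<alpha> u) n (Poly_Mapping.single \<beta> w) =
    Poly_Mapping.single (\<alpha> + \<beta>) (fconst (\<epsilon> \<alpha> \<beta>) *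
      (\<Sum>k::int | bform A \<alpha> \<beta> + of_int k = - n - 1. fls_nth (vertex_op A \<alpha> \<beta> u w) k))"
proof -
  have "vertex_op A \<alpha> \<beta> 0 w = 0" "vertex_op A \<alpha> \<beta> u 0 = 0"
    using vertex_op_fconst_mult [of A \<alpha> \<beta> 0 0 w] flin_0 [OF flin_vertex_op] by simp_all
  then show ?thesis by (cases "u = 0"; cases "w = 0") (simp_all add: vmode_def)
qed

text \<open>A mode of e^(g j) sends a monomial \<open>w\<close> to \<open>hsym (g j) n * w\<close>
  plus terms in which the monomial has smaller weight and \<open>n\<close> is larger. Hence the
  inner induction is on the weight, for all \<open>n\<close> at once.\<close>

lemma mon_in_generated:
  assumes U: "vertex_subalgebra A \<epsilon> V U" "\<And>i. vexpo (g i) \<in> U"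
    and \<epsilon>: "\<And>i \<nu>. \<epsilon> (g i) (chg g \<nu>) \<noteq> 0"
  shows "Poly_Mapping.single (chg g \<nu>) (mon g \<nu>) \<in> U"
proof (induction "size \<nu>" arbitrary: \<nu>)
  case 0
  then show ?case using U by (simp add: vertex_subalgebra_def vac_def vexpo_def)
next
  case (Suc r)
  have subU: "lattice_module.subspace U" using U by (simp add: vertex_subalgebra_def)
  have step: "Poly_Mapping.single (g j + chg g \<nu>) (hsym (g j) n * mon g \<nu>) \<in> U" if "size \<nu> = r" for \<nu> j n
    using that
  proof (induction "wt \<nu>" arbitrary: \<nu> n rule: less_induct)
    case less
    let ?\<delta> = "chg g \<nu>" and ?w = "mon g \<nu>"
    let ?X = "{p. Poly_Mapping.single (g j + ?\<delta>) p \<in> U}"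
    have X: "fock_space.subspace ?X"
      unfolding fock_space.subspace_def
    proof (intro conjI allI ballI)
      show "0 \<in> ?X" using lattice_module.subspace_0 [OF subU] by simp
      show "x + y \<in> ?X" if "x \<in> ?X" "y \<in> ?X" for x y
        using that lattice_module.subspace_add [OF subU] by (simp add: single_add)
      show "fconst c * x \<in> ?X" if "x \<in> ?X" for c x
      proof -
        have "vscale c (Poly_Mapping.single (g j + ?\<delta>) x) = Poly_Mapping.single (g j + ?\<delta>) (fconst c * x)"
          by (rule poly_mapping_eqI) (simp add: lookup_vscale lookup_single when_def)
        then show ?thesis using that lattice_module.subspace_scale [OF subU, of "Poly_Mapping.single (g j + ?\<delta>) x" c] by simp
      qed
    qed
    obtain N where N: "\<And>q. q \<ge> N \<Longrightarrow> tcoef A (g j) q ?w = 0" using tcoef_eventually_zero by blast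
    then have N': "\<And>q. q \<ge> Suc N \<Longrightarrow> tcoef A (g j) q ?w = 0" by simp
    let ?Y = "fls_nth (vertex_op A (g j) ?\<delta> 1 ?w) (int n)"
    have k: "{k::int. complex_of_int k = of_nat n} = {int n}"
      by (auto, metis of_int_eq_iff of_int_of_nat_eq)
    \<comment> \<open>The mode that picks the exponent (g j|\<delta>) + n of z, even when the
      pairing is not an integer.\<close>
    have "vmode A \<epsilon> (vexpo (g j)) (- 1 - (bform A (g j) ?\<delta> + of_int (int n))) (Poly_Mapping.single ?\<delta> ?w) \<in> U"
      using U less(2) Suc(1) by (simp add: vertex_subalgebra_def)
    then have "fconst (\<epsilon> (g j) ?\<delta>) * ?Y \<in> ?X"
      unfolding vexpo_def vmode_single using k by simp
    then have "fconst (1 / \<epsilon> (g j) ?\<delta>) * (fconst (\<epsilon> (g j) ?\<delta>) * ?Y) \<in> ?X"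
      by (rule fock_space.subspace_scale [OF X])
    then have Y: "?Y \<in> ?X" unfolding fconst_inverse_cancel(1) [OF \<epsilon>] .
    have "?Y = (\<Sum>q<Suc N. hsym (g j) (n + q) * tcoef A (g j) q ?w)"
      by (simp only: vertex_op_one vexp_nth [OF N'])
    then have "?Y = hsym (g j) n * ?w + (\<Sum>q<N. hsym (g j) (n + Suc q) * tcoef A (g j) (Suc q) ?w)"
      unfolding sum.lessThan_Suc_shift by simp
    moreover have "(\<Sum>q<N. hsym (g j) (n + Suc q) * tcoef A (g j) (Suc q) ?w) \<in> ?X"
    proof (rule fock_space.subspace_sum [OF X])
      fix q
      have "hsym (g j) (n + Suc q) * tcoef A (g j) (Suc q) ?w \<in> fock_space.span ?X"
      proof (rule span_mult_left [OF tcoef_mon])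
        fix s assume "s \<in> {mon g \<nu>' | \<nu>'. chg g \<nu>' = chg g \<nu> \<and> size \<nu>' = size \<nu> \<and> wt \<nu>' + Suc q = wt \<nu>}"
        then obtain \<nu>' where \<nu>': "s = mon g \<nu>'" "chg g \<nu>' = chg g \<nu>" "size \<nu>' = size \<nu>" "wt \<nu>' + Suc q = wt \<nu>" by blast
        then have "hsym (g j) (n + Suc q) * s \<in> ?X"
          using less(1) [of \<nu>' "n + Suc q"] less(2) by simp
        then show "hsym (g j) (n + Suc q) * s \<in> fock_space.span ?X" by (rule fock_space.span_base)
      qed
      then show "hsym (g j) (n + Suc q) * tcoef A (g j) (Suc q) ?w \<in> ?X"
        by (simp only: fock_space.span_eq_iff [THEN iffD2, OF X])
    qed
    ultimately have "hsym (g j) n * ?w \<in> ?X"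
      using fock_space.subspace_diff [OF X Y, of "\<Sum>q<N. hsym (g j) (n + Suc q) * tcoef A (g j) (Suc q) ?w"]
      by (simp only: add_diff_cancel_right')
    then show ?case by simp
  qed
  from Suc(2) obtain x \<nu>' where \<nu>: "\<nu> = add_mset x \<nu>'" by (cases \<nu>) auto
  moreover obtain j n where "x = (j, n)" by (metis surj_pair)
  ultimately show ?case using step [of \<nu>' j n] Suc(2) by simp
qed

section \<open>Complete symmetric polynomials as free generators\<close>

definition peval :: "('l \<times> nat \<Rightarrow> 'l fock) \<Rightarrow> 'l fock \<Rightarrow> 'l fock" where
  "peval f p = (\<Sum>\<mu>\<in>Poly_Mapping.keys p. fconst (Poly_Mapping.lookup p \<mu>) * (\<Prod>x\<in>#\<mu>. f x))"

lemma peval_single: "peval f (Poly_Mapping.single \<mu> c) = fconst c * (\<Prod>x\<in>#\<mu>. f x)"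
  by (cases "c = 0") (simp_all add: peval_def)

lemma peval_add: "peval f (p + q) = peval f p + peval f q"
  unfolding peval_def by (rule sum_keys_add) (simp_all add: fconst_add distrib_right)

lemma peval_fconst [simp]: "peval f (fconst c) = fconst c"
  using peval_single [of f "{#}" c] by (simp add: fconst_def)

lemma peval_fvar_mult: "peval f (fvar i k * p) = f (i, k) * peval f p"
proof (induction p rule: poly_mapping_induct)
  case (single \<mu> c)
  then show ?case by (simp add: single_add_mset [symmetric] peval_single mult.left_commute)
next
  case (sum p q)
  then show ?case by (simp add: distrib_left peval_add)
qed

lemma peval_fvar: "peval f (fvar i k) = f (i, k)"
  using peval_fvar_mult [of f i k "fconst 1"] peval_fconst [of f 1] by simp

lemma peval_fconst_mult: "peval f (fconst c * p) = fconst c * peval f p"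
proof (induction p rule: fock_induct)
  case (const d)
  then show ?case by (simp only: fconst_mult [symmetric] peval_fconst)
next
  case (var i k p)
  have "peval f (fconst c * (fvar i k * p)) = peval f (fvar i k * (fconst c * p))"
    by (simp only: mult.left_commute [of "fconst c"])
  also have "\<dots> = fconst c * peval f (fvar i k * p)"
    by (simp only: peval_fvar_mult var mult.left_commute [of "fconst c"])
  finally show ?case .
next
  case (add p q)
  then show ?case by (simp only: distrib_left peval_add)
qed

lemma peval_mult: "peval f (p * q) = peval f p * peval f q"
proof (induction p rule: fock_induct)
  case (const c)
  then show ?case by (simp add: peval_fconst_mult)
next
  case (var i k p)
  then show ?case by (simp only: mult.assoc peval_fvar_mult)
next
  case (add p q)
  then show ?case by (simp only: distrib_right peval_add)
qed

lemma peval_sum: "peval f (sum g S) = (\<Sum>x\<in>S. peval f (g x))"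
  using peval_fconst [of f 0] by (induction S rule: infinite_finite_induct) (simp_all add: peval_add)

lemma peval_one: "peval f 1 = 1"
  using peval_fconst [of f 1] by simp

lemma peval_of_nat: "peval f (of_nat n * p) = of_nat n * peval f p"
  using peval_fconst_mult [of f "of_nat n" p] by (simp add: fconst_of_nat)

text \<open>Newton's identities read backwards: the power sum expressed in terms of complete symmetric
  polynomials, for which the variables \<open>fvar j 0, fvar j 1, \<dots>\<close> stand.\<close>

definition hvar :: "'l \<Rightarrow> nat \<Rightarrow> 'l fock" where
  "hvar j n = (if n = 0 then 1 else fvar j (n - 1))"

fun newton :: "'l \<Rightarrow> nat \<Rightarrow> 'l fock" where
  "newton j n = of_nat n * hvar j n - (\<Sum>k=1..<n. newton j k * hvar j (n - k))"

declare newton.simps [simp del]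

lemma newton_sum: "(\<Sum>k=1..n. newton j k * hvar j (n - k)) = of_nat n * hvar j n"
proof (cases n)
  case (Suc m)
  have "(\<Sum>k=1..n. newton j k * hvar j (n - k)) = (\<Sum>k=1..<n. newton j k * hvar j (n - k)) + newton j n"
    using Suc by (simp add: hvar_def atLeastLessThanSuc_atLeastAtMost)
  then show ?thesis by (subst (asm) (2) newton.simps) simp
qed simp

context
  fixes A :: "'l::finite \<Rightarrow> 'l \<Rightarrow> complex" and fw :: "'l \<Rightarrow> complex ^ 'l"
  assumes dual: "\<And>i j. bform A (fw i) (sroot j) = (if i = j then 1 else 0)"
begin

lemma dual_left: "(\<Sum>k\<in>UNIV. vec_nth (fw i) k * A k j) = (if i = j then 1 else 0)"
  using dual [of i j] by (simp add: bform_sroot)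

text \<open>The coordinates of the fundamental weights form a left inverse of the square matrix
  \<open>A\<close>, hence also a right inverse.\<close>

lemma dual_right: "(\<Sum>k\<in>UNIV. A i k * vec_nth (fw k) j) = (if i = j then 1 else 0)"
proof -
  let ?F = "\<chi> i k. vec_nth (fw i) k" and ?A = "\<chi> i j. A i j"
  have "?F ** ?A = mat 1"
    by (simp add: matrix_matrix_mult_def mat_def vec_eq_iff dual_left)
  then have "?A ** ?F = mat 1" by (simp add: matrix_left_right_inverse)
  then show ?thesis by (simp add: matrix_matrix_mult_def mat_def vec_eq_iff)
qed

lemma fw_expand: "\<beta> = (\<Sum>j\<in>UNIV. bform A \<beta> (sroot j) *s fw j)"
proof -
  have "vec_nth (\<Sum>j\<in>UNIV. bform A \<beta> (sroot j) *s fw j) m = vec_nth \<beta> m" for m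
  proof -
    have "vec_nth (\<Sum>j\<in>UNIV. bform A \<beta> (sroot j) *s fw j) m =
        (\<Sum>j\<in>UNIV. \<Sum>i\<in>UNIV. vec_nth \<beta> i * (A i j * vec_nth (fw j) m))"
      by (simp add: bform_sroot sum_distrib_right mult.assoc)
    also have "\<dots> = (\<Sum>i\<in>UNIV. vec_nth \<beta> i * (if i = m then 1 else 0))"
      by (subst sum.swap) (simp only: sum_distrib_left [symmetric] dual_right)
    also have "\<dots> = (\<Sum>i\<in>UNIV. if i = m then vec_nth \<beta> i else 0)"
      by (rule sum.cong) auto
    finally show ?thesis by simp
  qed
  then show ?thesis by (simp add: vec_eq_iff)
qed

lemma fvar_conv_gen_fw: "fvar i k = (\<Sum>j\<in>UNIV. fconst (A i j) * gen (fw j) (Suc k))"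
proof -
  have "(\<Sum>j\<in>UNIV. fconst (A i j) * gen (fw j) (Suc k)) =
      (\<Sum>m\<in>UNIV. (\<Sum>j\<in>UNIV. fconst (A i j * vec_nth (fw j) m)) * fvar m k)"
    by (simp only: gen_def sum_distrib_left sum_distrib_right fconst_mult mult.assoc diff_Suc_1) (rule sum.swap)
  also have "\<dots> = (\<Sum>m\<in>UNIV. fconst (if i = m then 1 else 0) * fvar m k)"
    by (simp only: fconst_sum [symmetric] dual_right)
  also have "\<dots> = (\<Sum>m\<in>UNIV. if i = m then fvar m k else 0)"
    by (rule sum.cong) auto
  finally show ?thesis by simp
qed

section \<open>Change of generators between power sums and complete symmetric polynomials\<close>

definition from_h :: "'l fock \<Rightarrow> 'l fock" where
  "from_h = peval (\<lambda>(j, k). hsym (fw j) (Suc k))"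

definition to_h :: "'l fock \<Rightarrow> 'l fock" where
  "to_h = peval (\<lambda>(i, k). \<Sum>j\<in>UNIV. fconst (A i j) * newton j (Suc k))"

lemma from_h_fconst [simp]: "from_h (fconst c) = fconst c"
  by (simp add: from_h_def)

lemma from_h_add: "from_h (p + q) = from_h p + from_h q"
  and from_h_mult: "from_h (p * q) = from_h p * from_h q"
  and from_h_fconst_mult: "from_h (fconst c * p) = fconst c * from_h p"
  and from_h_of_nat: "from_h (of_nat n * p) = of_nat n * from_h p"
  and from_h_sum: "from_h (sum g S) = (\<Sum>x\<in>S. from_h (g x))"
  unfolding from_h_def by (rule peval_add peval_mult peval_fconst_mult peval_of_nat peval_sum)+

lemma to_h_gen: "to_h (gen (fw j) (Suc k)) = newton j (Suc k)"
proof -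
  have "to_h (gen (fw j) (Suc k)) = (\<Sum>i\<in>UNIV. \<Sum>m\<in>UNIV. fconst (vec_nth (fw j) i * A i m) * newton m (Suc k))"
    by (simp add: to_h_def gen_def peval_sum peval_fconst_mult peval_fvar sum_distrib_left fconst_mult mult.assoc)
  also have "\<dots> = (\<Sum>m\<in>UNIV. fconst (\<Sum>i\<in>UNIV. vec_nth (fw j) i * A i m) * newton m (Suc k))"
    by (subst sum.swap) (simp only: fconst_sum sum_distrib_right)
  also have "\<dots> = (\<Sum>m\<in>UNIV. if j = m then newton m (Suc k) else 0)"
    by (simp only: dual_left) (rule sum.cong, auto)
  finally show ?thesis by simp
qed

lemma to_h_hsym: "to_h (hsym (fw j) n) = hvar j n"
proof (induction n rule: less_induct)
  case (less n)
  show ?case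
  proof (cases "n = 0")
    case True
    then show ?thesis by (simp add: to_h_def hvar_def peval_one)
  next
    case False
    have "of_nat n * to_h (hsym (fw j) n) = to_h (\<Sum>k=1..n. gen (fw j) k * hsym (fw j) (n - k))"
      by (simp only: to_h_def peval_of_nat [symmetric] hsym_recursion)
    also have "\<dots> = (\<Sum>k=1..n. to_h (gen (fw j) k) * to_h (hsym (fw j) (n - k)))"
      by (simp only: to_h_def peval_sum peval_mult)
    also have "\<dots> = (\<Sum>k=1..n. newton j k * hvar j (n - k))"
    proof (rule sum.cong [OF refl])
      fix k assume "k \<in> {1..n}"
      then obtain k' where "k = Suc k'" "n - k < n" by (cases k) auto
      then show "to_h (gen (fw j) k) * to_h (hsym (fw j) (n - k)) = newton j k * hvar j (n - k)"
        using less to_h_gen by simp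
    qed
    also have "\<dots> = of_nat n * hvar j n" by (rule newton_sum)
    finally show ?thesis using of_nat_fock_cancel False by blast
  qed
qed

text \<open>A left inverse makes \<open>from_h\<close> injective: the \<open>hsym (fw j) n\<close>
  with \<open>n > 0\<close> are algebraically independent.\<close>

lemma to_h_from_h: "to_h (from_h p) = p"
proof (induction p rule: fock_induct)
  case (const c)
  then show ?case by (simp add: to_h_def from_h_def)
next
  case (var i k p)
  have "to_h (from_h (fvar i k * p)) = to_h (hsym (fw i) (Suc k)) * to_h (from_h p)"
    by (simp add: to_h_def from_h_def peval_fvar peval_mult)
  then show ?case by (simp add: to_h_hsym hvar_def var)
next
  case (add p q)
  then show ?case by (simp add: to_h_def from_h_def peval_add)
qed

text \<open>Newton's identity contains \<open>gen (fw j) n\<close> with coefficient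
  \<open>hsym (fw j) 0 = 1\<close>, so it can be solved for it recursively; inverting
  \<open>A\<close> then reaches the variables.\<close>

lemma from_h_surj: "\<exists>p. w = from_h p"
proof (induction w rule: fock_induct)
  case (const c)
  have "fconst c = from_h (fconst c)" by (simp add: from_h_def)
  then show ?case by blast
next
  case (var i k w)
  then obtain p where p: "w = from_h p" by blast
  have h: "\<exists>q. hsym (fw j) n = from_h q" for j n
  proof (cases n)
    case 0
    then have "hsym (fw j) n = from_h 1" by (simp add: from_h_def peval_one)
    then show ?thesis by blast
  next
    case (Suc m)
    then have "hsym (fw j) n = from_h (fvar j m)" by (simp add: from_h_def peval_fvar)
    then show ?thesis by blast
  qed
  then obtain hq where hq: "\<And>j n. hsym (fw j) n = from_h (hq j n)" by metis
  have "\<exists>q. gen (fw j) n = from_h q" if "n > 0" for j n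
    using that
  proof (induction n rule: less_induct)
    case (less n)
    then have "\<forall>k. \<exists>q. k \<in> {1..<n} \<longrightarrow> gen (fw j) k = from_h q" by auto
    then obtain gq where gq: "\<And>k. k \<in> {1..<n} \<Longrightarrow> gen (fw j) k = from_h (gq k)" by metis
    obtain m where m: "n = Suc m" using less.prems by (cases n) auto
    have "of_nat n * hsym (fw j) n = (\<Sum>k=1..<n. gen (fw j) k * hsym (fw j) (n - k)) + gen (fw j) n"
      unfolding hsym_recursion using m by (simp add: atLeastLessThanSuc_atLeastAtMost)
    then have "gen (fw j) n = of_nat n * hsym (fw j) n + fconst (- 1) * (\<Sum>k=1..<n. gen (fw j) k * hsym (fw j) (n - k))"
      by (simp only: fconst_minus fconst_1) simp
    also have "(\<Sum>k=1..<n. gen (fw j) k * hsym (fw j) (n - k)) = from_h (\<Sum>k=1..<n. gq k * hq j (n - k))"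
      unfolding from_h_sum from_h_mult by (rule sum.cong) (simp_all only: gq hq [symmetric])
    also have "of_nat n * hsym (fw j) n + fconst (- 1) * \<dots> =
        from_h (of_nat n * hq j n + fconst (- 1) * (\<Sum>k=1..<n. gq k * hq j (n - k)))"
      by (simp only: from_h_add from_h_fconst_mult from_h_of_nat hq [symmetric])
    finally show ?case by blast
  qed
  then have "\<forall>j. \<exists>q. gen (fw j) (Suc k) = from_h q" by blast
  then obtain g where g: "\<And>j. gen (fw j) (Suc k) = from_h (g j)" by metis
  have "fvar i k * w = from_h ((\<Sum>j\<in>UNIV. fconst (A i j) * g j) * p)"
    unfolding fvar_conv_gen_fw p by (simp only: from_h_mult from_h_sum from_h_fconst g [symmetric])
  then show ?case by blast
next
  case (add p q)
  then obtain p' q' where "p = from_h p'" "q = from_h q'" by blast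
  then have "p + q = from_h (p' + q')" by (simp add: from_h_def peval_add)
  then show ?case by blast
qed

text \<open>The shift by \<open>Suc\<close> excludes the factors \<open>hsym _ 0\<close>, which are
  1 and not free generators.\<close>

definition hmon :: "('l \<times> nat) multiset \<Rightarrow> 'l fock" where
  "hmon \<nu> = mon fw (image_mset (apsnd Suc) \<nu>)"

lemma from_h_eq: "from_h p = (\<Sum>\<nu>\<in>Poly_Mapping.keys p. fconst (Poly_Mapping.lookup p \<nu>) * hmon \<nu>)"
  by (simp add: from_h_def peval_def hmon_def mon_def image_mset.compositionality comp_def case_prod_unfold)

lemma from_h_single: "from_h (Poly_Mapping.single \<mu> c) = fconst c * hmon \<mu>"
  by (simp add: from_h_def peval_single hmon_def mon_def image_mset.compositionality comp_def case_prod_unfold)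

lemma from_h_0: "from_h 0 = 0"
  using from_h_fconst [of 0] by simp

section \<open>Leading terms\<close>

text \<open>Under \<open>Y(u, z) e\<^sup>\<alpha>\<^sup>i\<close> the generator \<open>hsym (fw i) (Suc k)\<close> of \<open>u\<close> contributes
  \<open>z\<^sup>-\<^sup>1 hsym (fw i) k\<close> to lowest order, and the others themselves.\<close>

definition num :: "'l \<Rightarrow> ('l \<times> nat) multiset \<Rightarrow> nat" where
  "num i \<nu> = size (filter_mset (\<lambda>x. fst x = i) \<nu>)"

definition lower :: "'l \<Rightarrow> 'l \<times> nat \<Rightarrow> 'l \<times> nat" where
  "lower i = (\<lambda>(j, k). (j, if j = i then k else Suc k))"

lemma num_simps [simp]: "num i {#} = 0" "num i (add_mset (j, k) \<nu>) = (if j = i then 1 else 0) + num i \<nu>"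
  by (simp_all add: num_def)

lemma tcoef_one_set: "{q. tcoef A \<gamma> q 1 \<noteq> 0} = {0}"
  using tcoef_one [of _ A \<gamma>] by (auto intro: ccontr)

text \<open>On 1 the operator \<tau> is trivial, so a factor from \<lambda>_j acts through (z + t)^c
  E(z + t) with c = 1 for \<open>j = i\<close> and c = 0 otherwise. The charge \<alpha> enters
  through E_\<alpha>(z), whose constant term is 1, and may stay arbitrary.\<close>

lemma vertex_op_hmon_lead:
  "vanishes_below (vertex_op A \<alpha> (sroot i) (hmon \<nu>) 1) (- int (num i \<nu>)) \<and>
   fls_nth (vertex_op A \<alpha> (sroot i) (hmon \<nu>) 1) (- int (num i \<nu>)) = mon fw (image_mset (lower i) \<nu>)"
proof (induction \<nu> arbitrary: \<alpha>)
  case empty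
  have T: "tcoef A \<alpha> q 1 = 0" if "q \<ge> Suc 0" for q using that by (simp add: tcoef_one)
  have "vexp A \<alpha> (sroot i) 1 = fps_to_fls (Abs_fps (hsym \<alpha>)) * (\<Sum>q<Suc 0. zinv (int q) * fls_const (tcoef A \<alpha> q 1))"
    by (rule vexp_eq) (rule T)
  then have "vexp A \<alpha> (sroot i) 1 = fps_to_fls (Abs_fps (hsym \<alpha>))" by simp
  then show ?case
    by (simp_all add: hmon_def vertex_op_one vanishes_below_def)
next
  case (add x \<nu>)
  obtain j k where x: "x = (j, k)" by (metis surj_pair)
  let ?c = "bform A (fw j) (sroot i)" and ?F = "vertex_op A (\<alpha> - fw j) (sroot i) (hmon \<nu>)"
  let ?d = "- int (num i \<nu>)"
  have bop: "bop A (fw j) ?c r ?F 1 = zinv (int r) * (cconst (?c gchoose r) * ?F 1)" for r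
    by (simp add: bop_def tcoef_one_set)
  have Y: "vertex_op A \<alpha> (sroot i) (hmon (add_mset x \<nu>)) 1 =
      (\<Sum>r\<le>Suc k. dser (fw j) r * (zinv (int (Suc k - r)) * (cconst (?c gchoose (Suc k - r)) * ?F 1)))"
    using vertex_op_hsym_mult [of A "fw j" "\<alpha> - fw j" "sroot i" "Suc k" "hmon \<nu>" 1]
    by (simp add: x hmon_def gop_def bop [unfolded hmon_def] del: sum.atMost_Suc)
  note IH = conjunct1 [OF add.IH [of "\<alpha> - fw j"]] conjunct2 [OF add.IH [of "\<alpha> - fw j"]]
  have top: "vanishes_below (dser (fw j) r * ?F 1) ?d"
    "fls_nth (dser (fw j) r * ?F 1) ?d = hsym (fw j) r * mon fw (image_mset (lower i) \<nu>)" for r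
    using fls_nth_mult_lead [OF vanishes_below_dser [of "fw j" r] IH(1)] IH(2) by (simp_all add: dser_nth_0)
  show ?case
  proof (cases "j = i")
    case True
    have c: "?c gchoose m = of_nat (1 choose m)" for m
      using True binomial_gbinomial [of 1 m, where 'a = complex] by (simp add: dual)
    have split: "(\<Sum>r\<le>Suc k. f r) = (\<Sum>r<k. f r) + (f k + f (Suc k))" for f :: "nat \<Rightarrow> 'l fock fls"
      by (simp add: lessThan_Suc_atMost [symmetric] add.assoc)
    have z: "(\<Sum>r<k. dser (fw j) r * (zinv (int (Suc k - r)) * (cconst (?c gchoose (Suc k - r)) * ?F 1))) = 0"
    proof (rule sum.neutral, rule ballI)
      fix r assume "r \<in> {..<k}"
      then have "1 choose (Suc k - r) = 0" by (intro binomial_eq_0) simp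
      then show "dser (fw j) r * (zinv (int (Suc k - r)) * (cconst (?c gchoose (Suc k - r)) * ?F 1)) = 0"
        by (simp only: c of_nat_0 fconst_0 fls_const_0 mult_zero_left mult_zero_right)
    qed
    \<comment> \<open>The factor z + t, divided by the omitted z, is 1 + t/z: the term t/z lowers
      the order by one and the index from \<open>Suc k\<close> to \<open>k\<close>.\<close>
    have "vertex_op A \<alpha> (sroot i) (hmon (add_mset x \<nu>)) 1 = dser (fw j) (Suc k) * ?F 1 + zinv 1 * (dser (fw j) k * ?F 1)"
      unfolding Y split z by (simp add: c True dual mult.left_commute [of _ "zinv 1"] add.commute)
    then show ?thesis
      using top True by (simp add: x vanishes_below_def zinv_nth lower_def)
  next
    case False
    have "vertex_op A \<alpha> (sroot i) (hmon (add_mset x \<nu>)) 1 = dser (fw j) (Suc k) * ?F 1"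
    proof -
      have "?c gchoose (Suc k - r) = 0" if "r < Suc k" for r
        using False that by (cases "Suc k - r") (auto simp: dual)
      then have "(\<Sum>r<Suc k. dser (fw j) r * (zinv (int (Suc k - r)) * (cconst (?c gchoose (Suc k - r)) * ?F 1))) = 0"
        by (intro sum.neutral) auto
      then show ?thesis
        unfolding Y lessThan_Suc_atMost [symmetric] sum.lessThan_Suc [of _ "Suc k"] by simp
    qed
    then show ?thesis
      using top False by (simp add: x lower_def)
  qed
qed

text \<open>Generators that \<open>lower i\<close> turns into \<open>hsym (fw i) 0 = 1\<close> are dropped.\<close>

definition reduce :: "'l \<Rightarrow> ('l \<times> nat) multiset \<Rightarrow> ('l \<times> nat) multiset" where
  "reduce i \<nu> = image_mset (\<lambda>(j, k). (j, if j = i then k - 1 else k)) (filter_mset (\<lambda>x. x \<noteq> (i, 0)) \<nu>)"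

lemma mon_lower: "mon fw (image_mset (lower i) \<nu>) = hmon (reduce i \<nu>)"
proof (induction \<nu>)
  case (add x \<nu>)
  obtain j k where x: "x = (j, k)" by (metis surj_pair)
  show ?case
    using add by (cases "j = i"; cases k) (simp_all add: x lower_def reduce_def hmon_def)
qed (simp add: reduce_def hmon_def)

text \<open>Only pairs \<open>(i, 0)\<close> are lost, and their number is recovered by comparing
  \<open>num i\<close> before and after.\<close>

lemma reduce_inject:
  assumes "reduce i \<mu> = reduce i \<nu>" "num i \<mu> = num i \<nu>"
  shows "\<mu> = \<nu>"
proof -
  have restore: "\<nu> = image_mset (\<lambda>(j, k). (j, if j = i then Suc k else k)) (reduce i \<nu>) +
      replicate_mset (count \<nu> (i, 0)) (i, 0)"
    and num: "num i \<nu> = num i (reduce i \<nu>) + count \<nu> (i, 0)" for \<nu>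
  proof (induction \<nu>)
    case (add x \<nu>)
    obtain j k where x: "x = (j, k)" by (metis surj_pair)
    {
      case 1
      show ?case using add(1) by (cases "j = i"; cases k) (simp_all add: x reduce_def)
    next
      case 2
      show ?case using add(2) by (cases "j = i"; cases k) (simp_all add: x reduce_def)
    }
  qed (simp_all add: reduce_def)
  have "count \<mu> (i, 0) = count \<nu> (i, 0)" using num [of \<mu>] num [of \<nu>] assms by simp
  then have "image_mset (\<lambda>(j, k). (j, if j = i then Suc k else k)) (reduce i \<mu>) + replicate_mset (count \<mu> (i, 0)) (i, 0) =
      image_mset (\<lambda>(j, k). (j, if j = i then Suc k else k)) (reduce i \<nu>) + replicate_mset (count \<nu> (i, 0)) (i, 0)"
    by (simp only: assms(1))
  then show ?thesis unfolding restore [symmetric] .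
qed

text \<open>The coefficient at the largest occurring count \<open>D\<close> cannot cancel:
  \<open>reduce i\<close> is injective at fixed count, and distinct \<open>hmon\<close> are
  independent. For negative \<open>m\<close> the conclusion excludes every \<nu>, so
  \<open>p\<close> is zero.\<close>

lemma num_bound:
  assumes "vanishes_below (vertex_op A \<beta> (sroot i) (from_h p) 1) (- m)" "\<nu> \<in> Poly_Mapping.keys p"
  shows "int (num i \<nu>) \<le> m"
proof (rule ccontr)
  assume neg: "\<not> int (num i \<nu>) \<le> m"
  define D where "D = Max (num i ` Poly_Mapping.keys p)"
  have D: "num i \<mu> \<le> D" if "\<mu> \<in> Poly_Mapping.keys p" for \<mu>
    using that by (simp add: D_def)
  have "D \<in> num i ` Poly_Mapping.keys p"
    unfolding D_def using assms(2) by (intro Max_in) auto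
  then obtain \<nu>0 where \<nu>0: "\<nu>0 \<in> Poly_Mapping.keys p" "num i \<nu>0 = D" by auto
  have "- int D < - m" using D [OF assms(2)] neg by linarith
  then have "0 = fls_nth (vertex_op A \<beta> (sroot i) (from_h p) 1) (- int D)"
    using assms(1) by (simp add: vanishes_below_def)
  also have "\<dots> = (\<Sum>\<mu>\<in>Poly_Mapping.keys p. fconst (Poly_Mapping.lookup p \<mu>) *
      fls_nth (vertex_op A \<beta> (sroot i) (hmon \<mu>) 1) (- int D))"
    by (simp only: from_h_eq [of p] vertex_op_sum vertex_op_fconst_mult fls_nth_sum fls_mult_const_nth)
  also have "\<dots> = (\<Sum>\<mu>\<in>Poly_Mapping.keys p. if num i \<mu> = D then fconst (Poly_Mapping.lookup p \<mu>) * hmon (reduce i \<mu>) else 0)"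
  proof (rule sum.cong [OF refl])
    fix \<mu> assume "\<mu> \<in> Poly_Mapping.keys p"
    then have "num i \<mu> \<le> D" by (rule D)
    then have "fls_nth (vertex_op A \<beta> (sroot i) (hmon \<mu>) 1) (- int D) = (if num i \<mu> = D then hmon (reduce i \<mu>) else 0)"
      using vertex_op_hmon_lead [of \<beta> i \<mu>] by (auto simp: mon_lower vanishes_below_def)
    then show "fconst (Poly_Mapping.lookup p \<mu>) * fls_nth (vertex_op A \<beta> (sroot i) (hmon \<mu>) 1) (- int D) =
        (if num i \<mu> = D then fconst (Poly_Mapping.lookup p \<mu>) * hmon (reduce i \<mu>) else 0)"
      by simp
  qed
  also have "\<dots> = from_h (\<Sum>\<mu>\<in>Poly_Mapping.keys p. if num i \<mu> = D then Poly_Mapping.single (reduce i \<mu>) (Poly_Mapping.lookup p \<mu>) else 0)"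
    unfolding from_h_sum by (rule sum.cong) (simp_all add: from_h_single from_h_0)
  finally have "from_h (\<Sum>\<mu>\<in>Poly_Mapping.keys p. if num i \<mu> = D then Poly_Mapping.single (reduce i \<mu>) (Poly_Mapping.lookup p \<mu>) else 0) = from_h 0"
    by (simp only: from_h_0)
  then have "(\<Sum>\<mu>\<in>Poly_Mapping.keys p. if num i \<mu> = D then Poly_Mapping.single (reduce i \<mu>) (Poly_Mapping.lookup p \<mu>) else 0) = 0"
    by - (drule arg_cong [where f = to_h], simp only: to_h_from_h)
  then have "0 = Poly_Mapping.lookup (\<Sum>\<mu>\<in>Poly_Mapping.keys p. if num i \<mu> = D then Poly_Mapping.single (reduce i \<mu>) (Poly_Mapping.lookup p \<mu>) else 0) (reduce i \<nu>0)"
    by simp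
  also have "\<dots> = (\<Sum>\<mu>\<in>Poly_Mapping.keys p. if \<mu> = \<nu>0 then Poly_Mapping.lookup p \<mu> else 0)"
    unfolding lookup_sum
    by (intro sum.cong refl) (use \<nu>0 reduce_inject [of i] in \<open>auto simp: lookup_single when_def\<close>)
  also have "\<dots> = Poly_Mapping.lookup p \<nu>0" using \<nu>0 by simp
  finally show False using \<nu>0 by (simp add: in_keys_iff)
qed

lemma chg_eq_sum_num: "chg fw \<nu> = (\<Sum>i\<in>UNIV. of_nat (num i \<nu>) *s fw i)"
proof (induction \<nu>)
  case empty
  then show ?case by simp
next
  case (add x \<nu>)
  obtain j k where x: "x = (j, k)" by (metis surj_pair)
  have "(\<Sum>i\<in>UNIV. of_nat (num i (add_mset x \<nu>)) *s fw i) = (\<Sum>i\<in>UNIV. (if j = i then fw i else 0) + of_nat (num i \<nu>) *s fw i)"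
    by (rule sum.cong) (auto simp: x vector_sadd_rdistrib)
  then show ?case using add by (simp add: x sum.distrib)
qed

text \<open>Padding raises each count to exactly \<open>m i\<close>. The resulting charge has the
  same pairings with the simple roots as \<beta>, so it is \<beta> by
  \<open>fw_expand\<close>.\<close>

lemma hmon_in_mspan:
  assumes "\<And>i. bform A \<beta> (sroot i) = of_int (m i)" "\<And>i. int (num i \<nu>) \<le> m i"
  shows "hmon \<nu> \<in> mspan fw \<beta>"
proof -
  \<comment> \<open>\<open>S\<close> is the set of indices already padded; induction on it adds
    pairs \<open>(j, 0)\<close> for one index at a time.\<close>
  have "\<exists>\<mu>. mon fw \<mu> = hmon \<nu> \<and> (\<forall>i. num i \<mu> = num i \<nu> + (if i \<in> S then nat (m i) - num i \<nu> else 0))" if "finite S" for S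
    using that
  proof (induction S rule: finite_induct)
    case empty
    have "num i (image_mset (apsnd Suc) \<nu>) = num i \<nu>" for i by (induction \<nu>) auto
    then show ?case by (intro exI [of _ "image_mset (apsnd Suc) \<nu>"]) (simp add: hmon_def)
  next
    case (insert j S)
    then obtain \<mu> where \<mu>: "mon fw \<mu> = hmon \<nu>" "\<And>i. num i \<mu> = num i \<nu> + (if i \<in> S then nat (m i) - num i \<nu> else 0)" by blast
    define n where "n = nat (m j) - num j \<nu>"
    have mon: "mon fw (replicate_mset k (j, 0) + \<mu>) = mon fw \<mu>" for k
      by (induction k) simp_all
    have num: "num i (replicate_mset k (j, 0) + \<mu>) = (if j = i then k else 0) + num i \<mu>" for i k
      by (induction k) simp_all
    have "num i (replicate_mset n (j, 0) + \<mu>) = num i \<nu> + (if i \<in> insert j S then nat (m i) - num i \<nu> else 0)" for i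
    proof (cases "j = i")
      case True
      then have "num i \<mu> = num i \<nu>" using \<mu>(2) [of i] insert.hyps(2) by simp
      then show ?thesis unfolding num using True by (simp add: n_def)
    next
      case False
      then show ?thesis using \<mu>(2) [of i] by (simp only: num if_False add_0 insert_iff) simp
    qed
    then show ?case
      by (intro exI [of _ "replicate_mset n (j, 0) + \<mu>"]) (simp only: mon \<mu>(1) simp_thms)
  qed
  from this [OF finite] obtain \<mu> where \<mu>: "mon fw \<mu> = hmon \<nu>"
      "\<forall>i. num i \<mu> = num i \<nu> + (if i \<in> UNIV then nat (m i) - num i \<nu> else 0)" by blast
  have "bform A \<beta> (sroot i) = of_nat (num i \<mu>)" for i
  proof -
    have "m i = int (num i \<mu>)" using assms(2) [of i] spec [OF \<mu>(2), of i] by simp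
    then show ?thesis by (simp add: assms(1))
  qed
  then have "chg fw \<mu> = (\<Sum>i\<in>UNIV. bform A \<beta> (sroot i) *s fw i)" by (simp only: chg_eq_sum_num)
  also have "\<dots> = \<beta>" by (rule fw_expand [symmetric])
  finally have "chg fw \<mu> = \<beta>" .
  then show ?thesis using mon_in_mspan [of fw \<mu>] \<mu>(1) by simp
qed

end

section \<open>The commutant\<close>

lemma root_lattice_closed:
  "0 \<in> root_lattice" "x \<in> root_lattice \<Longrightarrow> y \<in> root_lattice \<Longrightarrow> x + y \<in> root_lattice" "sroot i \<in> root_lattice"
  by (auto simp: root_lattice_def axis_def)

lemma weight_lattice_closed:
  "0 \<in> weight_lattice A" "x \<in> weight_lattice A \<Longrightarrow> y \<in> weight_lattice A \<Longrightarrow> x + y \<in> weight_lattice A"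
  by (auto simp: weight_lattice_def bform_add_left)

lemma root_lattice_subset_weight_lattice:
  assumes "\<And>i j. A i j \<in> \<int>"
  shows "root_lattice \<subseteq> weight_lattice A"
  using assms by (auto simp: root_lattice_def weight_lattice_def bform_def intro!: Ints_sum Ints_mult)

text \<open>The charge of v(n) e^(\<alpha>_i) determines the charge of the contributing part of
  \<open>v\<close>, so the products can be examined one charge at a time.\<close>

lemma vmode_sroot_vanishes:
  assumes v: "\<And>n :: nat. vmode A \<epsilon> v (of_nat n) (vexpo (sroot i)) = 0"
    and \<epsilon>: "\<epsilon> \<beta> (sroot i) \<noteq> 0" and m: "bform A \<beta> (sroot i) = of_int m"
  shows "vanishes_below (vertex_op A \<beta> (sroot i) (Poly_Mapping.lookup v \<beta>) 1) (- m)"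
proof (cases "\<beta> \<in> Poly_Mapping.keys v")
  case True
  show ?thesis
    unfolding vanishes_below_def
  proof (intro allI impI)
    fix k assume k: "k < - m"
    \<comment> \<open>Solves \<open>m + k = - n - 1\<close>, and \<open>k < - m\<close> is precisely
      what makes \<open>n\<close> nonnegative.\<close>
    define n where "n = nat (- k - 1 - m)"
    have n: "int n = - k - 1 - m" using k by (simp add: n_def)
    have "(of_int k :: complex) = - of_nat n - 1 - of_int m"
    proof -
      have "k = - int n - 1 - m" using n by simp
      then show ?thesis by (metis of_int_diff of_int_minus of_int_of_nat_eq of_int_1)
    qed
    then have K: "{k'::int. bform A \<beta> (sroot i) + of_int k' = - of_nat n - 1} = {k}"
      using m by (auto simp: algebra_simps) (metis (no_types, opaque_lifting) add.commute add_left_cancel of_int_eq_iff of_int_add)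
    have "0 = Poly_Mapping.lookup (vmode A \<epsilon> v (of_nat n) (vexpo (sroot i))) (\<beta> + sroot i)"
      using v by simp
    also have "\<dots> = (\<Sum>\<alpha>\<in>Poly_Mapping.keys v. if \<alpha> = \<beta> then
        fconst (\<epsilon> \<alpha> (sroot i)) * (\<Sum>k'::int | bform A \<alpha> (sroot i) + of_int k' = - of_nat n - 1.
          fls_nth (vertex_op A \<alpha> (sroot i) (Poly_Mapping.lookup v \<alpha>) 1) k') else 0)"
      by (simp add: vmode_def vexpo_def lookup_sum lookup_single when_def)
    also have "\<dots> = fconst (\<epsilon> \<beta> (sroot i)) * fls_nth (vertex_op A \<beta> (sroot i) (Poly_Mapping.lookup v \<beta>) 1) k"
      using True K by simp
    finally have "fconst (1 / \<epsilon> \<beta> (sroot i)) * (fconst (\<epsilon> \<beta> (sroot i)) *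
        fls_nth (vertex_op A \<beta> (sroot i) (Poly_Mapping.lookup v \<beta>) 1) k) = 0"
      by simp
    then show "fls_nth (vertex_op A \<beta> (sroot i) (Poly_Mapping.lookup v \<beta>) 1) k = 0"
      unfolding fconst_inverse_cancel(1) [OF \<epsilon>] .
  qed
next
  case False
  then show ?thesis
    using vertex_op_fconst_mult [of A \<beta> "sroot i" 0 0 1] by (simp add: in_keys_iff vanishes_below_def)
qed

section \<open>The two inclusions and the charge decomposition\<close>

context
  fixes A :: "'l::finite \<Rightarrow> 'l \<Rightarrow> complex" and fw :: "'l \<Rightarrow> complex ^ 'l"
    and \<epsilon> :: "complex ^ 'l \<Rightarrow> complex ^ 'l \<Rightarrow> complex"
  assumes dual: "\<And>i j. bform A (fw i) (sroot j) = (if i = j then 1 else 0)"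
    and integral: "\<And>i j. A i j \<in> \<int>"
    and cocycle: "lattice_cocycle A \<epsilon>"
begin

lemma root_subset_weight: "root_lattice \<subseteq> weight_lattice A"
  by (rule root_lattice_subset_weight_lattice) (rule integral)

lemma fw_in_weight_lattice: "fw j \<in> weight_lattice A"
  unfolding weight_lattice_def
proof (intro CollectI ballI)
  fix y :: "complex ^ 'l" assume "y \<in> root_lattice"
  then show "bform A (fw j) y \<in> \<int>"
    by (auto simp: bform_expand [of A _ y] dual root_lattice_def intro!: Ints_sum Ints_mult)
qed

lemma chg_fw_in_weight_lattice: "chg fw \<nu> \<in> weight_lattice A"
  by (induction \<nu>) (auto simp: weight_lattice_closed fw_in_weight_lattice)

lemma mspan_in_principal_P:
  assumes "p \<in> mspan fw \<beta>"
  shows "Poly_Mapping.single \<beta> p \<in> principal_P A \<epsilon> fw"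
  unfolding principal_P_def generated_subalgebra_def
proof (intro InterI, elim CollectE conjE)
  fix U assume U: "vertex_subalgebra A \<epsilon> (lattice_va (weight_lattice A)) U" "range (\<lambda>i. vexpo (fw i)) \<subseteq> U"
  have subU: "lattice_module.subspace U" using U by (simp add: vertex_subalgebra_def)
  have "\<epsilon> (fw i) (chg fw \<nu>) \<noteq> 0" for i \<nu>
    using cocycle fw_in_weight_lattice chg_fw_in_weight_lattice by (simp add: lattice_cocycle_def)
  then have mon: "Poly_Mapping.single (chg fw \<nu>) (mon fw \<nu>) \<in> U" for \<nu>
    using U by (intro mon_in_generated) auto
  show "Poly_Mapping.single \<beta> p \<in> U"
    using assms unfolding mspan_def
  proof (induction rule: fock_space.span_induct_alt)
    case base
    show ?case using lattice_module.subspace_0 [OF subU] by simp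
  next
    case (step c s x)
    then obtain \<nu> where \<nu>: "s = mon fw \<nu>" "chg fw \<nu> = \<beta>" by blast
    have "Poly_Mapping.single \<beta> (fconst c * s) = vscale c (Poly_Mapping.single \<beta> s)"
      by (rule poly_mapping_eqI) (simp add: lookup_vscale lookup_single when_def)
    then show ?case
      using mon [of \<nu>] \<nu> step lattice_module.subspace_add [OF subU] lattice_module.subspace_scale [OF subU]
      by (simp add: single_add)
  qed
qed

text \<open>Testing \<open>v\<close> against the generators e^(\<alpha>_i) gives every bound on the
  counts that \<open>hmon_in_mspan\<close> requires.\<close>

lemma commutant_subset:
  "commutant A \<epsilon> (principal_Q A \<epsilon>) (lattice_va root_lattice) \<subseteq> lattice_mspan fw root_lattice"
proof
  fix v assume v: "v \<in> commutant A \<epsilon> (principal_Q A \<epsilon>) (lattice_va root_lattice)"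
  have gens: "vexpo (sroot i) \<in> principal_Q A \<epsilon>" for i
    by (auto simp: principal_Q_def generated_subalgebra_def)
  have v0: "vmode A \<epsilon> v (of_nat n) (vexpo (sroot i)) = 0" for n i
  proof -
    have "\<forall>n::real. n > -1 \<longrightarrow> vmode A \<epsilon> v (complex_of_real n) (vexpo (sroot i)) = 0"
      using v gens [of i] by (simp add: commutant_def)
    from spec [OF this, of "of_nat n"] show ?thesis by simp
  qed
  have vL: "v \<in> lattice_va root_lattice" using v by (simp add: commutant_def)
  moreover have "Poly_Mapping.lookup v \<beta> \<in> mspan fw \<beta>" for \<beta>
  proof (cases "\<beta> \<in> Poly_Mapping.keys v")
    case True
    then have \<beta>: "\<beta> \<in> root_lattice" using vL by (auto simp: lattice_va_def)
    then have \<beta>W: "\<beta> \<in> weight_lattice A" using root_subset_weight by blast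
    then have "bform A \<beta> (sroot i) \<in> \<int>" for i
      using root_lattice_closed(3) [of i] by (simp add: weight_lattice_def)
    then have "\<forall>i. \<exists>m. bform A \<beta> (sroot i) = of_int m" by (meson Ints_cases)
    then obtain m where m: "\<And>i. bform A \<beta> (sroot i) = of_int (m i)" by metis
    obtain p where p: "Poly_Mapping.lookup v \<beta> = from_h fw p" using from_h_surj [OF dual] by blast
    have "vanishes_below (vertex_op A \<beta> (sroot i) (from_h fw p) 1) (- m i)" for i
      unfolding p [symmetric]
    proof (rule vmode_sroot_vanishes [OF v0 _ m])
      show "\<epsilon> \<beta> (sroot i) \<noteq> 0"
        using cocycle \<beta>W root_subset_weight root_lattice_closed(3)
        by (auto simp: lattice_cocycle_def)
    qed
    then have "hmon fw \<nu> \<in> mspan fw \<beta>" if "\<nu> \<in> Poly_Mapping.keys p" for \<nu>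
      using num_bound [OF dual _ that] hmon_in_mspan [OF dual m] by blast
    then show ?thesis
      unfolding p from_h_eq [OF dual]
      by (intro fock_space.subspace_sum [OF subspace_mspan] fock_space.subspace_scale [OF subspace_mspan])
  next
    case False
    then show ?thesis using fock_space.subspace_0 [OF subspace_mspan [of fw \<beta>]] by (simp add: in_keys_iff)
  qed
  ultimately show "v \<in> lattice_mspan fw root_lattice" by (simp add: lattice_mspan_def)
qed

text \<open>For elements of W_Q it is enough that they lie in the span
  \<open>lattice_mspan sroot root_lattice\<close>, as regularity holds for all products with that
  span.\<close>

lemma lattice_mspan_subset_commutant:
  "lattice_mspan fw root_lattice \<subseteq> commutant A \<epsilon> (principal_Q A \<epsilon>) (lattice_va root_lattice)"
proof
  fix v assume v: "v \<in> lattice_mspan fw root_lattice"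
  have "vmode A \<epsilon> v (complex_of_real n) s = 0" if s: "s \<in> principal_Q A \<epsilon>" and n: "n > - 1" for s n
  proof -
    have s': "s \<in> lattice_mspan sroot root_lattice"
      using s generated_subset_lattice_mspan [of root_lattice sroot A \<epsilon>] root_lattice_closed
      by (auto simp: principal_Q_def)
    have "fls_nth (vertex_op A \<beta> \<delta> (Poly_Mapping.lookup v \<beta>) (Poly_Mapping.lookup s \<delta>)) k = 0"
      if \<delta>: "\<delta> \<in> Poly_Mapping.keys s" and k: "bform A \<beta> \<delta> + of_int k = - complex_of_real n - 1" for \<beta> \<delta> k
    proof -
      have w: "Poly_Mapping.lookup s \<delta> \<in> mspan sroot \<delta>" using s' by (simp add: lattice_mspan_def)
      \<comment> \<open>A charge occurring in \<open>s\<close> is a sum of simple roots, because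
        otherwise \<open>mspan sroot \<delta>\<close> is spanned by the empty set. This makes the
        pairings with the fundamental weights natural numbers.\<close>
      obtain \<rho> where \<rho>: "chg sroot \<rho> = \<delta>"
      proof (rule ccontr)
        assume "\<not> thesis"
        then have "{mon sroot \<nu> | \<nu>. chg sroot \<nu> = \<delta>} = {}" using that by blast
        then have "Poly_Mapping.lookup s \<delta> = 0" using w by (simp add: mspan_def)
        then show False using \<delta> by (simp add: in_keys_iff)
      qed
      let ?d = "\<lambda>i j :: 'l. if i = j then 1 else 0 :: nat" and ?c = "\<lambda>i. \<Sum>(j, n)\<in>#\<rho>. if i = j then 1 else 0 :: nat"
      have d: "bform A (fw i) (sroot j) = of_nat (?d i j)" for i j by (simp add: dual)
      have c: "bform A (fw i) \<delta> = of_nat (?c i)" for i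
        unfolding \<rho> [symmetric] by (rule bform_chg [OF d])
      have "Poly_Mapping.lookup v \<beta> \<in> mspan fw \<beta>" using v by (simp add: lattice_mspan_def)
      then have "fls_nth (vertex_op A \<beta> \<delta> (Poly_Mapping.lookup v \<beta>) (Poly_Mapping.lookup s \<delta>)) k \<in> {0}"
      proof (rule vertex_op_mspan)
        fix \<nu> assume \<nu>: "chg fw \<nu> = \<beta>"
        define M where "M = (\<Sum>(i, n)\<in>#\<nu>. ?c i)"
        have "vanishes_below (vertex_op A \<beta> \<delta> (mon fw \<nu>) (Poly_Mapping.lookup s \<delta>)) (- int M)"
          using vertex_op_mon_regular [where g = fw and h = sroot and d = ?d and c = ?c, OF d c w, of \<nu>]
          unfolding \<nu> M_def .
        moreover have "bform A \<beta> \<delta> = of_nat M"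
          unfolding \<nu> [symmetric] M_def by (induction \<nu>) (auto simp: bform_add_left c)
        then have "complex_of_real (real M + real_of_int k) = complex_of_real (- n - 1)"
          using k by simp
        then have "real M + real_of_int k = - n - 1" by (simp only: of_real_eq_iff)
        \<comment> \<open>Since (\<beta>|\<delta>) equals the pole bound \<open>M\<close>, every
          mode \<open>n > -1\<close> reads a coefficient below the lowest order.\<close>
        then have "k < - int M" using n by linarith
        ultimately show "fls_nth (vertex_op A \<beta> \<delta> (mon fw \<nu>) (Poly_Mapping.lookup s \<delta>)) k \<in> {0}"
          by (simp add: vanishes_below_def)
      qed (rule fock_space.subspace_single_0)
      then show ?thesis by simp
    qed
    then show ?thesis
      unfolding vmode_def by (intro sum.neutral ballI) simp
  qed
  then show "v \<in> commutant A \<epsilon> (principal_Q A \<epsilon>) (lattice_va root_lattice)"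
    using v by (auto simp: commutant_def lattice_mspan_def)
qed

text \<open>The direct sum over Q is encoded as a span. Each element is the finite sum of its charge
  components, and each component lies in W_P by \<open>mspan_in_principal_P\<close>.\<close>

lemma span_charge_parts:
  "lattice_module.span (\<Union>\<beta>\<in>root_lattice. charge_part (principal_P A \<epsilon> fw) \<beta>) = lattice_mspan fw root_lattice"
proof
  have "principal_P A \<epsilon> fw \<subseteq> lattice_mspan fw (weight_lattice A)"
    unfolding principal_P_def
    by (rule generated_subset_lattice_mspan) (auto intro: weight_lattice_closed fw_in_weight_lattice)
  then have "(\<Union>\<beta>\<in>root_lattice. charge_part (principal_P A \<epsilon> fw) \<beta>) \<subseteq> lattice_mspan fw root_lattice"
    by (auto simp: charge_part_def lattice_mspan_def lattice_va_def)
  then show "lattice_module.span (\<Union>\<beta>\<in>root_lattice. charge_part (principal_P A \<epsilon> fw) \<beta>) \<subseteq> lattice_mspan fw root_lattice"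
    by (rule lattice_module.span_minimal) (rule subspace_lattice_mspan)
next
  show "lattice_mspan fw root_lattice \<subseteq> lattice_module.span (\<Union>\<beta>\<in>root_lattice. charge_part (principal_P A \<epsilon> fw) \<beta>)"
  proof
    fix v assume v: "v \<in> lattice_mspan fw root_lattice"
    show "v \<in> lattice_module.span (\<Union>\<beta>\<in>root_lattice. charge_part (principal_P A \<epsilon> fw) \<beta>)"
    proof (subst poly_mapping_sum_single [symmetric, of v], rule lattice_module.span_sum, rule lattice_module.span_base)
      fix \<beta> assume "\<beta> \<in> Poly_Mapping.keys v"
      then have "\<beta> \<in> root_lattice" using v by (auto simp: lattice_mspan_def lattice_va_def)
      moreover have "Poly_Mapping.single \<beta> (Poly_Mapping.lookup v \<beta>) \<in> principal_P A \<epsilon> fw"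
        using v by (intro mspan_in_principal_P) (simp add: lattice_mspan_def)
      ultimately show "Poly_Mapping.single \<beta> (Poly_Mapping.lookup v \<beta>) \<in> (\<Union>\<beta>\<in>root_lattice. charge_part (principal_P A \<epsilon> fw) \<beta>)"
        by (auto simp: charge_part_def lattice_va_def)
    qed
  qed
qed

end

theorem corollary7p2:
  fixes scale :: "complex \<Rightarrow> 'g::ab_group_add \<Rightarrow> 'g"
    and bracket :: "'g \<Rightarrow> 'g \<Rightarrow> 'g"
    and H :: "'g set"
    and \<kappa> :: "'g \<Rightarrow> 'g \<Rightarrow> complex"
    and \<alpha> :: "'l::finite \<Rightarrow> 'g"
    and A :: "'l \<Rightarrow> 'l \<Rightarrow> complex"
    and fw :: "'l \<Rightarrow> complex ^ 'l"
    and \<epsilon> :: "complex ^ 'l \<Rightarrow> complex ^ 'l \<Rightarrow> complex"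
  assumes "simply_laced_lie_algebra scale bracket H \<kappa> \<alpha>"
    and "\<And>i j. A i j = \<kappa> (\<alpha> i) (\<alpha> j)"
    and "\<And>i j. bform A (fw i) (sroot j) = (if i = j then 1 else 0)"
    and "lattice_cocycle A \<epsilon>"
  shows "commutant A \<epsilon> (principal_Q A \<epsilon>) (lattice_va root_lattice) =
    module.span vscale (\<Union>\<beta>\<in>root_lattice. charge_part (principal_P A \<epsilon> fw) \<beta>)"
proof -
  interpret simply_laced_lie_algebra scale bracket H \<kappa> \<alpha> by fact
  \<comment> \<open>Integrality gives the inclusion of Q in P, hence nonzero cocycle values on Q and
    integer pairings of \<beta> with the simple roots.\<close>
  have integral: "A i j \<in> \<int>" for i j
    unfolding assms(2) by (rule root_form_Ints [OF simple_root simple_root])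
  note ctx = assms(3) integral assms(4)
  show ?thesis
    using commutant_subset [of A fw \<epsilon>, OF ctx] lattice_mspan_subset_commutant [of A fw \<epsilon>, OF ctx]
      span_charge_parts [of A fw \<epsilon>, OF ctx] by blast
qed

end
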